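(* Assume $\zeta>0$. Let $F\subset(0,\zeta)$ be a co-countable set (i.e. $(0,\zeta)\setminus F$ is at most countable) on which the convex functions $\widehat R$ and $\widehat C$ are differentiable. Put $$\{\widehat q(z)\}=\arg\max_{q\in\mathrm{co}\,Q}\{\widetilde R(q)-qz\},\quad \{\widehat\alpha(z)\}=\arg\max_{\alpha\in\mathrm{co}\,A}\{\alpha z-\widetilde C(\alpha)\},\quad z\in F,$$ $$\widehat u\in\arg\max\{\widetilde R(u)-\widetilde C(u):u\in\mathrm{co}\,Q\cap\mathrm{co}\,A\}.$$ For given initial inventory $x>0$ put $$\tau=\frac1\beta\ln\frac{v'(0)}{v'(x)}$$ and define $X_t\in[0,x]$, $t\in[0,\tau]$, by the equation $v'(X_t)=v'(x)e^{\beta t}$. Furthermore, put $\mathscr T=\{t\in[0,\tau]:v'(X_t)\in F\}$ and consider the strategy (a) $\alpha^*_t=\widehat\alpha(v'(X_t))$, $q^*_t=\widehat q(v'(X_t))$ for $t\in\mathscr T$; (b) $\alpha^*_t=q^*_t=\widehat u$ for $t>\tau$; on the countable set $[0,\tau]\setminus\mathscr T$ the values $\alpha^*_t$, $q^*_t$ can be defined in an arbitrary way (within the control sets of the problem under consideration). Then: (i) The strategy given by (a), (b) is optimal for the convexified problem with initial inventory $x$, i.e. attains the supremum defining $\widetilde v(x)$. (ii) For $t\in\mathscr T$ we have $\alpha^*_t\in A$, $q^*_t\in Q$, $\widetilde C(\alpha^*_t)=C(\alpha^*_t)$ and $\widetilde R(q^*_t)=R(q^*_t)$. (iii) There exist $q^i\in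 Q$, $\alpha^i\in A$, $i=1,2$, and $\gamma,\nu\in(0,1)$ such that $$\widehat u=\gamma q^1+(1-\gamma)q^2=\nu\alpha^1+(1-\nu)\alpha^2,$$ $$\widetilde R(\widehat u)=\gamma R(q^1)+(1-\gamma)R(q^2),\quad \widetilde C(\widehat u)=\nu C(\alpha^1)+(1-\nu)C(\alpha^2).$$ Replacing (b) by the static relaxed control $$\overline q(dy)=\gamma\delta_{q^1}(dy)+(1-\gamma)\delta_{q^2}(dy),\quad \overline\alpha(dy)=\nu\delta_{\alpha^1}(dy)+(1-\nu)\delta_{\alpha^2}(dy)\quad\text{for }t>\tau$$ (and regarding the ordinary controls on $[0,\tau]$ as Dirac measures), we get a solution of the relaxed problem with initial inventory $x$, i.e. the supremum defining $v_r(x)$ is attained. (iv) If $\mathscr M_\zeta\neq\emptyset$, then replacing $\widehat u$ in (b) by $$\widehat u\in\arg\max_{u\in Q\cap A}\{R(u)-C(u)\},$$ we get an optimal solution of the original problem with initial inventory $x$, i.e. the supremum defining $v(x)$ is attained.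
   Context: Setting. $\mathbb R_+=[0,\infty)$. $A\subset\mathbb R_+$ is a closed set and $Q\subset\mathbb R_+$ is a compact set, with $0\in A\cap Q$, $A\setminus\{0\}\ne\emptyset$, $Q\setminus\{0\}\neq\emptyset$. The revenue $R:Q\to\mathbb R_+$ is continuous with $R(0)=0$. The production cost $C:A\to\mathbb R_+$ is continuous and non-decreasing; if $A$ is unbounded, then additionally $C(\alpha)/\alpha\to+\infty$ as $A\ni\alpha\to+\infty$. The constant $\beta>0$ is fixed. Original problem. For $x\ge 0$, $\mathscr A(x)$ is the set of pairs of Borel measurable functions $\alpha:\mathbb R_+\to A$, $q:\mathbb R_+\to Q$ (with $\alpha$ locally integrable) such that $x+\int_0^t(\alpha_s-q_s)\,ds\ge 0$ for all $t\ge 0$, and $$v(x)=\sup_{(\alpha,q)\in\mathscr A(x)}\int_0^\infty e^{-\beta t}(R(q_t)-C(\alpha_t))\,dt.$$ Convexified problem. For $G\subset\mathbb R$, $\mathrm{co}\,G$ is the intersection of all intervals containing $G$. Put $C=+\infty$ off $A$ and $R=-\infty$ off $Q$. For $f:\mathbb R\to(-\infty,+\infty]$ with $\mathrm{dom} f=\{f<\infty\}$, $$(\mathrm{co} f)(x)=\inf\{\delta f(x_1)+(1-\delta)f(x_2):\delta\in[0,1],\ x_i\in\mathrm{dom} f,\ \delta x_1+(1-\delta)x_2=x\}.$$ Let $\widetilde C=\mathrm{co}\,C$ and $\widetilde R=-\mathrm{co}(-R)$ (finite exactly on $\mathrm{co}\,A$ and $\mathrm{co}\,Q$ respectively). Let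 $\widetilde{\mathscr A}(x)$ be the set of pairs of Borel measurable functions $\alpha:\mathbb R_+\to\mathrm{co}\,A$, $q:\mathbb R_+\to\mathrm{co}\,Q$ ($\alpha$ locally integrable) with $x+\int_0^t(\alpha_s-q_s)\,ds\ge0$ for all $t\ge0$, and $$\widetilde v(x)=\sup_{(\alpha,q)\in\widetilde{\mathscr A}(x)}\int_0^\infty e^{-\beta t}(\widetilde R(q_t)-\widetilde C(\alpha_t))\,dt.$$ Relaxed problem. Relaxed controls $q_t(dy)$, $\alpha_t(dy)$ are mappings from $[0,\infty)$ to the sets of probability measures on $Q$ and $A$ respectively such that $t\mapsto\int_Q\varphi(y)\,q_t(dy)$ and $t\mapsto\int_A\varphi(y)\,\alpha_t(dy)$ are Borel measurable for every bounded continuous function $\varphi$. The class $\mathscr A_r(x)$ consists of those relaxed controls (with $t\mapsto\int_A y\,\alpha_t(dy)$ locally integrable) for which $x+\int_0^t\int_A y\,\alpha_s(dy)\,ds-\int_0^t\int_Q y\,q_s(dy)\,ds\ge0$ for all $t\ge0$, and $$v_r(x)=\sup_{(\alpha,q)\in\mathscr A_r(x)}\left(\int_0^\infty e^{-\beta t}\int_Q R(y)\,q_t(dy)\,dt-\int_0^\infty e^{-\beta t}\int_A C(y)\,\alpha_t(dy)\,dt\right).$$ $\delta_a$ denotes the Dirac measure concentrated at $a$. Hamiltonian and notation. For $z\in\mathbb R$, $$\widehat R(z)=\sup_{q\in Q}\{R(q)-qz\},\quad \widehat C(z)=\sup_{\alpha\in A}\{\alpha z-C(\alpha)\},\quad H(z)=\widehat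 R(z)+\widehat C(z),$$ all finite convex functions. The set of minimum points of $H$ over $\mathbb R$ is a non-empty closed convex subset of $\mathbb R_+$, and $\zeta\ge0$ is the least minimum point of $H$. Further, $\mathscr M_\zeta=\arg\max_{q\in Q}\{R(q)-\zeta q\}\cap\arg\max_{\alpha\in A}\{\alpha\zeta-C(\alpha)\}$. Well-definedness. If $\zeta>0$, then $v$ is continuously differentiable on $[0,\infty)$ (with $v'(0)$ the right derivative), and $v'$ is a continuous strictly decreasing bijection of $[0,\infty)$ onto $(0,\zeta]$, with $v'(0)=\zeta$; so $\tau$ and $X_t$ are well defined. For $z\in F$ the two argmax sets defining $\widehat q(z)$ and $\widehat\alpha(z)$ are singletons, $\widehat q(z)=-\widehat R'(z)$ and $\widehat\alpha(z)=\widehat C'(z)$. *)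

theory Defs
  imports "HOL-Probability.Probability"
begin

text \<open>
  Throughout, \<open>A\<close> and \<open>Q\<close> are the sets of admissible production and selling rates, and
  \<open>R\<close> and \<open>C\<close> are the revenue and the production cost. Only the values of \<open>R\<close> on \<open>Q\<close> and of
  \<open>C\<close> on \<open>A\<close> matter.
\<close>

definition argmax_set :: "('a \<Rightarrow> 'b::ord) \<Rightarrow> 'a set \<Rightarrow> 'a set" where
  "argmax_set f S = {u. is_arg_max f (\<lambda>y. y \<in> S) u}"

definition co_set :: "real set \<Rightarrow> real set" where
  "co_set G = \<Inter>{I. is_interval I \<and> G \<subseteq> I}"

text \<open>Meant for functions that do not take the value \<open>-\<infinity>\<close>; the infimum of the empty set is \<open>\<infinity>\<close>.\<close>

definition co_fun :: "(real \<Rightarrow> ereal) \<Rightarrow> real \<Rightarrow> ereal" where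
  "co_fun f x = Inf {ereal \<delta> * f x1 + ereal (1 - \<delta>) * f x2 | \<delta> x1 x2.
     0 \<le> \<delta> \<and> \<delta> \<le> 1 \<and> f x1 < \<infinity> \<and> f x2 < \<infinity> \<and> \<delta> * x1 + (1 - \<delta>) * x2 = x}"

definition ext_cost :: "real set \<Rightarrow> (real \<Rightarrow> real) \<Rightarrow> real \<Rightarrow> ereal" where
  "ext_cost A C a = (if a \<in> A then ereal (C a) else \<infinity>)"

definition ext_revenue :: "real set \<Rightarrow> (real \<Rightarrow> real) \<Rightarrow> real \<Rightarrow> ereal" where
  "ext_revenue Q R q = (if q \<in> Q then ereal (R q) else -\<infinity>)"

definition cvx_cost :: "real set \<Rightarrow> (real \<Rightarrow> real) \<Rightarrow> real \<Rightarrow> ereal" where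
  "cvx_cost A C = co_fun (ext_cost A C)"

definition ccv_revenue :: "real set \<Rightarrow> (real \<Rightarrow> real) \<Rightarrow> real \<Rightarrow> ereal" where
  "ccv_revenue Q R y = - co_fun (\<lambda>q. - ext_revenue Q R q) y"

text \<open>
  Lebesgue integral over \<open>S\<close> of an extended real function, as the integral of the positive part
  minus that of the negative part (\<^const>\<open>e2ennreal\<close> maps negative numbers to 0). It is only
  applied where the positive part or the negative part has a finite integral: \<open>R\<close> is bounded
  on \<open>Q\<close> and \<open>C\<close> is nonnegative on \<open>A\<close>, but the discounted total cost may be infinite.
\<close>

definition ext_integral :: "'a measure \<Rightarrow> 'a set \<Rightarrow> ('a \<Rightarrow> ereal) \<Rightarrow> ereal" where
  "ext_integral M S f =
     enn2ereal (\<integral>\<^sup>+ t\<in>S. e2ennreal (f t) \<partial>M) - enn2ereal (\<integral>\<^sup>+ t\<in>S. e2ennreal (- f t) \<partial>M)"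

text \<open>
  Ordinary controls. The original problem uses the sets \<open>A\<close>, \<open>Q\<close> and the functions
  \<^const>\<open>ext_cost\<close>, \<^const>\<open>ext_revenue\<close>; the convexified problem uses the sets
  \<open>co_set A\<close>, \<open>co_set Q\<close> and the functions \<^const>\<open>cvx_cost\<close>, \<^const>\<open>ccv_revenue\<close>.
  Controls are functions on the whole line whose values at negative times are ignored.
\<close>

definition controls :: "real set \<Rightarrow> real set \<Rightarrow> real \<Rightarrow> ((real \<Rightarrow> real) \<times> (real \<Rightarrow> real)) set" where
  "controls A Q x = {(\<alpha>, q).
     \<alpha> \<in> borel_measurable (restrict_space borel {0..}) \<and> (\<forall>t\<ge>0. \<alpha> t \<in> A) \<and>
     q \<in> borel_measurable (restrict_space borel {0..}) \<and> (\<forall>t\<ge>0. q t \<in> Q) \<and>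
     (\<forall>t\<ge>0. set_integrable lborel {0..t} \<alpha>) \<and>
     (\<forall>t\<ge>0. x + (LINT s:{0..t}|lborel. \<alpha> s - q s) \<ge> 0)}"

definition payoff ::
  "real \<Rightarrow> (real \<Rightarrow> ereal) \<Rightarrow> (real \<Rightarrow> ereal) \<Rightarrow> (real \<Rightarrow> real) \<times> (real \<Rightarrow> real) \<Rightarrow> ereal" where
  "payoff \<beta> r c = (\<lambda>(\<alpha>, q).
     ext_integral lborel {0..} (\<lambda>t. ereal (exp (- \<beta> * t)) * (r (q t) - c (\<alpha> t))))"

definition orig_value ::
  "real set \<Rightarrow> real set \<Rightarrow> (real \<Rightarrow> real) \<Rightarrow> (real \<Rightarrow> real) \<Rightarrow> real \<Rightarrow> real \<Rightarrow> ereal" where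
  "orig_value A Q R C \<beta> x =
     (SUP p\<in>controls A Q x. payoff \<beta> (ext_revenue Q R) (ext_cost A C) p)"

definition conv_value ::
  "real set \<Rightarrow> real set \<Rightarrow> (real \<Rightarrow> real) \<Rightarrow> (real \<Rightarrow> real) \<Rightarrow> real \<Rightarrow> real \<Rightarrow> ereal" where
  "conv_value A Q R C \<beta> x =
     (SUP p\<in>controls (co_set A) (co_set Q) x. payoff \<beta> (ccv_revenue Q R) (cvx_cost A C) p)"

text \<open>
  Derivative on \<open>[0,\<infinity>)\<close> of the (finite) value function of the original problem: the two-sided
  derivative at \<open>x > 0\<close>, the right derivative at 0.
\<close>

definition value_deriv ::
  "real set \<Rightarrow> real set \<Rightarrow> (real \<Rightarrow> real) \<Rightarrow> (real \<Rightarrow> real) \<Rightarrow> real \<Rightarrow> real \<Rightarrow> real" where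
  "value_deriv A Q R C \<beta> x =
     vector_derivative (\<lambda>y. real_of_ereal (orig_value A Q R C \<beta> y)) (at x within {0..})"

text \<open>Probability measures on a Borel set \<open>S\<close> are Borel measures on the line concentrated on \<open>S\<close>.\<close>

definition prob_measures_on :: "real set \<Rightarrow> real measure set" where
  "prob_measures_on S = {\<mu>. prob_space \<mu> \<and> sets \<mu> = sets borel \<and> emeasure \<mu> S = 1}"

definition relaxed_map :: "real set \<Rightarrow> (real \<Rightarrow> real measure) \<Rightarrow> bool" where
  "relaxed_map S \<mu> \<longleftrightarrow> (\<forall>t\<ge>0. \<mu> t \<in> prob_measures_on S) \<and>
     (\<forall>\<phi>::real \<Rightarrow> real. continuous_on S \<phi> \<longrightarrow> bounded (\<phi> ` S) \<longrightarrow>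
        (\<lambda>t. LINT y:S|\<mu> t. \<phi> y) \<in> borel_measurable (restrict_space borel {0..}))"

text \<open>
  Local integrability of \<open>t \<mapsto> \<integral> y \<alpha>\<^sub>t(dy) \<in> [0,\<infinity>]\<close> has to include that this mean is finite for
  almost every \<open>t\<close>, since the Bochner integral of a non-integrable function is 0.
\<close>

definition relaxed_controls ::
  "real set \<Rightarrow> real set \<Rightarrow> real \<Rightarrow> ((real \<Rightarrow> real measure) \<times> (real \<Rightarrow> real measure)) set" where
  "relaxed_controls A Q x = {(\<alpha>, q).
     relaxed_map A \<alpha> \<and> relaxed_map Q q \<and>
     (AE t in lborel. t \<ge> 0 \<longrightarrow> set_integrable (\<alpha> t) A (\<lambda>y. y)) \<and>
     (\<forall>t\<ge>0. set_integrable lborel {0..t} (\<lambda>s. LINT y:A|\<alpha> s. y)) \<and>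
     (\<forall>t\<ge>0. x + (LINT s:{0..t}|lborel. (LINT y:A|\<alpha> s. y))
               - (LINT s:{0..t}|lborel. (LINT y:Q|q s. y)) \<ge> 0)}"

definition relaxed_payoff ::
  "real set \<Rightarrow> real set \<Rightarrow> (real \<Rightarrow> real) \<Rightarrow> (real \<Rightarrow> real) \<Rightarrow> real \<Rightarrow>
   (real \<Rightarrow> real measure) \<times> (real \<Rightarrow> real measure) \<Rightarrow> ereal" where
  "relaxed_payoff A Q R C \<beta> = (\<lambda>(\<alpha>, q).
     ext_integral lborel {0..} (\<lambda>t. ereal (exp (- \<beta> * t)) * ext_integral (q t) Q (\<lambda>y. ereal (R y)))
   - ext_integral lborel {0..} (\<lambda>t. ereal (exp (- \<beta> * t)) * ext_integral (\<alpha> t) A (\<lambda>y. ereal (C y))))"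

definition relaxed_value ::
  "real set \<Rightarrow> real set \<Rightarrow> (real \<Rightarrow> real) \<Rightarrow> (real \<Rightarrow> real) \<Rightarrow> real \<Rightarrow> real \<Rightarrow> ereal" where
  "relaxed_value A Q R C \<beta> x = (SUP p\<in>relaxed_controls A Q x. relaxed_payoff A Q R C \<beta> p)"

text \<open>The measure \<open>\<gamma> \<delta>\<^sub>a + (1 - \<gamma>) \<delta>\<^sub>b\<close>; \<open>return borel a\<close> is the Dirac measure at \<open>a\<close>.\<close>

definition dirac_mix :: "real \<Rightarrow> real \<Rightarrow> real \<Rightarrow> real measure" where
  "dirac_mix \<gamma> a b = measure_of UNIV (sets borel)
     (\<lambda>B. ennreal \<gamma> * emeasure (return borel a) B + ennreal (1 - \<gamma>) * emeasure (return borel b) B)"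

definition R_hat :: "real set \<Rightarrow> (real \<Rightarrow> real) \<Rightarrow> real \<Rightarrow> real" where
  "R_hat Q R z = (SUP q\<in>Q. R q - q * z)"

definition C_hat :: "real set \<Rightarrow> (real \<Rightarrow> real) \<Rightarrow> real \<Rightarrow> real" where
  "C_hat A C z = (SUP a\<in>A. a * z - C a)"

definition hamiltonian ::
  "real set \<Rightarrow> real set \<Rightarrow> (real \<Rightarrow> real) \<Rightarrow> (real \<Rightarrow> real) \<Rightarrow> real \<Rightarrow> real" where
  "hamiltonian A Q R C z = R_hat Q R z + C_hat A C z"

definition zeta :: "real set \<Rightarrow> real set \<Rightarrow> (real \<Rightarrow> real) \<Rightarrow> (real \<Rightarrow> real) \<Rightarrow> real" where
  "zeta A Q R C = (LEAST z. is_arg_min (hamiltonian A Q R C) (\<lambda>_. True) z)"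

definition M_zeta :: "real set \<Rightarrow> real set \<Rightarrow> (real \<Rightarrow> real) \<Rightarrow> (real \<Rightarrow> real) \<Rightarrow> real set" where
  "M_zeta A Q R C =
     argmax_set (\<lambda>q. R q - zeta A Q R C * q) Q \<inter> argmax_set (\<lambda>a. a * zeta A Q R C - C a) A"

definition q_hat :: "real set \<Rightarrow> (real \<Rightarrow> real) \<Rightarrow> real \<Rightarrow> real" where
  "q_hat Q R z = the_elem (argmax_set (\<lambda>q. ccv_revenue Q R q - ereal (q * z)) (co_set Q))"

definition alpha_hat :: "real set \<Rightarrow> (real \<Rightarrow> real) \<Rightarrow> real \<Rightarrow> real" where
  "alpha_hat A C z = the_elem (argmax_set (\<lambda>a. ereal (a * z) - cvx_cost A C a) (co_set A))"

text \<open>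
  Controls that are equal to \<open>f\<close> on \<open>T\<close>, equal to the constant \<open>u\<close> after time \<open>\<tau>\<close>, and arbitrary
  within the control set \<open>U\<close> on the rest of \<open>[0,\<tau>]\<close>.
\<close>

definition switching :: "real set \<Rightarrow> real \<Rightarrow> (real \<Rightarrow> 'a) \<Rightarrow> 'a \<Rightarrow> 'a set \<Rightarrow> (real \<Rightarrow> 'a) set" where
  "switching T \<tau> f u U =
     {g. (\<forall>t\<in>T. g t = f t) \<and> (\<forall>t\<in>{0..\<tau>} - T. g t \<in> U) \<and> (\<forall>t>\<tau>. g t = u)}"

end

theory Submission
  imports Defs
begin

text \<open>
  All three problems are solved by Lagrangian duality, without a Hamilton-Jacobi-Bellman
  equation. For a number \<open>p \<in> (0,\<zeta>]\<close> let the costate be \<open>p\<^sub>t = min (p e\<^sup>\<beta>\<^sup>t) \<zeta>\<close>. By definition of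
  the conjugates, \<open>R(q) \<le> R\<^sup>*(z) + z q\<close> and \<open>C(\<alpha>) \<ge> z \<alpha> - C\<^sup>*(z)\<close>, so every admissible control
  satisfies \<open>R(q\<^sub>t) - C(\<alpha>\<^sub>t) \<le> H(p\<^sub>t) - p\<^sub>t (\<alpha>\<^sub>t - q\<^sub>t)\<close>; the same inequality holds for the convexified
  functions and for the averages under relaxed controls. The discounted costate
  \<open>e\<^sup>-\<^sup>\<beta>\<^sup>t p\<^sub>t = min p (\<zeta> e\<^sup>-\<^sup>\<beta>\<^sup>t)\<close> is nonincreasing and the inventory is nonnegative, hence the
  second mean value theorem bounds the integral of \<open>e\<^sup>-\<^sup>\<beta>\<^sup>t p\<^sub>t (\<alpha>\<^sub>t - q\<^sub>t)\<close> from below by \<open>- p x\<close>.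
  The result is the upper bound \<open>dual x p = x p + \<integral> e\<^sup>-\<^sup>\<beta>\<^sup>t H(p\<^sub>t) dt\<close>, valid for every \<open>p\<close> and for all
  three problems (\<open>payoff_le_dual\<close>, \<open>relaxed_payoff_le_dual\<close>).

  Equality requires that the rates maximize the Hamiltonian at \<open>p\<^sub>t\<close>, that the inventory
  vanishes when the costate reaches \<open>\<zeta>\<close>, and that it stays at zero afterwards. The first
  condition makes the inventory decrease with speed \<open>- H'(p\<^sub>t)\<close>; counted backwards from the time
  of depletion it is \<open>stock s = \<integral>\<^sub>0\<^sup>s - H'(\<zeta> e\<^sup>-\<^sup>\<beta>\<^sup>r) dr\<close>. Since \<open>\<zeta>\<close> is the least minimum point
  of \<open>H\<close>, the integrand is positive and nondecreasing in \<open>r\<close>, so \<open>stock\<close> is an increasing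
  continuous bijection of \<open>[0,\<infinity>)\<close>, and \<open>price x = \<zeta> e\<^sup>-\<^sup>\<beta>\<^sup>\<sigma>\<close> with \<open>stock \<sigma> = x\<close> is the right
  choice of \<open>p\<close> (\<open>switching_strategy\<close>). At the price \<open>\<zeta>\<close> the intervals spanned by the optimal
  production rates and by the optimal selling rates intersect; the static optimum \<open>u\<close> lies in
  both intervals (\<open>static_optimum_tight\<close>), which provides the mixtures of two rates used by
  the relaxed solution.

  Rates jumping rapidly between the end points of these two intervals keep the inventory
  between zero and a small constant and lose only a small amount of payoff. Hence the original
  problem has the value \<open>dual x (price x)\<close> even when it has no solution
  (\<open>orig_value_eq_dual\<close>). As \<open>v x = dual x (price x) \<le> dual x p\<close> for all \<open>p\<close> and \<open>dual\<close> is affine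
  in \<open>x\<close> with slope \<open>p\<close>, the number \<open>price x\<close> is a supergradient of \<open>v\<close> at \<open>x\<close>; continuity of
  \<open>price\<close> turns it into the derivative (\<open>value_deriv_eq_price\<close>). This identifies the strategy
  of the theorem, which is written in terms of \<open>v'\<close>, with the one constructed here.
\<close>

section \<open>Maximizers and convex hulls\<close>

lemma argmax_set_iff:
  fixes f :: "'a \<Rightarrow> 'b::linorder"
  shows "u \<in> argmax_set f S \<longleftrightarrow> u \<in> S \<and> (\<forall>y\<in>S. f y \<le> f u)"
  unfolding argmax_set_def is_arg_max_def by (auto simp: not_less)

text \<open>
  The form in which the duality argument ends: a dual bound that some admissible control reaches.
\<close>

lemma SUP_eqI_attained:
  fixes f :: "'x \<Rightarrow> ereal"
  assumes "p \<in> S" "\<And>p. p \<in> S \<Longrightarrow> f p \<le> d" "d \<le> f p"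
  shows "f p = (SUP p\<in>S. f p)"
proof (rule antisym)
  show "f p \<le> (SUP p\<in>S. f p)" by (rule SUP_upper[OF assms(1)])
  show "(SUP p\<in>S. f p) \<le> f p" using assms(2,3) order_trans by (intro SUP_least) blast
qed

lemma co_set_between:
  assumes "s1 \<in> S" "s2 \<in> S" "s1 \<le> u" "u \<le> s2"
  shows "u \<in> co_set S"
  using assms unfolding co_set_def is_interval_1 by blast

lemma subset_co_set: "S \<subseteq> co_set S"
  by (auto simp: co_set_def)

lemma co_set_subset: "is_interval I \<Longrightarrow> S \<subseteq> I \<Longrightarrow> co_set S \<subseteq> I"
  by (auto simp: co_set_def)

section \<open>Conjugates of coercive functions on closed subsets of the line\<close>

text \<open>
  Production costs and, with the opposite sign, revenues are treated together. Coercivity is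
  stated as boundedness of the superlevel sets of \<open>s z - f s\<close>, which covers both compact \<open>S\<close> and
  superlinear growth of \<open>f\<close> on an unbounded \<open>S\<close>.
\<close>

locale coercive_cost =
  fixes S :: "real set" and f :: "real \<Rightarrow> real"
  assumes closed: "closed S" and nonempty: "S \<noteq> {}" and cont: "continuous_on S f"
    and coercive: "\<And>z K. bounded {s \<in> S. K \<le> s * z - f s}"
begin

definition maximizer :: "real \<Rightarrow> real \<Rightarrow> bool" where
  "maximizer z s \<longleftrightarrow> s \<in> S \<and> (\<forall>y\<in>S. y * z - f y \<le> s * z - f s)"

lemma ex_maximizer: "\<exists>s. maximizer z s"
proof -
  obtain s0 where s0: "s0 \<in> S" using nonempty by blast
  \<comment> \<open>The superlevel set through any point of \<open>S\<close> is compact and contains all maximizers.\<close>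
  let ?K = "s0 * z - f s0"
  let ?L = "{s \<in> S. ?K \<le> s * z - f s}"
  have c: "continuous_on S (\<lambda>s. s * z - f s)" by (intro continuous_intros cont)
  have "closed ?L"
    using continuous_on_closed_Collect_le[OF continuous_on_const[of S ?K] c closed] .
  hence "compact ?L" using coercive compact_eq_bounded_closed by blast
  moreover have "?L \<noteq> {}" using s0 by blast
  moreover have "continuous_on ?L (\<lambda>s. s * z - f s)" by (rule continuous_on_subset[OF c]) auto
  ultimately have "\<exists>s\<in>?L. \<forall>y\<in>?L. y * z - f y \<le> s * z - f s"
    by (rule continuous_attains_sup)
  then obtain s where s: "s \<in> ?L" "\<forall>y\<in>?L. y * z - f y \<le> s * z - f s" by (auto simp only: Bex_def)
  have "y * z - f y \<le> s * z - f s" if "y \<in> S" for y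
  proof (cases "?K \<le> y * z - f y")
    case True then show ?thesis using s(2) that by blast
  next
    case False then show ?thesis using s(1) by simp
  qed
  then show ?thesis using s(1) unfolding maximizer_def by blast
qed

definition conj_fun :: "real \<Rightarrow> real" where "conj_fun = C_hat S f"

lemma conj_fun_eq: "maximizer z s \<Longrightarrow> conj_fun z = s * z - f s"
  unfolding conj_fun_def C_hat_def maximizer_def by (intro cSup_eq_maximum) auto

lemma conj_fun_ge: "s \<in> S \<Longrightarrow> s * z - f s \<le> conj_fun z"
  using ex_maximizer[of z] conj_fun_eq maximizer_def by metis

lemma conj_fun_subgradient: "maximizer z s \<Longrightarrow> conj_fun z + s * (z' - z) \<le> conj_fun z'"
  using conj_fun_eq[of z s] conj_fun_ge[of s z'] by (simp add: maximizer_def algebra_simps)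

lemma maximizerI: "s \<in> S \<Longrightarrow> conj_fun z \<le> s * z - f s \<Longrightarrow> maximizer z s"
  unfolding maximizer_def using conj_fun_ge order_trans by blast

lemma subgradient_mono:
  assumes "\<And>w. conj_fun z + s * (w - z) \<le> conj_fun w"
      and "\<And>w. conj_fun z' + s' * (w - z') \<le> conj_fun w" and "z < z'"
  shows "s \<le> s'"
proof -
  have "(s' - s) * (z' - z) \<ge> 0" using assms(1)[of z'] assms(2)[of z] by (simp add: algebra_simps)
  thus ?thesis using \<open>z < z'\<close> by (simp add: zero_le_mult_iff)
qed

text \<open>
  Maximizers at \<open>z\<close> are subgradients of the convex conjugate at \<open>z\<close>, hence monotone in \<open>z\<close>.
\<close>

lemma maximizer_mono: "maximizer z s \<Longrightarrow> maximizer z' s' \<Longrightarrow> z < z' \<Longrightarrow> s \<le> s'"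
  using subgradient_mono conj_fun_subgradient by metis

lemma conj_fun_convex: "convex_on UNIV conj_fun"
proof (rule convex_onI)
  fix t x y :: real assume t: "0 < t" "t < 1"
  let ?z = "(1 - t) *\<^sub>R x + t *\<^sub>R y"
  obtain s where s: "maximizer ?z s" using ex_maximizer by blast
  have "conj_fun ?z = (1-t) * (conj_fun ?z + s * (x - ?z)) + t * (conj_fun ?z + s * (y - ?z))"
    by (simp add: algebra_simps)
  also have "\<dots> \<le> (1-t) * conj_fun x + t * conj_fun y"
    using conj_fun_subgradient[OF s] t by (intro add_mono mult_left_mono) auto
  finally show "conj_fun ?z \<le> (1-t) * conj_fun x + t * conj_fun y" .
qed simp

lemma conj_fun_continuous: "continuous_on UNIV conj_fun"
  by (rule convex_on_continuous[OF open_UNIV conj_fun_convex])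

text \<open>
  The graph of the set of maximizers is closed: by monotonicity the maximizers along a
  convergent sequence of slopes stay in a compact interval, and the conjugate is continuous.
\<close>

lemma maximizer_limit:
  assumes max: "\<And>n. maximizer (z n) (s n)" and lim: "z \<longlonglongrightarrow> l"
  obtains r s' where "strict_mono (r::nat\<Rightarrow>nat)" "maximizer l s'" "(s \<circ> r) \<longlonglongrightarrow> s'"
proof -
  have "Bseq z" using lim convergentI convergent_imp_Bseq by blast
  then obtain B' where B': "norm (z n) \<le> B'" for n by (elim BseqE) blast
  define B where "B = B' + 1"
  have B: "\<bar>z n\<bar> < B" for n using B'[of n] by (simp add: B_def)
  obtain s1 s2 where "maximizer (-B) s1" "maximizer B s2" using ex_maximizer by blast
  moreover have "-B < z n" "z n < B" for n using B[of n] by auto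
  ultimately have "s n \<in> {s1..s2}" for n using max maximizer_mono by (metis atLeastAtMost_iff)
  then obtain s' r where r: "strict_mono (r::nat\<Rightarrow>nat)" "(s \<circ> r) \<longlonglongrightarrow> s'"
    using compact_Icc[of s1 s2] unfolding compact_eq_seq_compact_metric seq_compact_def by metis
  have sS: "(s \<circ> r) n \<in> S" for n using max by (simp add: maximizer_def)
  have s'S: "s' \<in> S" using closed_sequentially[OF closed sS r(2)] .
  have zr: "(z \<circ> r) \<longlonglongrightarrow> l" using LIMSEQ_subseq_LIMSEQ[OF lim r(1)] .
  have "(\<lambda>n. f ((s \<circ> r) n)) \<longlonglongrightarrow> f s'"
    by (rule continuous_on_tendsto_compose[OF cont r(2) s'S]) (use sS in auto)
  hence l1: "(\<lambda>n. (s \<circ> r) n * (z \<circ> r) n - f ((s \<circ> r) n)) \<longlonglongrightarrow> s' * l - f s'"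
    by (intro tendsto_intros r(2) zr)
  have "isCont conj_fun l" using conj_fun_continuous by (simp add: continuous_on_eq_continuous_at)
  hence l2: "(\<lambda>n. conj_fun ((z \<circ> r) n)) \<longlonglongrightarrow> conj_fun l"
    using zr isCont_tendsto_compose by blast
  have "(\<lambda>n. conj_fun ((z \<circ> r) n)) = (\<lambda>n. (s \<circ> r) n * (z \<circ> r) n - f ((s \<circ> r) n))"
    using conj_fun_eq[OF max] by auto
  hence "conj_fun l = s' * l - f s'" using l1 l2 LIMSEQ_unique by metis
  hence "maximizer l s'" using maximizerI[OF s'S, of l] by simp
  thus ?thesis using that r by blast
qed

text \<open>
  Extreme subgradients of the conjugate belong to \<open>S\<close>: they are limits of maximizers at slopes
  approaching \<open>z\<close> from either side, and monotonicity places every subgradient between them.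
\<close>

lemma subgradient_between_maximizers:
  assumes sub: "\<And>w. conj_fun z + u * (w - z) \<le> conj_fun w"
  obtains s1 s2 where "maximizer z s1" "maximizer z s2" "s1 \<le> u" "u \<le> s2"
proof -
  define h where "h n = inverse (real (Suc n))" for n
  have h: "h n > 0" for n by (simp add: h_def)
  have h0: "h \<longlonglongrightarrow> 0" unfolding h_def by (rule LIMSEQ_inverse_real_of_nat)
  have "\<forall>n. \<exists>s. maximizer (z + h n) s" "\<forall>n. \<exists>s. maximizer (z - h n) s" using ex_maximizer by auto
  then obtain s t where s: "\<And>n. maximizer (z + h n) (s n)" and t: "\<And>n. maximizer (z - h n) (t n)"
    by metis
  have "(\<lambda>n. z + h n) \<longlonglongrightarrow> z" using tendsto_add[OF tendsto_const[of z] h0] by simp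
  from maximizer_limit[of "\<lambda>n. z + h n" s, OF s this]
  obtain r s2 where r: "maximizer z s2" "(s \<circ> r) \<longlonglongrightarrow> s2" .
  have "(\<lambda>n. z - h n) \<longlonglongrightarrow> z" using tendsto_diff[OF tendsto_const[of z] h0] by simp
  from maximizer_limit[of "\<lambda>n. z - h n" t, OF t this]
  obtain r' s1 where r': "maximizer z s1" "(t \<circ> r') \<longlonglongrightarrow> s1" .
  have "u \<le> s n" for n using subgradient_mono[OF sub conj_fun_subgradient[OF s[of n]]] h[of n] by simp
  hence "u \<le> s2" using r(2) by (intro LIMSEQ_le_const[OF r(2)]) auto
  have "t n \<le> u" for n using subgradient_mono[OF conj_fun_subgradient[OF t[of n]] sub] h[of n] by simp
  hence "s1 \<le> u" using r'(2) by (intro LIMSEQ_le_const2[OF r'(2)]) auto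
  show ?thesis using that r(1) r'(1) \<open>u \<le> s2\<close> \<open>s1 \<le> u\<close> by blast
qed

lemma cvx_cost_ge: "ereal (y * z - conj_fun z) \<le> cvx_cost S f y"
  unfolding cvx_cost_def co_fun_def
proof (rule Inf_greatest, clarify)
  fix \<delta> x1 x2 :: real
  assume d: "0 \<le> \<delta>" "\<delta> \<le> 1" and e: "ext_cost S f x1 < \<infinity>" "ext_cost S f x2 < \<infinity>"
  have x: "x1 \<in> S" "x2 \<in> S" using e by (auto simp: ext_cost_def split: if_splits)
  have "\<delta> * (x1 * z - f x1) + (1 - \<delta>) * (x2 * z - f x2) \<le> \<delta> * conj_fun z + (1-\<delta>) * conj_fun z"
    using d x conj_fun_ge by (intro add_mono mult_left_mono) auto
  thus "ereal ((\<delta> * x1 + (1 - \<delta>) * x2) * z - conj_fun z)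
      \<le> ereal \<delta> * ext_cost S f x1 + ereal (1 - \<delta>) * ext_cost S f x2"
    using x by (simp add: ext_cost_def algebra_simps)
qed

lemma cvx_cost_le:
  assumes "s1 \<in> S" "s2 \<in> S" "0 \<le> \<delta>" "\<delta> \<le> 1"
  shows "cvx_cost S f (\<delta> * s1 + (1 - \<delta>) * s2) \<le> ereal (\<delta> * f s1 + (1 - \<delta>) * f s2)"
  unfolding cvx_cost_def co_fun_def
  by (rule Inf_lower, rule CollectI, rule exI[of _ \<delta>], rule exI[of _ s1], rule exI[of _ s2])
    (use assms in \<open>simp add: ext_cost_def\<close>)

lemma cvx_cost_maximizer:
  assumes "maximizer z s"
  shows "cvx_cost S f s = ereal (f s)" "cvx_cost S f s = ereal (s * z - conj_fun z)"
proof -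
  have "f s = s * z - conj_fun z" using conj_fun_eq[OF assms] by simp
  moreover have "cvx_cost S f s \<le> ereal (f s)"
    using cvx_cost_le[of s s 1] assms by (simp add: maximizer_def)
  ultimately show "cvx_cost S f s = ereal (f s)" "cvx_cost S f s = ereal (s * z - conj_fun z)"
    using cvx_cost_ge[of s z] by (auto intro: antisym)
qed

text \<open>
  Equality in the Fenchel-Young inequality for the convex hull of \<open>f\<close> means that \<open>u\<close> is a
  subgradient of the conjugate.
\<close>

lemma tight_subgradient:
  assumes "cvx_cost S f u \<le> ereal (u * z - conj_fun z)"
  shows "conj_fun z + u * (w - z) \<le> conj_fun w"
proof -
  have "ereal (u * w - conj_fun w) \<le> ereal (u * z - conj_fun z)"
    using cvx_cost_ge assms order_trans by blast
  thus ?thesis by (simp add: algebra_simps)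
qed

lemma tight_between_maximizers:
  assumes "maximizer z s1" "maximizer z s2" "0 \<le> \<delta>" "\<delta> \<le> 1" "u = \<delta> * s1 + (1 - \<delta>) * s2"
  shows "cvx_cost S f u = ereal (u * z - conj_fun z)"
proof -
  have "\<delta> * f s1 + (1-\<delta>) * f s2 = \<delta> * (s1 * z - conj_fun z) + (1-\<delta>) * (s2 * z - conj_fun z)"
    using conj_fun_eq[OF assms(1)] conj_fun_eq[OF assms(2)] by simp
  also have "\<dots> = u * z - conj_fun z" unfolding assms(5) by (simp add: algebra_simps)
  finally have "cvx_cost S f u \<le> ereal (u * z - conj_fun z)"
    using cvx_cost_le[of s1 s2 \<delta>] assms by (simp add: maximizer_def)
  thus ?thesis using cvx_cost_ge antisym by blast
qed

lemma tight_between: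
  assumes "maximizer z s1" "maximizer z s2" "min s1 s2 \<le> u" "u \<le> max s1 s2"
  shows "cvx_cost S f u = ereal (u * z - conj_fun z)" "u \<in> co_set S"
proof -
  have "\<exists>\<delta>. 0 \<le> \<delta> \<and> \<delta> \<le> 1 \<and> u = \<delta> * s1 + (1 - \<delta>) * s2"
  proof (cases "s1 = s2")
    case True
    thus ?thesis using assms(3,4) by (intro exI[of _ 1]) auto
  next
    case False
    define \<delta> where "\<delta> = (s2 - u) / (s2 - s1)"
    have "\<delta> * (s2 - s1) = s2 - u" using False by (simp add: \<delta>_def)
    moreover have "\<delta> * s1 + (1 - \<delta>) * s2 = s2 - \<delta> * (s2 - s1)" by (simp only: algebra_simps)
    moreover have "0 \<le> \<delta>" "\<delta> \<le> 1"
      using assms(3,4) False unfolding \<delta>_def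
      by (auto simp: divide_simps min_def max_def split: if_splits)
    ultimately show ?thesis by (intro exI[of _ \<delta>]) simp
  qed
  thus "cvx_cost S f u = ereal (u * z - conj_fun z)" using tight_between_maximizers[OF assms(1,2)] by blast
  have "min s1 s2 \<in> S" "max s1 s2 \<in> S" using assms(1,2) by (auto simp: maximizer_def min_def max_def)
  thus "u \<in> co_set S" using co_set_between assms(3,4) by blast
qed

text \<open>
  Where the Fenchel-Young inequality is an equality, the infimum defining the convex hull is
  attained. The weight is kept strictly inside \<open>(0,1)\<close>; if \<open>u\<close> is itself a maximizer, both points
  are \<open>u\<close>.
\<close>

lemma tight_representation:
  assumes "cvx_cost S f u \<le> ereal (u * z - conj_fun z)"
  obtains s1 s2 \<delta> where "maximizer z s1" "maximizer z s2" "s1 \<le> s2" "0 < \<delta>" "\<delta> < 1"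
    "u = \<delta> * s1 + (1 - \<delta>) * s2" "cvx_cost S f u = ereal (\<delta> * f s1 + (1 - \<delta>) * f s2)"
proof -
  obtain s1 s2 where s: "maximizer z s1" "maximizer z s2" "s1 \<le> u" "u \<le> s2"
    using subgradient_between_maximizers[OF tight_subgradient[OF assms]] by metis
  have "\<exists>s1 s2 \<delta>. maximizer z s1 \<and> maximizer z s2 \<and> s1 \<le> s2 \<and> 0 < \<delta> \<and> \<delta> < 1 \<and> u = \<delta> * s1 + (1 - \<delta>) * s2"
  proof (cases "u = s1 \<or> u = s2")
    case True
    then have "maximizer z u" using s by auto
    then show ?thesis by (intro exI[of _ u] exI[of _ "1/2"]) auto
  next
    case False
    let ?d = "(s2 - u) / (s2 - s1)"
    have lt: "s1 < u" "u < s2" using False s by auto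
    hence "0 < ?d" "?d < 1" by auto
    moreover have "u = ?d * s1 + (1 - ?d) * s2"
    proof -
      have "?d * (s2 - s1) = s2 - u" using lt by simp
      moreover have "?d * s1 + (1 - ?d) * s2 = s2 - ?d * (s2 - s1)" by (simp only: algebra_simps)
      ultimately show ?thesis by simp
    qed
    ultimately show ?thesis using s lt by (intro exI[of _ s1] exI[of _ s2] exI[of _ ?d] conjI) linarith+
  qed
  then obtain s1 s2 \<delta> where d: "maximizer z s1" "maximizer z s2" "s1 \<le> s2" "0 < \<delta>" "\<delta> < 1"
    "u = \<delta> * s1 + (1 - \<delta>) * s2" by blast
  have f12: "f s1 = s1 * z - conj_fun z" "f s2 = s2 * z - conj_fun z"
    using conj_fun_eq[OF d(1)] conj_fun_eq[OF d(2)] by simp_all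
  have e: "u * z - conj_fun z = \<delta> * f s1 + (1 - \<delta>) * f s2"
    unfolding f12 d(6) by (simp add: algebra_simps)
  show ?thesis using that[OF d] tight_between_maximizers[OF d(1,2) _ _ d(6)] d(4,5) e by simp
qed

text \<open>
  Where the conjugate is differentiable its only subgradient is the derivative, so the convexified
  maximization has a single solution, and that solution is an original maximizer in \<open>S\<close>.
\<close>

lemma argmax_conjugate:
  assumes diff: "conj_fun differentiable (at z)" and s: "maximizer z s"
  shows "argmax_set (\<lambda>a. ereal (a * z) - cvx_cost S f a) (co_set S) = {s}"
proof -
  have le: "ereal (a * z) - cvx_cost S f a \<le> ereal (conj_fun z)" for a
    using cvx_cost_ge[of a z] by (cases "cvx_cost S f a") auto
  have eq: "ereal (s * z) - cvx_cost S f s = ereal (conj_fun z)"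
    using cvx_cost_maximizer(2)[OF s] by simp
  have deriv: "(conj_fun has_real_derivative u) (at z)"
    if u: "\<And>w. conj_fun z + u * (w - z) \<le> conj_fun w" for u
  proof -
    obtain d where d: "(conj_fun has_real_derivative d) (at z)"
      using diff real_differentiable_def by blast
    have "((\<lambda>w. conj_fun w - (conj_fun z + u * (w - z))) has_real_derivative d - u) (at z)"
      by (auto intro!: derivative_eq_intros d)
    moreover have "\<forall>y. \<bar>z - y\<bar> < 1 \<longrightarrow> conj_fun z - (conj_fun z + u * (z - z)) \<le> conj_fun y - (conj_fun z + u * (y - z))"
      using u by simp
    ultimately have "d - u = 0" using DERIV_local_min[of _ "d - u" z 1] by simp
    then show ?thesis using d by simp
  qed
  show ?thesis
  proof (intro equalityI subsetI)
    fix u assume "u \<in> argmax_set (\<lambda>a. ereal (a * z) - cvx_cost S f a) (co_set S)"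
    hence "ereal (conj_fun z) \<le> ereal (u * z) - cvx_cost S f u"
      using eq s subset_co_set[of S] unfolding argmax_set_iff by (metis maximizer_def subsetD)
    hence "cvx_cost S f u \<le> ereal (u * z - conj_fun z)" by (cases "cvx_cost S f u") auto
    from deriv[OF tight_subgradient[OF this]] deriv[OF conj_fun_subgradient[OF s]]
    show "u \<in> {s}" using DERIV_unique by blast
  next
    fix u assume "u \<in> {s}"
    thus "u \<in> argmax_set (\<lambda>a. ereal (a * z) - cvx_cost S f a) (co_set S)"
      unfolding argmax_set_iff using le eq s subset_co_set[of S] by (auto simp: maximizer_def)
  qed
qed

text \<open>
  Any choice of maximizers is monotone in the slope, so an arbitrary one is already Borel
  measurable and integrable on bounded intervals.
\<close>

definition sel :: "real \<Rightarrow> real" where "sel z = (SOME s. maximizer z s)"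

lemma maximizer_sel: "maximizer z (sel z)"
  unfolding sel_def by (rule someI_ex[OF ex_maximizer])

lemma sel_mono: "mono sel"
  using maximizer_mono[OF maximizer_sel maximizer_sel] by (auto simp: mono_def le_less)

end

section \<open>Weighted and discounted integrals\<close>

text \<open>
  Bounds on the primitive of \<open>f\<close> carry over to the integral of \<open>l f\<close> for a nonincreasing nonnegative
  weight \<open>l\<close>. With \<open>f\<close> the net production rate and \<open>l\<close> the discounted costate, this turns the state
  constraint into a bound on the payoff.
\<close>

lemma second_mean_value_bounds:
  fixes f l :: "real \<Rightarrow> real"
  assumes f: "f integrable_on {a..b}" and "a \<le> b"
    and anti: "\<And>s t. a \<le> s \<Longrightarrow> s \<le> t \<Longrightarrow> t \<le> b \<Longrightarrow> l t \<le> l s" and "0 \<le> l b"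
    and bounds: "\<And>t. a \<le> t \<Longrightarrow> t \<le> b \<Longrightarrow> c \<le> integral {a..t} f \<and> integral {a..t} f \<le> d"
  shows "l a * c \<le> integral {a..b} (\<lambda>t. l t * f t)" "integral {a..b} (\<lambda>t. l t * f t) \<le> l a * d"
proof -
  obtain e where e: "e \<in> {a..b}"
    and i: "((\<lambda>t. - l t * f t) has_integral (- l a * integral {a..e} f + - l b * integral {e..b} f)) {a..b}"
    using second_mean_value_theorem_full[OF f \<open>a \<le> b\<close>, of "\<lambda>t. - l t"] anti by auto
  define u where "u = integral {a..e} f"
  define w where "w = integral {a..b} f"
  have eb: "integral {e..b} f = w - u"
    using Henstock_Kurzweil_Integration.integral_combine[of a e b f] e f unfolding u_def w_def by simp
  have "- (- l a * integral {a..e} f + - l b * integral {e..b} f) = (l a - l b) * u + l b * w"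
    unfolding eb u_def[symmetric] by (simp add: algebra_simps)
  hence "((\<lambda>t. l t * f t) has_integral ((l a - l b) * u + l b * w)) {a..b}"
    using has_integral_neg[OF i] by simp
  hence eq: "integral {a..b} (\<lambda>t. l t * f t) = (l a - l b) * u + l b * w" by (rule integral_unique)
  have lab: "l b \<le> l a" using anti[of a b] \<open>a \<le> b\<close> by simp
  have uw: "c \<le> u" "u \<le> d" "c \<le> w" "w \<le> d" unfolding u_def w_def using bounds e \<open>a \<le> b\<close> by auto
  have "(l a - l b) * c + l b * c \<le> (l a - l b) * u + l b * w"
    using lab uw \<open>0 \<le> l b\<close> by (intro add_mono mult_left_mono) auto
  thus "l a * c \<le> integral {a..b} (\<lambda>t. l t * f t)" unfolding eq by (simp add: algebra_simps)
  have "(l a - l b) * u + l b * w \<le> (l a - l b) * d + l b * d"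
    using lab uw \<open>0 \<le> l b\<close> by (intro add_mono mult_left_mono) auto
  thus "integral {a..b} (\<lambda>t. l t * f t) \<le> l a * d" unfolding eq by (simp add: algebra_simps)
qed

lemma set_integrable_mult_bounded:
  fixes f l :: "real \<Rightarrow> real"
  assumes f: "set_integrable lborel S f" and [measurable]: "l \<in> borel_measurable borel"
    and l: "\<And>t. t \<in> S \<Longrightarrow> \<bar>l t\<bar> \<le> K"
  shows "set_integrable lborel S (\<lambda>t. l t * f t)"
proof (rule set_integrable_bound[of _ _ "\<lambda>t. K * f t"])
  show "set_integrable lborel S (\<lambda>t. K * f t)" using f by simp
  have [measurable]: "(\<lambda>t. indicator S t *\<^sub>R f t) \<in> borel_measurable borel"
    using f unfolding set_integrable_def by simp
  have "(\<lambda>t. l t * (indicator S t *\<^sub>R f t)) \<in> borel_measurable borel" by measurable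
  thus "set_borel_measurable lborel S (\<lambda>t. l t * f t)"
    unfolding set_borel_measurable_def by (simp add: mult.left_commute)
  show "AE t in lborel. t \<in> S \<longrightarrow> norm (l t * f t) \<le> norm (K * f t)"
    using l order_trans[OF l abs_ge_self] by (auto intro!: AE_I2 mult_right_mono simp: abs_mult)
qed

lemma set_integrable_Icc_bounded:
  fixes h :: "real \<Rightarrow> real"
  assumes "h \<in> borel_measurable borel" "\<And>t. a \<le> t \<Longrightarrow> t \<le> b \<Longrightarrow> \<bar>h t\<bar> \<le> K"
  shows "set_integrable lborel {a..b} h"
proof -
  have "set_integrable lborel {a..b} (\<lambda>_. 1 :: real)" by (rule borel_integrable_atLeastAtMost') simp
  from set_integrable_mult_bounded[OF this assms(1), of K] assms(2) show ?thesis by simp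
qed

lemma set_integrable_exp_mult_bounded:
  fixes h :: "real \<Rightarrow> real"
  assumes "\<beta> > 0" "h \<in> borel_measurable borel" "\<And>t. 0 \<le> t \<Longrightarrow> \<bar>h t\<bar> \<le> K"
  shows "set_integrable lborel {0..} (\<lambda>t. exp (- \<beta> * t) * h t)"
proof -
  have "(\<lambda>x. exp (- \<beta> * x)) integrable_on {0..}"
    using integrable_on_exp_minus_to_infinity[OF assms(1)] .
  hence "(\<lambda>x. exp (- \<beta> * x)) absolutely_integrable_on {0..}"
    by (intro nonnegative_absolutely_integrable_1) auto
  moreover have "(\<lambda>x::real. indicator {0..} x *\<^sub>R exp (- \<beta> * x)) \<in> borel_measurable lborel"
    by measurable
  ultimately have "set_integrable lborel {0..} (\<lambda>x. exp (- \<beta> * x))"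
    unfolding set_integrable_def using integrable_completion by blast
  from set_integrable_mult_bounded[OF this assms(2), of K] assms(3)
  show ?thesis by (simp add: mult.commute)
qed

section \<open>Integrals with values in the extended reals\<close>

lemma ext_integral_mono_AE:
  assumes "AE t in M. t \<in> S \<longrightarrow> f t \<le> g t"
  shows "ext_integral M S f \<le> ext_integral M S g"
  unfolding ext_integral_def
proof (rule ereal_minus_mono)
  have neg: "AE t in M. t \<in> S \<longrightarrow> - g t \<le> - f t" using assms by simp
  show "enn2ereal (\<integral>\<^sup>+ t\<in>S. e2ennreal (f t) \<partial>M) \<le> enn2ereal (\<integral>\<^sup>+ t\<in>S. e2ennreal (g t) \<partial>M)"
    using assms unfolding less_eq_ennreal.rep_eq[symmetric]
    by (intro nn_integral_mono_AE) (auto split: split_indicator intro: e2ennreal_mono)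
  show "enn2ereal (\<integral>\<^sup>+ t\<in>S. e2ennreal (- g t) \<partial>M) \<le> enn2ereal (\<integral>\<^sup>+ t\<in>S. e2ennreal (- f t) \<partial>M)"
    unfolding less_eq_ennreal.rep_eq[symmetric]
    by (intro nn_integral_mono_AE eventually_mono[OF neg]) (auto split: split_indicator intro: e2ennreal_mono simp del: ereal_minus_le_minus)
qed

lemma ext_integral_cong_AE:
  assumes "AE t in M. t \<in> S \<longrightarrow> f t = g t"
  shows "ext_integral M S f = ext_integral M S g"
  using assms by (intro antisym ext_integral_mono_AE) auto

lemma ext_integral_ereal:
  "ext_integral M S (\<lambda>t. ereal (h t)) = enn2ereal (\<integral>\<^sup>+ t. ennreal (indicator S t *\<^sub>R h t) \<partial>M)
     - enn2ereal (\<integral>\<^sup>+ t. ennreal (- (indicator S t *\<^sub>R h t)) \<partial>M)"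
  unfolding ext_integral_def by (auto simp: ennreal.abs_eq indicator_def intro!: arg_cong2[where f=minus] arg_cong[where f=enn2ereal] nn_integral_cong)

lemma enn2ereal_finite: "x \<noteq> \<top> \<Longrightarrow> enn2ereal x = ereal (enn2real x)"
  by (cases x) (auto simp: enn2ereal_ennreal)

lemma ext_integral_integrable:
  assumes "set_integrable M S h"
  shows "ext_integral M S (\<lambda>t. ereal (h t)) = ereal (LINT t:S|M. h t)"
proof -
  let ?h = "\<lambda>t. indicator S t *\<^sub>R h t"
  have i: "integrable M ?h" using assms by (simp add: set_integrable_def)
  have "(\<integral>\<^sup>+ t. ennreal (?h t) \<partial>M) \<noteq> \<top>" "(\<integral>\<^sup>+ t. ennreal (- ?h t) \<partial>M) \<noteq> \<top>"
    using i unfolding real_integrable_def by auto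
  thus ?thesis
    unfolding ext_integral_ereal set_lebesgue_integral_def real_lebesgue_integral_def[OF i]
    by (simp add: enn2ereal_finite)
qed

text \<open>
  A function bounded below by an integrable one has the integral \<open>\<infinity>\<close> as soon as it is not
  integrable. This and its mirror image dispose of the controls with infinite discounted cost.
\<close>

lemma ext_integral_top:
  assumes h: "(\<lambda>t. indicator S t *\<^sub>R h t) \<in> borel_measurable M" and n: "\<not> set_integrable M S h"
    and g: "set_integrable M S g" "\<And>t. t \<in> S \<Longrightarrow> g t \<le> h t"
  shows "ext_integral M S (\<lambda>t. ereal (h t)) = \<infinity>"
proof -
  let ?h = "\<lambda>t. indicator S t *\<^sub>R h t" and ?g = "\<lambda>t. indicator S t *\<^sub>R g t"
  have "(\<integral>\<^sup>+ t. ennreal (- ?h t) \<partial>M) \<le> (\<integral>\<^sup>+ t. ennreal (- ?g t) \<partial>M)"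
    using g(2) by (intro nn_integral_mono ennreal_leI) (auto split: split_indicator)
  moreover have "(\<integral>\<^sup>+ t. ennreal (- ?g t) \<partial>M) \<noteq> \<infinity>"
    using g(1) unfolding set_integrable_def real_integrable_def by auto
  ultimately have fin: "(\<integral>\<^sup>+ t. ennreal (- ?h t) \<partial>M) \<noteq> \<infinity>" by (auto simp: top_unique)
  hence "(\<integral>\<^sup>+ t. ennreal (?h t) \<partial>M) = \<infinity>"
    using n h unfolding set_integrable_def real_integrable_def by auto
  with fin show ?thesis unfolding ext_integral_ereal by (simp add: enn2ereal_finite)
qed

lemma ext_integral_bot:
  assumes h: "(\<lambda>t. indicator S t *\<^sub>R h t) \<in> borel_measurable M" and n: "\<not> set_integrable M S h"
    and g: "set_integrable M S g" "\<And>t. t \<in> S \<Longrightarrow> h t \<le> g t"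
  shows "ext_integral M S (\<lambda>t. ereal (h t)) = -\<infinity>"
proof -
  let ?h = "\<lambda>t. indicator S t *\<^sub>R h t" and ?g = "\<lambda>t. indicator S t *\<^sub>R g t"
  have "(\<integral>\<^sup>+ t. ennreal (?h t) \<partial>M) \<le> (\<integral>\<^sup>+ t. ennreal (?g t) \<partial>M)"
    using g(2) by (intro nn_integral_mono ennreal_leI) (auto split: split_indicator)
  moreover have "(\<integral>\<^sup>+ t. ennreal (?g t) \<partial>M) \<noteq> \<infinity>"
    using g(1) unfolding set_integrable_def real_integrable_def by auto
  ultimately have fin: "(\<integral>\<^sup>+ t. ennreal (?h t) \<partial>M) \<noteq> \<infinity>" by (auto simp: top_unique)
  hence "(\<integral>\<^sup>+ t. ennreal (- ?h t) \<partial>M) = \<infinity>"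
    using n h unfolding set_integrable_def real_integrable_def by auto
  with fin show ?thesis unfolding ext_integral_ereal by (simp add: enn2ereal_finite)
qed

section \<open>Periodic switching between two rates\<close>

definition chatter :: "real \<Rightarrow> real \<Rightarrow> real \<Rightarrow> real" where
  "chatter \<epsilon> \<theta> t = (if frac (t / \<epsilon>) < \<theta> then 1 else 0)"

lemma chatter_measurable [measurable]: "chatter \<epsilon> \<theta> \<in> borel_measurable borel"
  unfolding chatter_def[abs_def] frac_def by measurable

text \<open>
  The primitive on one period, measured from its beginning, is a tent that vanishes at both ends:
  the value 1 is taken first.
\<close>

lemma chatter_integral_period:
  assumes "0 < \<epsilon>" "0 < \<theta>" "\<theta> < 1" "0 \<le> s" "s \<le> \<epsilon>"
  shows "((\<lambda>t. chatter \<epsilon> \<theta> t - \<theta>) has_integral (min s (\<theta> * \<epsilon>) - \<theta> * s)) {real n * \<epsilon>..real n * \<epsilon> + s}"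
proof -
  define c where "c = real n * \<epsilon>"
  define F where "F t = min (t - c) (\<theta> * \<epsilon>) - \<theta> * (t - c)" for t
  have "((\<lambda>t. chatter \<epsilon> \<theta> t - \<theta>) has_integral (F (c + s) - F c)) {c..c + s}"
  proof (rule fundamental_theorem_of_calculus_interior_strong[of "{c + \<theta> * \<epsilon>}"])
    show "continuous_on {c..c + s} F" unfolding F_def by (intro continuous_intros)
    fix t assume t: "t \<in> {c<..<c + s} - {c + \<theta> * \<epsilon>}"
    define r where "r = (t - c) / \<epsilon>"
    have r: "0 < r" "r < 1" "t / \<epsilon> = real n + r" "t = c + r * \<epsilon>" "r \<noteq> \<theta>"
      using t assms by (auto simp: r_def c_def field_simps)
    have fr: "frac (t / \<epsilon>) = r" unfolding r(3) using r(1,2) by (simp add: frac_unique_iff)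
    show "(F has_vector_derivative chatter \<epsilon> \<theta> t - \<theta>) (at t)"
    proof (cases "r < \<theta>")
      case True
      have "t < c + \<theta> * \<epsilon>" using True assms r(4) by simp
      hence ev: "\<forall>\<^sub>F x in nhds t. F x = (x - c) - \<theta> * (x - c)"
        by (intro eventually_mono[OF eventually_nhds_in_open[of "{..<c + \<theta> * \<epsilon>}"]]) (auto simp: F_def)
      have "((\<lambda>x. (x - c) - \<theta> * (x - c)) has_real_derivative 1 - \<theta>) (at t)"
        by (auto intro!: derivative_eq_intros)
      thus ?thesis using True fr
        unfolding has_real_derivative_iff_has_vector_derivative[symmetric] DERIV_cong_ev[OF refl ev refl]
        by (simp add: chatter_def)
    next
      case False
      have "c + \<theta> * \<epsilon> < t" using False assms r(4,5) by simp
      hence ev: "\<forall>\<^sub>F x in nhds t. F x = \<theta> * \<epsilon> - \<theta> * (x - c)"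
        by (intro eventually_mono[OF eventually_nhds_in_open[of "{c + \<theta> * \<epsilon><..}"]]) (auto simp: F_def)
      have "((\<lambda>x. \<theta> * \<epsilon> - \<theta> * (x - c)) has_real_derivative - \<theta>) (at t)"
        by (auto intro!: derivative_eq_intros)
      thus ?thesis using False fr
        unfolding has_real_derivative_iff_has_vector_derivative[symmetric] DERIV_cong_ev[OF refl ev refl]
        by (simp add: chatter_def)
    qed
  qed (use assms in auto)
  moreover have "F (c + s) - F c = min s (\<theta> * \<epsilon>) - \<theta> * s" using assms by (simp add: F_def)
  ultimately show ?thesis by (simp add: c_def)
qed

lemma chatter_integral_bounds:
  assumes "0 < \<epsilon>" "0 < \<theta>" "\<theta> < 1" "0 \<le> t"
  shows "0 \<le> integral {0..t} (\<lambda>s. chatter \<epsilon> \<theta> s - \<theta>)" "integral {0..t} (\<lambda>s. chatter \<epsilon> \<theta> s - \<theta>) \<le> \<epsilon>"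
proof -
  let ?g = "\<lambda>s. chatter \<epsilon> \<theta> s - \<theta>"
  have per: "(?g has_integral 0) {0..real n * \<epsilon>}" for n
  proof (induction n)
    case (Suc n)
    have "(?g has_integral 0) {real n * \<epsilon>..real n * \<epsilon> + \<epsilon>}"
      using chatter_integral_period[OF assms(1-3), of \<epsilon> n] assms by (simp add: min_def)
    from has_integral_combine[OF _ _ Suc this] show ?case using assms by (simp add: algebra_simps)
  next
    case 0
    show ?case using has_integral_refl(2)[of ?g 0] by simp
  qed
  define n where "n = nat \<lfloor>t / \<epsilon>\<rfloor>"
  define s where "s = t - real n * \<epsilon>"
  have n: "real n = of_int \<lfloor>t / \<epsilon>\<rfloor>" using assms by (simp add: n_def)
  have "real n \<le> t / \<epsilon>" "t / \<epsilon> < real n + 1" unfolding n using floor_correct[of "t / \<epsilon>"] by simp_all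
  hence s: "0 \<le> s" "s \<le> \<epsilon>" using assms by (simp_all add: s_def field_simps)
  have "(?g has_integral (0 + (min s (\<theta> * \<epsilon>) - \<theta> * s))) {0..t}"
    using has_integral_combine[OF _ _ per[of n] chatter_integral_period[OF assms(1-3) s, of n]] assms s
    by (simp add: s_def)
  hence eq: "integral {0..t} ?g = min s (\<theta> * \<epsilon>) - \<theta> * s" by (simp add: integral_unique)
  have "\<theta> * s \<le> \<theta> * \<epsilon>" "\<theta> * s \<le> 1 * s" "0 \<le> \<theta> * s"
    using mult_left_mono[OF s(2), of \<theta>] mult_right_mono[of \<theta> 1 s] assms s by simp_all
  thus "0 \<le> integral {0..t} ?g" "integral {0..t} ?g \<le> \<epsilon>" unfolding eq using s by auto
qed

lemma chatter_late:
  assumes "0 < \<epsilon>" "0 < \<theta>" "\<theta> < 1" "\<tau> \<le> t"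
  shows "(\<lambda>s. chatter \<epsilon> \<theta> (s - \<tau>) - \<theta>) integrable_on {\<tau>..t}"
    and "0 \<le> integral {\<tau>..t} (\<lambda>s. chatter \<epsilon> \<theta> (s - \<tau>) - \<theta>)"
    and "integral {\<tau>..t} (\<lambda>s. chatter \<epsilon> \<theta> (s - \<tau>) - \<theta>) \<le> \<epsilon>"
proof -
  let ?g = "\<lambda>s. chatter \<epsilon> \<theta> s - \<theta>"
  have "set_integrable lborel {0..t - \<tau>} ?g"
  proof (rule set_integrable_Icc_bounded)
    show "?g \<in> borel_measurable borel" by measurable
    show "\<bar>?g s\<bar> \<le> 1" for s using assms by (simp add: chatter_def)
  qed
  from set_borel_integral_eq_integral(1)[OF this]
  have "(?g has_integral integral {0..t - \<tau>} ?g) (cbox 0 (t - \<tau>))" by (simp add: has_integral_integral)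
  from has_integral_affinity'[OF this, of 1 "- \<tau>"]
  have h: "((\<lambda>s. ?g (s - \<tau>)) has_integral integral {0..t - \<tau>} ?g) {\<tau>..t}" by simp
  thus "(\<lambda>s. chatter \<epsilon> \<theta> (s - \<tau>) - \<theta>) integrable_on {\<tau>..t}" by blast
  show "0 \<le> integral {\<tau>..t} (\<lambda>s. chatter \<epsilon> \<theta> (s - \<tau>) - \<theta>)"
    "integral {\<tau>..t} (\<lambda>s. chatter \<epsilon> \<theta> (s - \<tau>) - \<theta>) \<le> \<epsilon>"
    using chatter_integral_bounds[OF assms(1-3), of "t - \<tau>"] assms(4) integral_unique[OF h] by simp_all
qed

section \<open>The production model and its Hamiltonian\<close>

locale production =
  fixes A Q :: "real set" and R C :: "real \<Rightarrow> real" and \<beta> :: real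
  assumes A: "closed A" "A \<subseteq> {0..}" "0 \<in> A" "A - {0} \<noteq> {}"
    and Q: "compact Q" "Q \<subseteq> {0..}" "0 \<in> Q" "Q - {0} \<noteq> {}"
    and R: "continuous_on Q R" "\<forall>q\<in>Q. 0 \<le> R q"
    and C: "continuous_on A C" "\<forall>a\<in>A. 0 \<le> C a"
    and C_superlinear:
      "\<not> bounded A \<longrightarrow> filterlim (\<lambda>a. C a / a) at_top (inf at_top (principal A))"
    and beta: "\<beta> > 0"
    and zeta_pos: "zeta A Q R C > 0"

sublocale production \<subseteq> prod: coercive_cost A C
proof
  show "closed A" "A \<noteq> {}" "continuous_on A C" using A C by auto
  fix z K
  show "bounded {a \<in> A. K \<le> a * z - C a}"
  proof (cases "bounded A")
    case True
    then show ?thesis by (rule bounded_subset) auto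
  next
    case False
    hence "\<forall>\<^sub>F a in inf at_top (principal A). z + 1 \<le> C a / a"
      using C_superlinear by (auto simp: filterlim_at_top)
    then obtain N where N: "\<And>a. N \<le> a \<Longrightarrow> a \<in> A \<Longrightarrow> z + 1 \<le> C a / a"
      unfolding eventually_inf_principal eventually_at_top_linorder by auto
    have "{a \<in> A. K \<le> a * z - C a} \<subseteq> {0..max (max N 1) (-K)}"
    proof
      fix a assume a: "a \<in> {a \<in> A. K \<le> a * z - C a}"
      show "a \<in> {0..max (max N 1) (-K)}"
      proof (cases "N \<le> a \<and> 1 \<le> a")
        case True
        then have "(z + 1) * a \<le> C a" using N[of a] a by (simp add: field_simps)
        then show ?thesis using a A(2) by (auto simp: algebra_simps)
      next
        case False
        then show ?thesis using a A(2) by auto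
      qed
    qed
    then show ?thesis using bounded_closed_interval bounded_subset by blast
  qed
qed

sublocale production \<subseteq> sales: coercive_cost Q "\<lambda>q. - R q"
proof
  show "closed Q" "Q \<noteq> {}" using Q compact_imp_closed by auto
  show "continuous_on Q (\<lambda>q. - R q)" by (intro continuous_intros R)
  show "bounded {q \<in> Q. K \<le> q * z - - R q}" for z K
    by (rule bounded_subset[OF compact_imp_bounded[OF Q(1)]]) auto
qed

context production
begin

abbreviation H where "H \<equiv> hamiltonian A Q R C"
abbreviation \<zeta> where "\<zeta> \<equiv> zeta A Q R C"
abbreviation C_conj where "C_conj \<equiv> prod.conj_fun"

text \<open>
  \<open>R_hat\<close> is the conjugate of \<open>- R\<close> at the reflected slope.
\<close>

definition R_conj :: "real \<Rightarrow> real" where "R_conj z = sales.conj_fun (- z)"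

lemma R_hat_eq: "R_hat Q R = R_conj"
proof
  fix z show "R_hat Q R z = R_conj z"
    unfolding R_hat_def R_conj_def sales.conj_fun_def C_hat_def by (simp add: algebra_simps)
qed

lemma H_eq: "H z = R_conj z + C_conj z"
  unfolding hamiltonian_def R_hat_eq prod.conj_fun_def ..

lemma R_conj_ge: "q \<in> Q \<Longrightarrow> R q - q * z \<le> R_conj z"
  using sales.conj_fun_ge[of q "-z"] by (simp add: R_conj_def)

lemma C_conj_continuous: "continuous_on UNIV C_conj"
  by (rule prod.conj_fun_continuous)

lemma R_conj_continuous: "continuous_on UNIV R_conj"
  unfolding R_conj_def[abs_def]
  by (rule continuous_on_compose2[OF sales.conj_fun_continuous]) (auto intro: continuous_intros)

lemma H_continuous: "continuous_on UNIV H"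
proof -
  have "H = (\<lambda>z. R_conj z + C_conj z)" using H_eq by blast
  thus ?thesis by (simp add: continuous_on_add C_conj_continuous R_conj_continuous)
qed

definition alpha_sel :: "real \<Rightarrow> real" where "alpha_sel z = prod.sel z"
definition q_sel :: "real \<Rightarrow> real" where "q_sel z = sales.sel (- z)"
text \<open>
  A nondecreasing selection of subgradients of the Hamiltonian. It is also the speed at which the
  inventory changes when both rates are optimal for the price \<open>z\<close>.
\<close>

definition drift :: "real \<Rightarrow> real" where "drift z = alpha_sel z - q_sel z"

lemma alpha_sel: "prod.maximizer z (alpha_sel z)"
  unfolding alpha_sel_def by (rule prod.maximizer_sel)
lemma q_sel: "sales.maximizer (- z) (q_sel z)"
  unfolding q_sel_def by (rule sales.maximizer_sel)

lemma alpha_sel_mono: "mono alpha_sel"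
  using prod.sel_mono by (simp add: alpha_sel_def mono_def)

lemma q_sel_antimono: "antimono q_sel"
  using sales.sel_mono by (simp add: q_sel_def mono_def antimono_def)

lemma drift_mono: "z \<le> w \<Longrightarrow> drift z \<le> drift w"
  using monoD[OF alpha_sel_mono, of z w] antimonoD[OF q_sel_antimono, of z w] by (simp add: drift_def)

lemma alpha_sel_measurable [measurable]: "alpha_sel \<in> borel_measurable borel"
  by (rule borel_measurable_mono[OF alpha_sel_mono])

lemma q_sel_measurable [measurable]: "q_sel \<in> borel_measurable borel"
proof -
  have [measurable]: "sales.sel \<in> borel_measurable borel" by (rule borel_measurable_mono[OF sales.sel_mono])
  show ?thesis unfolding q_sel_def[abs_def] by measurable
qed

lemma H_subgradient:
  assumes "prod.maximizer z a" "sales.maximizer (- z) q"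
  shows "H z + (a - q) * (w - z) \<le> H w"
  using prod.conj_fun_subgradient[OF assms(1), of w] sales.conj_fun_subgradient[OF assms(2), of "-w"]
  unfolding H_eq R_conj_def by (simp add: algebra_simps)

text \<open>
  A positive rate in \<open>A\<close> makes \<open>H\<close> grow at \<open>\<infinity>\<close>, a positive rate in \<open>Q\<close> makes it grow at
  \<open>-\<infinity>\<close>. So the sublevel sets are compact, the least minimum point exists, and the description of
  \<open>\<zeta>\<close> by \<open>LEAST\<close> is meaningful.
\<close>

lemma zeta_least_minimum: "H \<zeta> \<le> H z" "z < \<zeta> \<Longrightarrow> H \<zeta> < H z"
proof -
  obtain a1 where a1: "a1 \<in> A" "a1 > 0" using A(2,4) by force
  obtain q1 where q1: "q1 \<in> Q" "q1 > 0" using Q(2,4) by force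
  have ca: "a1 * z - C a1 \<le> H z" for z
    using prod.conj_fun_ge[OF a1(1), of z] R_conj_ge[OF Q(3), of z] R(2) Q(3) unfolding H_eq by force
  have cq: "R q1 - q1 * z - C 0 \<le> H z" for z
    using prod.conj_fun_ge[OF A(3), of z] R_conj_ge[OF q1(1), of z] unfolding H_eq by simp
  have comp: "compact {z. H z \<le> K}" for K
  proof -
    have "z \<in> {(R q1 - C 0 - K) / q1..(K + C a1) / a1}" if "H z \<le> K" for z
    proof -
      have "a1 * z \<le> K + C a1" "R q1 - C 0 - K \<le> q1 * z" using ca[of z] cq[of z] that by linarith+
      thus ?thesis using a1 q1 by (simp add: field_simps)
    qed
    hence "{z. H z \<le> K} \<subseteq> {(R q1 - C 0 - K) / q1..(K + C a1) / a1}" by blast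
    hence "bounded {z. H z \<le> K}" using bounded_closed_interval bounded_subset by blast
    moreover have "closed {z. H z \<le> K}"
      by (rule closed_Collect_le[OF H_continuous]) auto
    ultimately show ?thesis by (simp add: compact_eq_bounded_closed)
  qed
  have "{z. H z \<le> H 0} \<noteq> {}" by auto
  from continuous_attains_inf[OF comp this continuous_on_subset[OF H_continuous subset_UNIV]]
  obtain z0 where z0: "H z0 \<le> H 0" "\<And>y. H y \<le> H 0 \<Longrightarrow> H z0 \<le> H y" by blast
  have z0: "H z0 \<le> H y" for y using z0(2)[of y] z0(1) by linarith
  have "{z. H z \<le> H z0} \<noteq> {}" by auto
  from compact_attains_inf[OF comp this]
  obtain z1 where z1: "H z1 \<le> H z0" "\<And>y. H y \<le> H z0 \<Longrightarrow> z1 \<le> y" by blast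
  have min: "is_arg_min H (\<lambda>_. True) z \<longleftrightarrow> H z \<le> H z0" for z
    unfolding is_arg_min_def using z0 by (force simp: not_less intro: order_trans)
  have "\<zeta> = z1" unfolding zeta_def
    by (rule Least_equality) (use z1 min in auto)
  thus "H \<zeta> \<le> H z" "z < \<zeta> \<Longrightarrow> H \<zeta> < H z" using z0 z1 by (auto intro: order_trans simp: not_le[symmetric])
qed

text \<open>
  A nonnegative subgradient to the left of \<open>\<zeta>\<close> would produce a smaller minimum point.
\<close>

lemma drift_neg: "z < \<zeta> \<Longrightarrow> drift z < 0"
proof (rule ccontr)
  assume z: "z < \<zeta>" "\<not> drift z < 0"
  hence "0 \<le> drift z * (\<zeta> - z)" by simp
  hence "H z \<le> H \<zeta>" using H_subgradient[OF alpha_sel q_sel, of z \<zeta>] by (simp add: drift_def)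
  thus False using zeta_least_minimum(2)[OF z(1)] by simp
qed

section \<open>Stock as a function of the time to depletion\<close>

text \<open>
  Speed of selling out at the time \<open>r\<close> before the stock is exhausted. The truncation matters at \<open>r = 0\<close>
  only, where the selected subgradient of \<open>H\<close> at \<open>\<zeta>\<close> may be positive; it keeps the function
  nonnegative and monotone everywhere.
\<close>

definition depletion :: "real \<Rightarrow> real" where
  "depletion r = max 0 (- drift (\<zeta> * exp (- \<beta> * r)))"

lemma depletion_mono: "r \<le> s \<Longrightarrow> depletion r \<le> depletion s"
proof -
  assume "r \<le> s"
  hence "\<zeta> * exp (- \<beta> * s) \<le> \<zeta> * exp (- \<beta> * r)" using beta zeta_pos by simp
  from drift_mono[OF this] show ?thesis unfolding depletion_def by linarith
qed

lemma depletion_eq: "0 < r \<Longrightarrow> depletion r = - drift (\<zeta> * exp (- \<beta> * r))"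
  and depletion_pos: "0 < r \<Longrightarrow> 0 < depletion r"
proof -
  assume "0 < r"
  hence "\<zeta> * exp (- \<beta> * r) < \<zeta>" using beta zeta_pos by simp
  from drift_neg[OF this] show "depletion r = - drift (\<zeta> * exp (- \<beta> * r))" "0 < depletion r"
    by (auto simp: depletion_def)
qed

lemma depletion_integrable: "depletion integrable_on {a..b}"
  by (rule integrable_on_mono_on) (auto simp: mono_on_def depletion_mono)

text \<open>
  The inventory from which the optimal plan needs the time \<open>s\<close> to reach zero. Parametrizing by the
  remaining time instead of the price avoids any differentiation of \<open>H\<close>.
\<close>

definition stock :: "real \<Rightarrow> real" where "stock s = integral {0..s} depletion"

lemma stock_0 [simp]: "stock 0 = 0" by (simp add: stock_def)

lemma stock_increment:
  assumes "0 \<le> s" "s \<le> t"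
  shows "stock t - stock s = integral {s..t} depletion" "depletion s * (t - s) \<le> stock t - stock s"
proof -
  show eq: "stock t - stock s = integral {s..t} depletion"
    using Henstock_Kurzweil_Integration.integral_combine[OF assms depletion_integrable]
    by (simp add: stock_def)
  have "integral {s..t} (\<lambda>_. depletion s) \<le> integral {s..t} depletion"
    by (rule integral_le) (auto intro: depletion_integrable depletion_mono)
  thus "depletion s * (t - s) \<le> stock t - stock s" unfolding eq using assms by (simp add: mult.commute)
qed

lemma stock_strict_mono:
  assumes "0 \<le> s" "s < t"
  shows "stock s < stock t"
proof -
  let ?u = "(s + t) / 2"
  have "0 \<le> depletion s * (?u - s)" using assms by (simp add: depletion_def)
  moreover have "0 < depletion ?u * (t - ?u)" using assms depletion_pos[of ?u] by simp
  ultimately show ?thesis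
    using stock_increment(2)[of s ?u] stock_increment(2)[of ?u t] assms by simp
qed

lemma stock_nonneg: "0 \<le> s \<Longrightarrow> 0 \<le> stock s"
  using stock_strict_mono[of 0 s] by (cases "s = 0") auto

lemma stock_eq_iff: "0 \<le> s \<Longrightarrow> 0 \<le> t \<Longrightarrow> stock s = stock t \<longleftrightarrow> s = t"
  using stock_strict_mono[of s t] stock_strict_mono[of t s] by (cases s t rule: linorder_cases) auto

lemma stock_continuous: "continuous_on {0..b} stock"
  unfolding stock_def[abs_def] by (rule indefinite_integral_continuous_1[OF depletion_integrable])

text \<open>
  The speed is bounded below by \<open>depletion 1\<close> from time 1 on, so the stock is unbounded.
\<close>

lemma stock_surj:
  assumes "0 \<le> x"
  obtains s where "0 \<le> s" "stock s = x"
proof -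
  \<comment> \<open>Time 1 is an arbitrary positive time at which the speed is positive.\<close>
  let ?d = "depletion 1"
  have d: "?d > 0" by (simp add: depletion_pos)
  define t where "t = 1 + x / ?d"
  have t: "1 \<le> t" using assms d by (simp add: t_def)
  have "x \<le> stock t - stock 1" using stock_increment(2)[of 1 t] t d by (simp add: t_def)
  hence "x \<le> stock t" using stock_nonneg[of 1] by simp
  then show ?thesis using IVT'[of stock 0 x t] assms t stock_continuous that by force
qed

definition depletion_time :: "real \<Rightarrow> real" where
  "depletion_time x = (THE s. 0 \<le> s \<and> stock s = x)"

lemma depletion_time_stock: "0 \<le> s \<Longrightarrow> depletion_time (stock s) = s"
  unfolding depletion_time_def by (rule the_equality) (auto simp: stock_eq_iff)

lemma depletion_time:
  assumes "0 \<le> x"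
  shows "0 \<le> depletion_time x" "stock (depletion_time x) = x"
proof -
  obtain s where "0 \<le> s" "stock s = x" using stock_surj[OF assms] .
  thus "0 \<le> depletion_time x" "stock (depletion_time x) = x" using depletion_time_stock[of s] by auto
qed

text \<open>
  The inverse of a continuous injection is continuous on the image of a compact interval;
  continuity at \<open>x\<close> only needs an interval whose image contains \<open>x\<close> in its interior relative to
  \<open>[0,\<infinity>)\<close>.
\<close>

lemma depletion_time_continuous: "continuous_on {0..} depletion_time"
  unfolding continuous_on_eq_continuous_within
proof
  fix x :: real assume x: "x \<in> {0..}"
  define N where "N = depletion_time x + 1"
  have N: "0 \<le> N" "x < stock N"
    using x depletion_time[of x] stock_strict_mono[of "depletion_time x" N] by (auto simp: N_def)
  have im: "stock ` {0..N} = {0..stock N}"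
  proof (intro equalityI subsetI)
    fix y assume "y \<in> stock ` {0..N}"
    then obtain s where "0 \<le> s" "s \<le> N" "y = stock s" by auto
    thus "y \<in> {0..stock N}" using stock_nonneg[of s] stock_strict_mono[of s N] by (cases "s = N") auto
  next
    fix y assume y: "y \<in> {0..stock N}"
    show "y \<in> stock ` {0..N}"
      using IVT'[of stock 0 y N] y N stock_continuous by force
  qed
  have "continuous_on {0..stock N} depletion_time"
    unfolding im[symmetric] by (rule continuous_on_inv[OF stock_continuous]) (auto simp: depletion_time_stock)
  hence "continuous (at x within {0..stock N}) depletion_time"
    using x N unfolding continuous_on_eq_continuous_within by auto
  moreover have "at x within {0..stock N} = at x within {0..}"
    by (rule at_within_nhd[of _ "{..<stock N}"]) (use N in auto)
  ultimately show "continuous (at x within {0..}) depletion_time" by simp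
qed

text \<open>
  The multiplier matching the inventory \<open>x\<close>; it turns out to be the derivative of the value function.
\<close>

definition price :: "real \<Rightarrow> real" where "price x = \<zeta> * exp (- \<beta> * depletion_time x)"

lemma price_bounds: "0 < price x" "0 \<le> x \<Longrightarrow> price x \<le> \<zeta>"
  using zeta_pos beta depletion_time(1)[of x] by (auto simp: price_def)

lemma price_0: "price 0 = \<zeta>"
  using depletion_time_stock[of 0] by (simp add: price_def)

lemma price_continuous: "continuous_on {0..} price"
  unfolding price_def[abs_def] by (intro continuous_intros depletion_time_continuous)

section \<open>Lagrangian bound for ordinary controls\<close>

text \<open>
  Multiplier of the inventory: it grows at the rate \<open>\<beta>\<close> until it reaches \<open>\<zeta>\<close>, where the state
  constraint becomes active.
\<close>

definition costate :: "real \<Rightarrow> real \<Rightarrow> real" where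
  "costate p t = min (p * exp (\<beta> * t)) \<zeta>"

definition dual :: "real \<Rightarrow> real \<Rightarrow> real" where
  "dual x p = x * p + (LINT t:{0..}|lborel. exp (- \<beta> * t) * H (costate p t))"

text \<open>
  \<open>revenue_bound\<close> and \<open>cost_bound\<close> are the two sides of the Fenchel-Young inequalities along the
  costate, discounted. They are kept apart because the relaxed payoff integrates revenue and cost
  separately.
\<close>

definition revenue_bound :: "real \<Rightarrow> (real \<Rightarrow> real) \<Rightarrow> real \<Rightarrow> real" where
  "revenue_bound p q t = exp (- \<beta> * t) * (R_conj (costate p t) + costate p t * q t)"

definition cost_bound :: "real \<Rightarrow> (real \<Rightarrow> real) \<Rightarrow> real \<Rightarrow> real" where
  "cost_bound p a t = exp (- \<beta> * t) * (costate p t * a t - C_conj (costate p t))"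

lemma R_conj_measurable [measurable]: "R_conj \<in> borel_measurable borel"
  by (rule borel_measurable_continuous_onI[OF R_conj_continuous])

lemma C_conj_measurable [measurable]: "C_conj \<in> borel_measurable borel"
  by (rule borel_measurable_continuous_onI[OF C_conj_continuous])

lemma H_measurable [measurable]: "H \<in> borel_measurable borel"
  by (rule borel_measurable_continuous_onI[OF H_continuous])

lemma costate_measurable [measurable]: "costate p \<in> borel_measurable borel"
  unfolding costate_def[abs_def] by measurable

lemma costate_bounds: "0 < p \<Longrightarrow> 0 < costate p t" "costate p t \<le> \<zeta>"
  using zeta_pos by (auto simp: costate_def)

lemma conj_bounded_on_costates:
  "\<exists>K. \<forall>p t. 0 < p \<longrightarrow> \<bar>R_conj (costate p t)\<bar> \<le> K \<and> \<bar>C_conj (costate p t)\<bar> \<le> K"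
proof -
  have "\<exists>K. \<forall>z\<in>{0..\<zeta>}. norm (f z) \<le> K" if "continuous_on UNIV f" for f :: "real \<Rightarrow> real"
    using compact_imp_bounded[OF compact_continuous_image[OF continuous_on_subset[OF that subset_UNIV] compact_Icc]]
    unfolding bounded_iff by (metis image_eqI)
  then obtain K1 K2 where "\<forall>z\<in>{0..\<zeta>}. norm (R_conj z) \<le> K1" "\<forall>z\<in>{0..\<zeta>}. norm (C_conj z) \<le> K2"
    using R_conj_continuous C_conj_continuous by metis
  moreover have "costate p t \<in> {0..\<zeta>}" if "0 < p" for p t using costate_bounds[of p t] that by simp
  ultimately show ?thesis by (intro exI[of _ "max K1 K2"]) (simp add: le_max_iff_disj)
qed

lemma revenue_minus_cost_bound:
  "revenue_bound p q t - cost_bound p a t = exp (- \<beta> * t) * H (costate p t) - (exp (- \<beta> * t) * costate p t) * (a t - q t)"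
  unfolding revenue_bound_def cost_bound_def H_eq by (simp add: algebra_simps)

lemma discounted_costate: "exp (- \<beta> * t) * costate p t = min p (\<zeta> * exp (- \<beta> * t))"
proof -
  have "exp (- \<beta> * t) * (p * exp (\<beta> * t)) = p * exp (- \<beta> * t + \<beta> * t)" by (simp only: exp_add mult_ac)
  also have "\<dots> = p" by simp
  finally have e: "exp (- \<beta> * t) * (p * exp (\<beta> * t)) = p" .
  have "exp (- \<beta> * t) * costate p t = min (exp (- \<beta> * t) * (p * exp (\<beta> * t))) (exp (- \<beta> * t) * \<zeta>)"
    unfolding costate_def min_mult_distrib_left by simp
  thus ?thesis unfolding e by (simp only: mult.commute)
qed

lemma discounted_costate_antimono:
  "s \<le> t \<Longrightarrow> exp (- \<beta> * t) * costate p t \<le> exp (- \<beta> * s) * costate p s"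
  unfolding discounted_costate using beta zeta_pos by (intro min.mono) auto

lemma H_discounted_integrable:
  assumes "0 < p"
  shows "set_integrable lborel {0..} (\<lambda>t. exp (- \<beta> * t) * H (costate p t))"
proof -
  obtain K where K: "\<bar>R_conj (costate p t)\<bar> \<le> K" "\<bar>C_conj (costate p t)\<bar> \<le> K" for t
    using conj_bounded_on_costates assms by metis
  have "\<bar>H (costate p t)\<bar> \<le> K + K" for t
    using K[of t] unfolding H_eq by linarith
  thus ?thesis by (intro set_integrable_exp_mult_bounded[OF beta, of _ "K + K"]) auto
qed

lemma revenue_bound_integrable:
  assumes p: "0 < p" and [measurable]: "q \<in> borel_measurable borel"
    and q: "\<And>t. 0 \<le> t \<Longrightarrow> 0 \<le> q t \<and> q t \<le> B"
  shows "set_integrable lborel {0..} (revenue_bound p q)"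
proof -
  obtain K where K: "\<bar>R_conj (costate p t)\<bar> \<le> K" for t using conj_bounded_on_costates p by metis
  have "\<bar>R_conj (costate p t) + costate p t * q t\<bar> \<le> K + \<zeta> * B" if "0 \<le> t" for t
  proof -
    have "0 \<le> costate p t * q t" "costate p t * q t \<le> \<zeta> * B"
      using q[OF that] costate_bounds[of p t] p by (auto intro!: mult_nonneg_nonneg mult_mono)
    thus ?thesis using K[of t] by linarith
  qed
  thus ?thesis unfolding revenue_bound_def[abs_def]
    by (intro set_integrable_exp_mult_bounded[OF beta, of _ "K + \<zeta> * B"]) auto
qed

lemma cost_bound_integrable:
  assumes p: "0 < p" and [measurable]: "a \<in> borel_measurable borel"
    and a: "\<And>t. 0 \<le> t \<Longrightarrow> 0 \<le> a t \<and> a t \<le> B"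
  shows "set_integrable lborel {0..} (cost_bound p a)"
proof -
  obtain K where K: "\<bar>C_conj (costate p t)\<bar> \<le> K" for t using conj_bounded_on_costates p by metis
  have "\<bar>costate p t * a t - C_conj (costate p t)\<bar> \<le> K + \<zeta> * B" if "0 \<le> t" for t
  proof -
    have "0 \<le> costate p t * a t" "costate p t * a t \<le> \<zeta> * B"
      using a[OF that] costate_bounds[of p t] p by (auto intro!: mult_nonneg_nonneg mult_mono)
    thus ?thesis using K[of t] by linarith
  qed
  thus ?thesis unfolding cost_bound_def[abs_def]
    by (intro set_integrable_exp_mult_bounded[OF beta, of _ "K + \<zeta> * B"]) auto
qed

lemma weighted_drift_integrable:
  assumes "0 < p" "set_integrable lborel {a..b} g" "0 \<le> a"
  shows "set_integrable lborel {a..b} (\<lambda>t. (exp (- \<beta> * t) * costate p t) * g t)"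
proof (rule set_integrable_mult_bounded[OF assms(2), of _ \<zeta>])
  fix t assume "t \<in> {a..b}"
  hence "exp (- \<beta> * t) \<le> 1" using assms beta by simp
  hence "exp (- \<beta> * t) * costate p t \<le> 1 * \<zeta>"
    using costate_bounds[of p t] assms by (intro mult_mono) auto
  thus "\<bar>exp (- \<beta> * t) * costate p t\<bar> \<le> \<zeta>" using costate_bounds[of p t] assms by simp
qed measurable

text \<open>
  The gap between the Hamiltonian part of the dual value and the net bound is the integral
  of the drift weighted with the discounted costate. Integrals over bounded intervals are used
  because the net production rate itself need not be integrable on \<open>[0,\<infinity>)\<close>.
\<close>

lemma payoff_limit:
  assumes p: "0 < p" and ri: "set_integrable lborel {0..} (revenue_bound p q)"
    and ci: "set_integrable lborel {0..} (cost_bound p a)"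
    and gi: "\<And>t. 0 \<le> t \<Longrightarrow> set_integrable lborel {0..t} (\<lambda>s. a s - q s)"
  shows "((\<lambda>T. integral {0..T} (\<lambda>t. (exp (- \<beta> * t) * costate p t) * (a t - q t)))
    \<longlongrightarrow> (LINT t:{0..}|lborel. exp (- \<beta> * t) * H (costate p t)) - ((LINT t:{0..}|lborel. revenue_bound p q t) - (LINT t:{0..}|lborel. cost_bound p a t))) at_top"
proof -
  let ?h = "\<lambda>t. exp (- \<beta> * t) * H (costate p t)"
  let ?w = "\<lambda>t. (exp (- \<beta> * t) * costate p t) * (a t - q t)"
  have hi: "set_integrable lborel {0..} ?h" by (rule H_discounted_integrable[OF p])
  have d: "set_integrable lborel {0..} (\<lambda>t. ?h t - (revenue_bound p q t - cost_bound p a t))"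
    by (intro set_integral_diff hi ri ci)
  have eq: "(\<lambda>t. ?h t - (revenue_bound p q t - cost_bound p a t)) = ?w" unfolding revenue_minus_cost_bound by simp
  have lim: "((\<lambda>T. LINT t:{0..T}|lborel. ?w t) \<longlongrightarrow> (LINT t:{0..}|lborel. ?w t)) at_top"
    by (rule tendsto_set_lebesgue_integral_at_top) (use d eq in auto)
  have "(LINT t:{0..}|lborel. ?w t) = (LINT t:{0..}|lborel. ?h t) - ((LINT t:{0..}|lborel. revenue_bound p q t) - (LINT t:{0..}|lborel. cost_bound p a t))"
    unfolding eq[symmetric] using hi ri ci by simp
  moreover have "\<forall>\<^sub>F T in at_top. (LINT t:{0..T}|lborel. ?w t) = integral {0..T} ?w"
    using set_borel_integral_eq_integral(2)[OF weighted_drift_integrable[OF p gi]]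
    by (intro eventually_mono[OF eventually_ge_at_top[of 0]]) auto
  ultimately show ?thesis using lim tendsto_cong by fastforce
qed

text \<open>
  Weak duality: a nonnegative inventory means that the primitive of the net production rate is at
  least \<open>- x\<close>, and the discounted costate is a nonincreasing weight with initial value \<open>p\<close>.
\<close>

lemma dual_bound:
  assumes p: "0 < p" "p \<le> \<zeta>" and ri: "set_integrable lborel {0..} (revenue_bound p q)"
    and ci: "set_integrable lborel {0..} (cost_bound p a)"
    and gi: "\<And>t. 0 \<le> t \<Longrightarrow> set_integrable lborel {0..t} (\<lambda>s. a s - q s)"
    and feas: "\<And>t. 0 \<le> t \<Longrightarrow> 0 \<le> x + (LINT s:{0..t}|lborel. a s - q s)"
  shows "(LINT t:{0..}|lborel. revenue_bound p q t) - (LINT t:{0..}|lborel. cost_bound p a t) \<le> dual x p"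
proof -
  let ?g = "\<lambda>s. a s - q s" and ?l = "\<lambda>t. exp (- \<beta> * t) * costate p t"
  have l0: "?l 0 = p" using p by (simp add: costate_def)
  have ev: "p * (- x) \<le> integral {0..T} (\<lambda>t. ?l t * ?g t)" if T: "0 \<le> T" for T
  proof -
    note gT = set_borel_integral_eq_integral[OF gi]
    have lo: "- x \<le> integral {0..t} ?g" if "0 \<le> t" for t
      using feas[OF that] gT(2)[OF that] by simp
    have "continuous_on {0..T} (\<lambda>t. integral {0..t} ?g)"
      by (intro indefinite_integral_continuous_1 gT(1) T)
    hence "\<exists>u\<in>{0..T}. \<forall>t\<in>{0..T}. integral {0..t} ?g \<le> integral {0..u} ?g"
      using T by (intro continuous_attains_sup compact_Icc) auto
    then obtain u where D: "\<forall>t\<in>{0..T}. integral {0..t} ?g \<le> integral {0..u} ?g"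
      by (auto simp only: Bex_def)
    have "?l 0 * (- x) \<le> integral {0..T} (\<lambda>t. ?l t * ?g t)"
    proof (rule second_mean_value_bounds(1)[OF gT(1)[OF T] T, of _ _ "integral {0..u} ?g"])
      show "?l t \<le> ?l s" if "0 \<le> s" "s \<le> t" "t \<le> T" for s t
        by (rule discounted_costate_antimono[OF that(2)])
      show "0 \<le> ?l T" using costate_bounds(1)[OF p(1), of T] by simp
      show "- x \<le> integral {0..t} ?g \<and> integral {0..t} ?g \<le> integral {0..u} ?g" if "0 \<le> t" "t \<le> T" for t
        using lo[of t] D that by auto
    qed
    thus ?thesis unfolding l0 .
  qed
  have "p * (- x) \<le> (LINT t:{0..}|lborel. exp (- \<beta> * t) * H (costate p t)) - ((LINT t:{0..}|lborel. revenue_bound p q t) - (LINT t:{0..}|lborel. cost_bound p a t))"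
    by (rule tendsto_lowerbound[OF payoff_limit[OF p(1) ri ci gi]])
      (use ev in \<open>auto simp: eventually_at_top_linorder\<close>)
  thus ?thesis unfolding dual_def by (simp add: algebra_simps)
qed

text \<open>
  Complementary slackness up to an error: the weight is constant, equal to \<open>p\<close>, until \<open>\<tau>\<close>, when the
  inventory is exhausted; afterwards the inventory stays below \<open>\<kappa>\<close>, which costs at most \<open>p \<kappa>\<close>. The
  case \<open>\<kappa> = 0\<close> serves the exact optimizers, positive \<open>\<kappa>\<close> the rapidly switching controls.
\<close>

lemma dual_attained:
  assumes p: "0 < p" and ri: "set_integrable lborel {0..} (revenue_bound p q)"
    and ci: "set_integrable lborel {0..} (cost_bound p a)"
    and gi: "\<And>t. 0 \<le> t \<Longrightarrow> set_integrable lborel {0..t} (\<lambda>s. a s - q s)"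
    and \<tau>: "0 \<le> \<tau>" "p = \<zeta> * exp (- \<beta> * \<tau>)"
    and empty: "integral {0..\<tau>} (\<lambda>s. a s - q s) = - x"
    and small: "\<And>t. \<tau> \<le> t \<Longrightarrow> 0 \<le> integral {\<tau>..t} (\<lambda>s. a s - q s) \<and> integral {\<tau>..t} (\<lambda>s. a s - q s) \<le> \<kappa>"
  shows "dual x p - p * \<kappa> \<le> (LINT t:{0..}|lborel. revenue_bound p q t) - (LINT t:{0..}|lborel. cost_bound p a t)"
proof -
  let ?g = "\<lambda>s. a s - q s" and ?l = "\<lambda>t. exp (- \<beta> * t) * costate p t"
  have l: "?l t = p" if "t \<le> \<tau>" for t
  proof -
    have "exp (- \<beta> * \<tau>) \<le> exp (- \<beta> * t)" using that beta by simp
    hence "p \<le> \<zeta> * exp (- \<beta> * t)" unfolding \<tau>(2) using zeta_pos by simp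
    thus ?thesis unfolding discounted_costate by simp
  qed
  have ev: "integral {0..T} (\<lambda>t. ?l t * ?g t) \<le> p * (- x) + p * \<kappa>" if T: "\<tau> \<le> T" for T
  proof -
    have T0: "0 \<le> T" using T \<tau> by simp
    have gT: "?g integrable_on {0..T}" by (rule set_borel_integral_eq_integral(1)[OF gi[OF T0]])
    have wT: "(\<lambda>t. ?l t * ?g t) integrable_on {0..T}"
      by (rule set_borel_integral_eq_integral(1)[OF weighted_drift_integrable[OF p gi[OF T0]]]) simp
    have "integral {0..\<tau>} (\<lambda>t. ?l t * ?g t) = integral {0..\<tau>} (\<lambda>t. p * ?g t)"
      by (rule integral_cong) (use l in auto)
    also have "\<dots> = p * (- x)" using empty by simp
    finally have 1: "integral {0..\<tau>} (\<lambda>t. ?l t * ?g t) = p * (- x)" .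
    have "integral {\<tau>..T} (\<lambda>t. ?l t * ?g t) \<le> ?l \<tau> * \<kappa>"
    proof (rule second_mean_value_bounds(2)[OF _ T, of _ _ 0])
      show "?g integrable_on {\<tau>..T}" using integrable_subinterval_real[OF gT, of \<tau> T] \<tau> by simp
      show "?l t \<le> ?l s" if "\<tau> \<le> s" "s \<le> t" "t \<le> T" for s t
        by (rule discounted_costate_antimono[OF that(2)])
      show "0 \<le> ?l T" using costate_bounds(1)[OF p(1), of T] by simp
      show "0 \<le> integral {\<tau>..t} ?g \<and> integral {\<tau>..t} ?g \<le> \<kappa>" if "\<tau> \<le> t" "t \<le> T" for t
        using small that by blast
    qed
    hence 2: "integral {\<tau>..T} (\<lambda>t. ?l t * ?g t) \<le> p * \<kappa>" using l[of \<tau>] by simp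
    show ?thesis using 1 2 Henstock_Kurzweil_Integration.integral_combine[OF \<tau>(1) T wT] by simp
  qed
  have "(LINT t:{0..}|lborel. exp (- \<beta> * t) * H (costate p t)) - ((LINT t:{0..}|lborel. revenue_bound p q t) - (LINT t:{0..}|lborel. cost_bound p a t)) \<le> p * (- x) + p * \<kappa>"
    by (rule tendsto_upperbound[OF payoff_limit[OF p(1) ri ci gi]])
      (use ev in \<open>auto simp: eventually_at_top_linorder\<close>)
  thus ?thesis unfolding dual_def by (simp add: algebra_simps)
qed

lemma net_bound:
  assumes p: "0 < p" "p \<le> \<zeta>" and [measurable]: "a \<in> borel_measurable borel" "q \<in> borel_measurable borel"
    and a: "\<And>t. 0 \<le> t \<Longrightarrow> 0 \<le> a t" "\<And>t. 0 \<le> t \<Longrightarrow> set_integrable lborel {0..t} a"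
    and q: "\<And>t. 0 \<le> t \<Longrightarrow> 0 \<le> q t \<and> q t \<le> B"
    and feas: "\<And>t. 0 \<le> t \<Longrightarrow> 0 \<le> x + (LINT s:{0..t}|lborel. a s - q s)"
  shows "ext_integral lborel {0..} (\<lambda>t. ereal (revenue_bound p q t - cost_bound p a t)) \<le> ereal (dual x p)"
    and "ereal (LINT t:{0..}|lborel. revenue_bound p q t) - ext_integral lborel {0..} (\<lambda>t. ereal (cost_bound p a t)) \<le> ereal (dual x p)"
proof -
  have ri: "set_integrable lborel {0..} (revenue_bound p q)" by (rule revenue_bound_integrable[OF p(1) _ q]) auto
  obtain K where K: "\<bar>C_conj (costate p t)\<bar> \<le> K" for t
    using conj_bounded_on_costates p by metis
  have low: "set_integrable lborel {0..} (\<lambda>t. exp (- \<beta> * t) * (- C_conj (costate p t)))"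
    by (rule set_integrable_exp_mult_bounded[OF beta, of _ K]) (use K in auto)
  have cl: "exp (- \<beta> * t) * (- C_conj (costate p t)) \<le> cost_bound p a t" if "t \<in> {0..}" for t
    unfolding cost_bound_def using costate_bounds(1)[OF p(1), of t] a(1)[of t] that by (intro mult_left_mono) auto
  have gi: "set_integrable lborel {0..t} (\<lambda>s. a s - q s)" if "0 \<le> t" for t
    by (intro set_integral_diff a that set_integrable_Icc_bounded[of _ _ _ B]) (use q in auto)
  have cm: "(\<lambda>t. indicator {0..} t *\<^sub>R cost_bound p a t) \<in> borel_measurable lborel"
    and nm: "(\<lambda>t. indicator {0..} t *\<^sub>R (revenue_bound p q t - cost_bound p a t)) \<in> borel_measurable lborel"
    unfolding cost_bound_def[abs_def] revenue_bound_def[abs_def] by measurable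
  have main: "(LINT t:{0..}|lborel. revenue_bound p q t) - (LINT t:{0..}|lborel. cost_bound p a t) \<le> dual x p"
    if "set_integrable lborel {0..} (cost_bound p a)"
    by (rule dual_bound[OF p ri that gi feas])
  show "ext_integral lborel {0..} (\<lambda>t. ereal (revenue_bound p q t - cost_bound p a t)) \<le> ereal (dual x p)"
  proof (cases "set_integrable lborel {0..} (\<lambda>t. revenue_bound p q t - cost_bound p a t)")
    case True
    have "set_integrable lborel {0..} (\<lambda>t. revenue_bound p q t - (revenue_bound p q t - cost_bound p a t))"
      by (rule set_integral_diff(1)[OF ri True])
    hence "set_integrable lborel {0..} (cost_bound p a)" by simp
    thus ?thesis using main ext_integral_integrable[OF True] ri by simp
  next
    case False
    have "set_integrable lborel {0..} (\<lambda>t. revenue_bound p q t - exp (- \<beta> * t) * (- C_conj (costate p t)))"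
      by (rule set_integral_diff(1)[OF ri low])
    hence "ext_integral lborel {0..} (\<lambda>t. ereal (revenue_bound p q t - cost_bound p a t)) = -\<infinity>"
      by (rule ext_integral_bot[OF nm False]) (use cl in force)
    thus ?thesis by simp
  qed
  show "ereal (LINT t:{0..}|lborel. revenue_bound p q t) - ext_integral lborel {0..} (\<lambda>t. ereal (cost_bound p a t)) \<le> ereal (dual x p)"
  proof (cases "set_integrable lborel {0..} (cost_bound p a)")
    case True
    thus ?thesis using main ext_integral_integrable[OF True] by simp
  next
    case False
    from ext_integral_top[OF cm False low] cl show ?thesis by simp
  qed
qed

text \<open>
  Extending controls by zero to negative times makes them Borel functions on the line.
\<close>

lemma controls_extend:
  assumes "(\<alpha>, q) \<in> controls A' Q' x"
    and a'_def: "a' = (\<lambda>t. indicator {0..} t * \<alpha> t)" and q'_def: "q' = (\<lambda>t. indicator {0..} t * q t)"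
  shows "a' \<in> borel_measurable borel" "q' \<in> borel_measurable borel"
    "\<And>t. 0 \<le> t \<Longrightarrow> a' t = \<alpha> t \<and> q' t = q t \<and> \<alpha> t \<in> A' \<and> q t \<in> Q'"
    "\<And>t. 0 \<le> t \<Longrightarrow> set_integrable lborel {0..t} a'"
    "\<And>t. 0 \<le> t \<Longrightarrow> 0 \<le> x + (LINT s:{0..t}|lborel. a' s - q' s)"
proof -
  show "a' \<in> borel_measurable borel" "q' \<in> borel_measurable borel"
    using assms(1) unfolding a'_def q'_def controls_def by (auto simp: borel_measurable_restrict_space_iff)
  show e: "a' t = \<alpha> t \<and> q' t = q t \<and> \<alpha> t \<in> A' \<and> q t \<in> Q'" if "0 \<le> t" for t
    using assms(1) that unfolding a'_def q'_def controls_def by auto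
  fix t :: real assume t: "0 \<le> t"
  have "set_integrable lborel {0..t} \<alpha>" using assms(1) t unfolding controls_def by auto
  thus "set_integrable lborel {0..t} a'"
    by (subst set_integrable_cong[of lborel lborel "{0..t}" "{0..t}" a' \<alpha>]) (use e in auto)
  have "(LINT s:{0..t}|lborel. a' s - q' s) = (LINT s:{0..t}|lborel. \<alpha> s - q s)"
    by (rule set_lebesgue_integral_cong) (use e in auto)
  thus "0 \<le> x + (LINT s:{0..t}|lborel. a' s - q' s)" using assms(1) t unfolding controls_def by auto
qed

text \<open>
  The parameters stand for the original or the convexified rates and functions; both satisfy the
  Fenchel-Young inequalities.
\<close>

lemma payoff_le_dual:
  assumes p: "0 < p" "p \<le> \<zeta>" and A': "A' \<subseteq> {0..}" and Q': "Q' \<subseteq> {0..B}"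
    and r: "\<And>z y. y \<in> Q' \<Longrightarrow> r y \<le> ereal (R_conj z + z * y)"
    and c: "\<And>z y. y \<in> A' \<Longrightarrow> ereal (z * y - C_conj z) \<le> c y"
    and adm: "(\<alpha>, q) \<in> controls A' Q' x"
  shows "payoff \<beta> r c (\<alpha>, q) \<le> ereal (dual x p)"
proof -
  define a' where "a' = (\<lambda>t. indicator {0..} t * \<alpha> t)"
  define q' where "q' = (\<lambda>t. indicator {0..} t * q t)"
  note ext = controls_extend[OF adm a'_def q'_def]
  have "payoff \<beta> r c (\<alpha>, q) \<le> ext_integral lborel {0..} (\<lambda>t. ereal (revenue_bound p q' t - cost_bound p a' t))"
    unfolding payoff_def prod.case
  proof (rule ext_integral_mono_AE, rule AE_I2, rule impI)
    fix t :: real assume "t \<in> {0..}"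
    hence t: "0 \<le> t" by simp
    let ?z = "costate p t"
    have "r (q t) - c (\<alpha> t) \<le> ereal (R_conj ?z + ?z * q' t) - ereal (?z * a' t - C_conj ?z)"
      using r[of "q t" ?z] c[of "\<alpha> t" ?z] ext(3)[OF t] by (intro ereal_minus_mono) auto
    hence "ereal (exp (- \<beta> * t)) * (r (q t) - c (\<alpha> t))
      \<le> ereal (exp (- \<beta> * t)) * (ereal (R_conj ?z + ?z * q' t) - ereal (?z * a' t - C_conj ?z))"
      by (intro ereal_mult_left_mono) auto
    thus "ereal (exp (- \<beta> * t)) * (r (q t) - c (\<alpha> t)) \<le> ereal (revenue_bound p q' t - cost_bound p a' t)"
      unfolding revenue_bound_def cost_bound_def by (simp add: algebra_simps)
  qed
  also have "\<dots> \<le> ereal (dual x p)"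
  proof (rule net_bound(1)[OF p ext(1,2) _ ext(4) _ ext(5)])
    fix t :: real assume "0 \<le> t"
    from ext(3)[OF this] A' Q' show "0 \<le> a' t" "0 \<le> q' t \<and> q' t \<le> B" by auto
  qed
  finally show ?thesis .
qed

lemma payoff_eq:
  assumes ri: "set_integrable lborel {0..} (revenue_bound p b)" and ci: "set_integrable lborel {0..} (cost_bound p a)"
    and N: "countable N"
    and e: "\<And>t. 0 \<le> t \<Longrightarrow> t \<notin> N \<Longrightarrow> r (q t) = ereal (R_conj (costate p t) + costate p t * b t)
        \<and> c (\<alpha> t) = ereal (costate p t * a t - C_conj (costate p t))"
  shows "payoff \<beta> r c (\<alpha>, q) = ereal ((LINT t:{0..}|lborel. revenue_bound p b t) - (LINT t:{0..}|lborel. cost_bound p a t))"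
proof -
  have "AE t in lborel. t \<notin> N" using countable_imp_null_set_lborel[OF N] AE_not_in by blast
  hence "payoff \<beta> r c (\<alpha>, q) = ext_integral lborel {0..} (\<lambda>t. ereal (revenue_bound p b t - cost_bound p a t))"
    unfolding payoff_def prod.case using e
    by (intro ext_integral_cong_AE) (auto simp: revenue_bound_def cost_bound_def algebra_simps)
  also have "\<dots> = ereal ((LINT t:{0..}|lborel. revenue_bound p b t) - (LINT t:{0..}|lborel. cost_bound p a t))"
    using ext_integral_integrable[OF set_integral_diff(1)[OF ri ci]] set_integral_diff(2)[OF ri ci] by simp
  finally show ?thesis .
qed

section \<open>The switching strategy\<close>

text \<open>
  Rates driven by the costate while the stock lasts, given by \<open>u\<close> from the time of depletion on.
\<close>

definition switch :: "real \<Rightarrow> (real \<Rightarrow> real) \<Rightarrow> (real \<Rightarrow> real) \<Rightarrow> real \<Rightarrow> real" where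
  "switch x f u t = (if t < depletion_time x then f (costate (price x) t) else u t)"

lemma costate_price:
  assumes "t \<le> depletion_time x"
  shows "costate (price x) t = \<zeta> * exp (- \<beta> * (depletion_time x - t))"
proof -
  have "- \<beta> * depletion_time x + \<beta> * t = - \<beta> * (depletion_time x - t)" by (simp add: algebra_simps)
  hence e: "price x * exp (\<beta> * t) = \<zeta> * exp (- \<beta> * (depletion_time x - t))"
    unfolding price_def by (simp only: mult.assoc exp_add[symmetric])
  have "exp (- \<beta> * (depletion_time x - t)) \<le> 1" using assms beta by simp
  thus ?thesis unfolding costate_def e using zeta_pos by simp
qed

lemma costate_price_late:
  assumes "depletion_time x \<le> t"
  shows "costate (price x) t = \<zeta>"
proof -
  have e: "price x * exp (\<beta> * t) = \<zeta> * exp (\<beta> * (t - depletion_time x))"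
    unfolding price_def mult.assoc exp_add[symmetric] by (simp add: algebra_simps)
  have "1 \<le> exp (\<beta> * (t - depletion_time x))" using assms beta by simp
  thus ?thesis unfolding costate_def e using zeta_pos by simp
qed

text \<open>
  Reversing time, the drift along the costate is minus the speed of depletion; the instant of
  depletion, where the speed was truncated, is a null set.
\<close>

lemma stock_path:
  assumes "0 \<le> t" "t \<le> depletion_time x"
  shows "((\<lambda>s. switch x alpha_sel ua s - switch x q_sel uq s) has_integral
    (stock (depletion_time x - t) - stock (depletion_time x))) {0..t}"
proof -
  let ?T = "depletion_time x"
  have "(depletion has_integral (stock ?T - stock (?T - t))) (cbox (?T - t) ?T)"
    using integrable_integral[OF depletion_integrable[of "?T - t" ?T]] stock_increment(1)[of "?T - t" ?T] assms by simp
  from has_integral_affinity[OF this, of "-1" ?T]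
  have "((\<lambda>s. depletion (?T - s)) has_integral (stock ?T - stock (?T - t))) ((\<lambda>s. ?T - s) ` {?T - t..?T})"
    by simp
  moreover have "(\<lambda>s. ?T - s) ` {?T - t..?T} = {0..t}" using image_diff_atLeastAtMost[of ?T "?T - t" ?T] by simp
  ultimately have "((\<lambda>s. depletion (?T - s)) has_integral (stock ?T - stock (?T - t))) {0..t}" by simp
  from has_integral_neg[OF this]
  have "((\<lambda>s. - depletion (?T - s)) has_integral (stock (?T - t) - stock ?T)) {0..t}" by simp
  thus ?thesis
  proof (rule has_integral_spike[of "{?T}", rotated 2])
    fix s assume "s \<in> {0..t} - {?T}"
    hence "s < ?T" using assms by auto
    thus "switch x alpha_sel ua s - switch x q_sel uq s = - depletion (?T - s)"
      using depletion_eq[of "?T - s"] costate_price[of s x] by (simp add: switch_def drift_def)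
  qed simp
qed

lemma switch_measurable [measurable]:
  assumes [measurable]: "f \<in> borel_measurable borel" "u \<in> borel_measurable borel"
  shows "switch x f u \<in> borel_measurable borel"
  unfolding switch_def[abs_def] by measurable

lemma sel_bounds:
  assumes "0 \<le> x"
  obtains B where "\<And>t. 0 \<le> alpha_sel (costate (price x) t)" "\<And>t. alpha_sel (costate (price x) t) \<le> B"
    "\<And>t. 0 \<le> q_sel (costate (price x) t)" "\<And>t. q_sel (costate (price x) t) \<le> B"
proof -
  obtain B where B: "Q \<subseteq> {0..B}" using compact_imp_bounded[OF Q(1)] Q(2)
    unfolding bounded_iff by (force simp: subset_iff)
  have "alpha_sel (costate (price x) t) \<le> alpha_sel \<zeta>" for t
    using monoD[OF alpha_sel_mono] costate_bounds(2) by blast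
  moreover have "0 \<le> alpha_sel z" "q_sel z \<in> Q" for z
    using alpha_sel[of z] q_sel[of z] A(2) unfolding prod.maximizer_def sales.maximizer_def by auto
  ultimately show ?thesis using that[of "max B (alpha_sel \<zeta>)"] B by (force simp: le_max_iff_disj)
qed

text \<open>
  The rates after depletion are arbitrary functions here, constrained only to keep the inventory in
  \<open>[0,\<kappa>]\<close>, so that constant and rapidly switching continuations are treated at once.
\<close>

lemma switching_strategy:
  assumes x: "0 \<le> x" and [measurable]: "ua \<in> borel_measurable borel" "uq \<in> borel_measurable borel"
    and u: "\<And>t. 0 \<le> ua t \<and> ua t \<le> B" "\<And>t. 0 \<le> uq t \<and> uq t \<le> B"
    and small: "\<And>t. depletion_time x \<le> t \<Longrightarrow> 0 \<le> integral {depletion_time x..t} (\<lambda>s. ua s - uq s) \<and>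
        integral {depletion_time x..t} (\<lambda>s. ua s - uq s) \<le> \<kappa>"
  defines "a \<equiv> switch x alpha_sel ua" and "q \<equiv> switch x q_sel uq"
  shows "a \<in> borel_measurable borel" "q \<in> borel_measurable borel"
    and "set_integrable lborel {0..t} a" "set_integrable lborel {0..t} q"
    and "0 \<le> t \<Longrightarrow> 0 \<le> x + (LINT s:{0..t}|lborel. a s - q s)"
    and "set_integrable lborel {0..} (revenue_bound (price x) q)" "set_integrable lborel {0..} (cost_bound (price x) a)"
    and "dual x (price x) - price x * \<kappa>
        \<le> (LINT t:{0..}|lborel. revenue_bound (price x) q t) - (LINT t:{0..}|lborel. cost_bound (price x) a t)"
proof -
  let ?T = "depletion_time x"
  note T = depletion_time[OF x]
  obtain B' where B': "\<And>t. 0 \<le> alpha_sel (costate (price x) t)" "\<And>t. alpha_sel (costate (price x) t) \<le> B'"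
    "\<And>t. 0 \<le> q_sel (costate (price x) t)" "\<And>t. q_sel (costate (price x) t) \<le> B'"
    using sel_bounds[OF x] by metis
  have ab: "0 \<le> a t \<and> a t \<le> max B B'" and qb: "0 \<le> q t \<and> q t \<le> max B B'" for t
    using B' u unfolding a_def q_def switch_def by (auto simp: le_max_iff_disj)
  show am: "a \<in> borel_measurable borel" and qm: "q \<in> borel_measurable borel" unfolding a_def q_def by measurable
  show ai: "set_integrable lborel {0..t} a" for t
    by (rule set_integrable_Icc_bounded[OF am, of _ _ "max B B'"]) (use ab in force)
  show qi: "set_integrable lborel {0..t} q" for t
    by (rule set_integrable_Icc_bounded[OF qm, of _ _ "max B B'"]) (use qb in force)
  have gi: "set_integrable lborel {0..t} (\<lambda>s. a s - q s)" for t using ai qi by simp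
  show ri: "set_integrable lborel {0..} (revenue_bound (price x) q)" and ci: "set_integrable lborel {0..} (cost_bound (price x) a)"
    using revenue_bound_integrable[OF price_bounds(1) qm qb] cost_bound_integrable[OF price_bounds(1) am ab] by blast+
  have path: "integral {0..t} (\<lambda>s. a s - q s) = stock (?T - t) - x" if "0 \<le> t" "t \<le> ?T" for t
    using integral_unique[OF stock_path[OF that]] T(2) unfolding a_def q_def by simp
  have late: "integral {?T..t} (\<lambda>s. a s - q s) = integral {?T..t} (\<lambda>s. ua s - uq s)" for t
    by (rule integral_cong) (auto simp: a_def q_def switch_def)
  have empty: "integral {0..?T} (\<lambda>s. a s - q s) = - x" using path[of ?T] T(1) by simp
  show "0 \<le> x + (LINT s:{0..t}|lborel. a s - q s)" if t: "0 \<le> t"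
  proof (cases "t \<le> ?T")
    case True
    thus ?thesis using path[OF t] stock_nonneg[of "?T - t"] set_borel_integral_eq_integral(2)[OF gi] by simp
  next
    case False
    hence "integral {0..?T} (\<lambda>s. a s - q s) + integral {?T..t} (\<lambda>s. a s - q s) = integral {0..t} (\<lambda>s. a s - q s)"
      using Henstock_Kurzweil_Integration.integral_combine[OF T(1) _ set_borel_integral_eq_integral(1)[OF gi]] by simp
    thus ?thesis using set_borel_integral_eq_integral(2)[OF gi] small[of t] False empty late by simp
  qed
  show "dual x (price x) - price x * \<kappa>
        \<le> (LINT t:{0..}|lborel. revenue_bound (price x) q t) - (LINT t:{0..}|lborel. cost_bound (price x) a t)"
    by (rule dual_attained[OF price_bounds(1) ri ci gi T(1) price_def empty]) (use small late in simp)
qed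

end

section \<open>Relaxed controls and mixtures of two point masses\<close>

lemma prob_measures_onD:
  assumes "\<mu> \<in> prob_measures_on S" "S \<in> sets borel"
  shows "prob_space \<mu>" "sets \<mu> = sets borel" "space \<mu> = UNIV" "measure \<mu> S = 1" "S \<in> sets \<mu>"
    "set_integrable \<mu> S (\<lambda>_. c::real)" "(LINT y:S|\<mu>. c::real) = c"
proof -
  show p: "prob_space \<mu>" and s: "sets \<mu> = sets borel" using assms(1) by (auto simp: prob_measures_on_def)
  show "space \<mu> = UNIV" using sets_eq_imp_space_eq[OF s] by simp
  show S: "S \<in> sets \<mu>" using s assms(2) by simp
  show m: "measure \<mu> S = 1" using assms(1) by (auto simp: prob_measures_on_def measure_def)
  interpret prob_space \<mu> by (rule p)
  have fin: "emeasure \<mu> S < \<infinity>" using emeasure_finite[of S] by (simp add: less_top[symmetric])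
  show "set_integrable \<mu> S (\<lambda>_. c)" using S fin unfolding set_integrable_def by simp
  show "(LINT y:S|\<mu>. c::real) = c" using m S fin unfolding set_lebesgue_integral_def by simp
qed

lemma continuous_on_closed_measurable:
  fixes f :: "real \<Rightarrow> real"
  assumes "closed S" "continuous_on S f"
  shows "(\<lambda>y. indicator S y *\<^sub>R f y) \<in> borel_measurable borel"
  using assms borel_measurable_continuous_on_indicator[of S f] by simp

context coercive_cost
begin

text \<open>
  Integrating the Fenchel-Young inequality: only the mean of a relaxed rate enters the bound, so
  relaxed controls are covered by the same duality as ordinary ones.
\<close>

lemma relaxed_cost_ge:
  assumes \<mu>: "\<mu> \<in> prob_measures_on S" and i: "set_integrable \<mu> S (\<lambda>y. y)"
  shows "ereal (z * (LINT y:S|\<mu>. y) - conj_fun z) \<le> ext_integral \<mu> S (\<lambda>y. ereal (f y))"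
proof -
  have S: "S \<in> sets borel" using closed by simp
  note m = prob_measures_onD[OF \<mu> S]
  have gi: "set_integrable \<mu> S (\<lambda>y. z * y - conj_fun z)"
    by (intro set_integral_diff(1) m(6)) (use i in simp)
  have geq: "(LINT y:S|\<mu>. z * y - conj_fun z) = z * (LINT y:S|\<mu>. y) - conj_fun z"
    using set_integral_diff(2)[of \<mu> S "\<lambda>y. z * y" "\<lambda>_. conj_fun z"] i m(6,7) by simp
  have le: "z * y - conj_fun z \<le> f y" if "y \<in> S" for y
    using conj_fun_ge[OF that, of z] by (simp add: mult.commute)
  show ?thesis
  proof (cases "set_integrable \<mu> S f")
    case True
    have "(LINT y:S|\<mu>. z * y - conj_fun z) \<le> (LINT y:S|\<mu>. f y)"
      by (rule set_integral_mono[OF gi True le])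
    thus ?thesis unfolding geq ext_integral_integrable[OF True] by simp
  next
    case False
    have "(\<lambda>y. indicator S y *\<^sub>R f y) \<in> borel_measurable \<mu>"
      using continuous_on_closed_measurable[OF closed cont] measurable_cong_sets[OF m(2) refl] by blast
    from ext_integral_top[OF this False gi le] show ?thesis by simp
  qed
qed

end

text \<open>
  As the distribution of a coin toss the mixture is a probability measure, and integrals against it
  are sums of two terms.
\<close>

lemma dirac_mix_eq_distr:
  assumes "0 \<le> \<gamma>" "\<gamma> \<le> 1"
  shows "dirac_mix \<gamma> a b = distr (measure_pmf (bernoulli_pmf \<gamma>)) borel (\<lambda>c. if c then a else b)"
proof -
  let ?D = "distr (measure_pmf (bernoulli_pmf \<gamma>)) borel (\<lambda>c. if c then a else b)"
  have e: "ennreal \<gamma> * emeasure (return borel a) B + ennreal (1 - \<gamma>) * emeasure (return borel b) B = emeasure ?D B"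
    if B: "B \<in> sets borel" for B
  proof -
    have "emeasure ?D B = (\<integral>\<^sup>+ c. indicator B (if c then a else b) \<partial>measure_pmf (bernoulli_pmf \<gamma>))"
    proof -
      have "emeasure ?D B = (\<integral>\<^sup>+ y. indicator B y \<partial>?D)" using B by simp
      also have "\<dots> = (\<integral>\<^sup>+ c. indicator B (if c then a else b) \<partial>measure_pmf (bernoulli_pmf \<gamma>))"
        by (subst nn_integral_distr) (use B in auto)
      finally show ?thesis .
    qed
    also have "\<dots> = indicator B a * ennreal \<gamma> + indicator B b * ennreal (1 - \<gamma>)"
      using assms by (simp add: nn_integral_bernoulli_pmf)
    finally show ?thesis using B by (simp add: mult.commute)
  qed
  have "dirac_mix \<gamma> a b = measure_of UNIV (sets borel) (emeasure ?D)"
    unfolding dirac_mix_def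
  proof (rule measure_of_eq)
    fix B assume "B \<in> sigma_sets UNIV (sets borel :: real set set)"
    hence "B \<in> sets borel" using sets.sigma_sets_eq[of "borel :: real measure"] by simp
    thus "ennreal \<gamma> * emeasure (return borel a) B + ennreal (1 - \<gamma>) * emeasure (return borel b) B = emeasure ?D B"
      by (rule e)
  qed simp
  also have "\<dots> = ?D" using measure_of_of_measure[of ?D] by simp
  finally show ?thesis .
qed

lemma dirac_mix_same:
  assumes "0 \<le> \<gamma>" "\<gamma> \<le> 1"
  shows "dirac_mix \<gamma> a a = return borel a"
proof -
  have e: "ennreal \<gamma> * m + ennreal (1 - \<gamma>) * m = m" for m :: ennreal
    using assms by (simp add: distrib_right[symmetric] ennreal_plus[symmetric] del: ennreal_plus)
  show ?thesis unfolding dirac_mix_def e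
    using measure_of_of_measure[of "return borel a"] by simp
qed

lemma dirac_mix:
  fixes f :: "real \<Rightarrow> real"
  assumes \<gamma>: "0 \<le> \<gamma>" "\<gamma> \<le> 1" and ab: "a \<in> S" "b \<in> S" and S: "closed S"
  shows "dirac_mix \<gamma> a b \<in> prob_measures_on S"
    and "continuous_on S f \<Longrightarrow> set_integrable (dirac_mix \<gamma> a b) S f"
    and "continuous_on S f \<Longrightarrow> (LINT y:S|dirac_mix \<gamma> a b. f y) = \<gamma> * f a + (1 - \<gamma>) * f b"
proof -
  let ?B = "measure_pmf (bernoulli_pmf \<gamma>)"
  have "prob_space (dirac_mix \<gamma> a b)" unfolding dirac_mix_eq_distr[OF \<gamma>]
    by (intro prob_space.prob_space_distr prob_space_measure_pmf) simp
  moreover have "emeasure (dirac_mix \<gamma> a b) S = 1"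
  proof -
    have "(\<lambda>c. if c then a else b) -` S = UNIV" using ab by auto
    thus ?thesis unfolding dirac_mix_eq_distr[OF \<gamma>] using S
      by (subst emeasure_distr) (simp_all add: measure_pmf.emeasure_space_1[simplified])
  qed
  ultimately show "dirac_mix \<gamma> a b \<in> prob_measures_on S"
    unfolding prob_measures_on_def by (simp add: dirac_mix_eq_distr[OF \<gamma>])
  assume f: "continuous_on S f"
  note m = continuous_on_closed_measurable[OF S f]
  show "set_integrable (dirac_mix \<gamma> a b) S f"
    unfolding set_integrable_def dirac_mix_eq_distr[OF \<gamma>]
    by (subst integrable_distr_eq[OF _ m]) (auto intro: integrable_measure_pmf_finite)
  show "(LINT y:S|dirac_mix \<gamma> a b. f y) = \<gamma> * f a + (1 - \<gamma>) * f b"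
    unfolding set_lebesgue_integral_def dirac_mix_eq_distr[OF \<gamma>]
    by (subst integral_distr[OF _ m]) (use \<gamma> ab in \<open>simp_all add: integral_bernoulli_pmf mult.commute\<close>)
qed

lemma borel_measurable_Ici_off_countable:
  fixes f g :: "real \<Rightarrow> real"
  assumes "g \<in> borel_measurable borel" "countable N" "\<And>t. 0 \<le> t \<Longrightarrow> t \<notin> N \<Longrightarrow> f t = g t"
  shows "f \<in> borel_measurable (restrict_space borel {0..})"
proof (rule measurable_discrete_difference[of g _ _ "N \<inter> {0..}"])
  show "g \<in> borel_measurable (restrict_space borel {0..})" using assms(1) by (rule measurable_restrict_space1)
  show "countable (N \<inter> {0..})" using assms(2) by simp
  show "{t} \<in> sets (restrict_space borel {0..})" if "t \<in> N \<inter> {0..}" for t :: real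
    using that by (auto simp: sets_restrict_space_iff)
qed (use assms(3) in \<open>auto simp: space_restrict_space\<close>)

lemma relaxed_map_dirac_mix:
  assumes S: "closed S" and \<gamma>: "0 \<le> \<gamma>" "\<gamma> \<le> 1" and N: "countable N"
    and [measurable]: "s1 \<in> borel_measurable borel" "s2 \<in> borel_measurable borel"
    and s: "\<And>t. 0 \<le> t \<Longrightarrow> t \<notin> N \<Longrightarrow> s1 t \<in> S \<and> s2 t \<in> S \<and> \<mu> t = dirac_mix \<gamma> (s1 t) (s2 t)"
    and p: "\<And>t. 0 \<le> t \<Longrightarrow> \<mu> t \<in> prob_measures_on S"
  shows "relaxed_map S \<mu>"
  unfolding relaxed_map_def
proof (intro conjI allI impI)
  fix \<phi> :: "real \<Rightarrow> real" assume \<phi>: "continuous_on S \<phi>"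
  let ?h = "\<lambda>y. indicator S y *\<^sub>R \<phi> y"
  have [measurable]: "?h \<in> borel_measurable borel" by (rule continuous_on_closed_measurable[OF S \<phi>])
  show "(\<lambda>t. LINT y:S|\<mu> t. \<phi> y) \<in> borel_measurable (restrict_space borel {0..})"
  proof (rule borel_measurable_Ici_off_countable[OF _ N])
    show "(\<lambda>t. \<gamma> * ?h (s1 t) + (1 - \<gamma>) * ?h (s2 t)) \<in> borel_measurable borel" by measurable
    show "(LINT y:S|\<mu> t. \<phi> y) = \<gamma> * ?h (s1 t) + (1 - \<gamma>) * ?h (s2 t)" if "0 \<le> t" "t \<notin> N" for t
      using s[OF that] dirac_mix(3)[OF \<gamma> _ _ S \<phi>, of "s1 t" "s2 t"] by simp
  qed
qed (use p in auto)

context production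
begin

section \<open>Lagrangian bound for relaxed controls\<close>

lemma Q_bound: "\<exists>B. Q \<subseteq> {0..B}"
proof -
  obtain B where B: "\<forall>q\<in>Q. norm q \<le> B" using compact_imp_bounded[OF Q(1)] unfolding bounded_iff by blast
  have "q \<in> {0..B}" if "q \<in> Q" for q
  proof -
    have "0 \<le> q" "\<bar>q\<bar> \<le> B" using that Q(2) B by auto
    thus ?thesis by simp
  qed
  thus ?thesis by blast
qed

lemma relaxed_revenue_le:
  assumes \<mu>: "\<mu> \<in> prob_measures_on Q"
  shows "ext_integral \<mu> Q (\<lambda>y. ereal (R y)) \<le> ereal (R_conj z + z * (LINT y:Q|\<mu>. y))"
    and "set_integrable \<mu> Q (\<lambda>y. y)"
proof -
  have clQ: "closed Q" by (rule sales.closed)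
  have Qb: "Q \<in> sets borel" using clQ by simp
  note m = prob_measures_onD[OF \<mu> Qb]
  have cont: "set_integrable \<mu> Q h" if h: "continuous_on Q h" for h :: "real \<Rightarrow> real"
  proof -
    obtain K where K: "\<forall>y\<in>Q. norm (h y) \<le> K"
      using compact_imp_bounded[OF compact_continuous_image[OF h Q(1)]] unfolding bounded_iff by auto
    have "(\<lambda>y. indicator Q y *\<^sub>R h y) \<in> borel_measurable \<mu>"
      using continuous_on_closed_measurable[OF clQ h] measurable_cong_sets[OF m(2) refl] clQ by auto
    hence mh: "set_borel_measurable \<mu> Q h" by (simp add: set_borel_measurable_def)
    show ?thesis
      by (rule set_integrable_bound[OF m(6)[of K] mh]) (use K in \<open>auto intro!: AE_I2 order_trans[OF _ abs_ge_self]\<close>)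
  qed
  show id: "set_integrable \<mu> Q (\<lambda>y. y)" by (rule cont) (rule continuous_on_id)
  have Ri: "set_integrable \<mu> Q R" by (rule cont[OF R(1)])
  hence Ri': "set_integrable \<mu> Q (\<lambda>y. - R y)" by (simp add: set_integrable_def)
  have "ereal (- z * (LINT y:Q|\<mu>. y) - R_conj z) \<le> ext_integral \<mu> Q (\<lambda>y. ereal (- R y))"
    unfolding R_conj_def by (rule sales.relaxed_cost_ge[OF \<mu> id])
  also have "\<dots> = ereal (- (LINT y:Q|\<mu>. R y))"
    unfolding ext_integral_integrable[OF Ri'] using set_integral_uminus[OF Ri] by simp
  finally show "ext_integral \<mu> Q (\<lambda>y. ereal (R y)) \<le> ereal (R_conj z + z * (LINT y:Q|\<mu>. y))"
    unfolding ext_integral_integrable[OF Ri] by simp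
qed

lemma relaxed_payoff_le_dual:
  assumes p: "0 < p" "p \<le> \<zeta>" and adm: "(\<alpha>, q) \<in> relaxed_controls A Q x"
  shows "relaxed_payoff A Q R C \<beta> (\<alpha>, q) \<le> ereal (dual x p)"
proof -
  define a where "a t = indicator {0..} t * (LINT y:A|\<alpha> t. y)" for t
  define b where "b t = indicator {0..} t * (LINT y:Q|q t. y)" for t
  have ma: "relaxed_map A \<alpha>" and mq: "relaxed_map Q q"
    and ai0: "AE t in lborel. t \<ge> 0 \<longrightarrow> set_integrable (\<alpha> t) A (\<lambda>y. y)"
    and ai: "\<And>t. 0 \<le> t \<Longrightarrow> set_integrable lborel {0..t} (\<lambda>s. LINT y:A|\<alpha> s. y)"
    and fe: "\<And>t. 0 \<le> t \<Longrightarrow> x + (LINT s:{0..t}|lborel. (LINT y:A|\<alpha> s. y)) - (LINT s:{0..t}|lborel. (LINT y:Q|q s. y)) \<ge> 0"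
    using adm unfolding relaxed_controls_def by auto
  have pq: "q t \<in> prob_measures_on Q" and pa: "\<alpha> t \<in> prob_measures_on A" if "0 \<le> t" for t
    using ma mq that unfolding relaxed_map_def by auto
  obtain B where B: "Q \<subseteq> {0..B}" using Q_bound by blast
  have bb: "0 \<le> b t \<and> b t \<le> B" if t: "0 \<le> t" for t
  proof -
    note m = prob_measures_onD[OF pq[OF t]]
    have id: "set_integrable (q t) Q (\<lambda>y. y)" by (rule relaxed_revenue_le(2)[OF pq[OF t]])
    have "(LINT y:Q|q t. 0) \<le> (LINT y:Q|q t. y)"
      by (rule set_integral_mono[OF m(6) id]) (use B sales.closed in auto)
    moreover have "(LINT y:Q|q t. y) \<le> (LINT y:Q|q t. B)"
      by (rule set_integral_mono[OF id m(6)]) (use B sales.closed in auto)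
    ultimately show ?thesis using m(7) sales.closed t by (simp add: b_def)
  qed
  have a0: "0 \<le> a t" for t
  proof -
    have "0 \<le> (LINT y:A|\<alpha> t. y)" unfolding set_lebesgue_integral_def
      by (rule integral_nonneg_AE) (use A(2) in \<open>auto simp: indicator_def\<close>)
    thus ?thesis by (simp add: a_def)
  qed
  have "bounded ((\<lambda>y. y) ` Q)" using compact_imp_bounded[OF Q(1)] by simp
  hence "(\<lambda>t. LINT y:Q|q t. y) \<in> borel_measurable (restrict_space borel {0..})"
    using mq continuous_on_id[of Q] unfolding relaxed_map_def by blast
  hence bm: "b \<in> borel_measurable borel"
    unfolding b_def[abs_def] by (simp add: borel_measurable_restrict_space_iff)
  have ai': "set_integrable lborel {0..t} a" if "0 \<le> t" for t
    using ai[OF that] by (subst set_integrable_cong[of lborel lborel "{0..t}" "{0..t}" a "\<lambda>s. LINT y:A|\<alpha> s. y"]) (auto simp: a_def)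
  have am: "a \<in> borel_measurable borel"
  proof (rule borel_measurable_LIMSEQ_real)
    show "(\<lambda>s. indicator {0..real n} s *\<^sub>R a s) \<in> borel_measurable borel" for n
      using ai'[of "real n"] unfolding set_integrable_def by (auto dest: borel_measurable_integrable)
    show "(\<lambda>n. indicator {0..real n} s *\<^sub>R a s) \<longlonglongrightarrow> a s" if "s \<in> space borel" for s
    proof (rule tendsto_eventually)
      show "\<forall>\<^sub>F n in sequentially. indicator {0..real n} s *\<^sub>R a s = a s"
        using eventually_ge_at_top[of "nat \<lceil>s\<rceil>"]
        by eventually_elim (auto simp: a_def indicator_def nat_ceiling_le_eq)
    qed
  qed
  have feas: "0 \<le> x + (LINT s:{0..t}|lborel. a s - b s)" if t: "0 \<le> t" for t
  proof -
    have bi: "set_integrable lborel {0..t} b"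
      by (rule set_integrable_Icc_bounded[OF bm, of _ _ B]) (use bb in auto)
    have "(LINT s:{0..t}|lborel. a s) = (LINT s:{0..t}|lborel. (LINT y:A|\<alpha> s. y))"
      "(LINT s:{0..t}|lborel. b s) = (LINT s:{0..t}|lborel. (LINT y:Q|q s. y))"
      by (intro set_lebesgue_integral_cong; simp add: a_def b_def)+
    thus ?thesis using fe[OF t] set_integral_diff(2)[OF ai'[OF t] bi] by simp
  qed
  have ri: "set_integrable lborel {0..} (revenue_bound p b)" by (rule revenue_bound_integrable[OF p(1) bm bb])
  have 1: "ext_integral lborel {0..} (\<lambda>t. ereal (exp (- \<beta> * t)) * ext_integral (q t) Q (\<lambda>y. ereal (R y)))
      \<le> ereal (LINT t:{0..}|lborel. revenue_bound p b t)"
    unfolding ext_integral_integrable[OF ri, symmetric]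
  proof (rule ext_integral_mono_AE, rule AE_I2, rule impI)
    fix t :: real assume "t \<in> {0..}"
    hence t: "0 \<le> t" by simp
    have "ereal (exp (- \<beta> * t)) * ext_integral (q t) Q (\<lambda>y. ereal (R y))
        \<le> ereal (exp (- \<beta> * t)) * ereal (R_conj (costate p t) + costate p t * b t)"
      using relaxed_revenue_le(1)[OF pq[OF t], of "costate p t"] t by (intro ereal_mult_left_mono) (auto simp: b_def)
    thus "ereal (exp (- \<beta> * t)) * ext_integral (q t) Q (\<lambda>y. ereal (R y)) \<le> ereal (revenue_bound p b t)"
      unfolding revenue_bound_def by simp
  qed
  have 2: "ext_integral lborel {0..} (\<lambda>t. ereal (cost_bound p a t))
      \<le> ext_integral lborel {0..} (\<lambda>t. ereal (exp (- \<beta> * t)) * ext_integral (\<alpha> t) A (\<lambda>y. ereal (C y)))"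
  proof (rule ext_integral_mono_AE, rule eventually_mono[OF ai0], rule impI)
    fix t :: real assume i: "t \<ge> 0 \<longrightarrow> set_integrable (\<alpha> t) A (\<lambda>y. y)" and "t \<in> {0..}"
    hence t: "0 \<le> t" and i: "set_integrable (\<alpha> t) A (\<lambda>y. y)" by auto
    have "ereal (exp (- \<beta> * t)) * ereal (costate p t * a t - C_conj (costate p t))
        \<le> ereal (exp (- \<beta> * t)) * ext_integral (\<alpha> t) A (\<lambda>y. ereal (C y))"
      using prod.relaxed_cost_ge[OF pa[OF t] i, of "costate p t"] t by (intro ereal_mult_left_mono) (auto simp: a_def)
    thus "ereal (cost_bound p a t) \<le> ereal (exp (- \<beta> * t)) * ext_integral (\<alpha> t) A (\<lambda>y. ereal (C y))"
      unfolding cost_bound_def by simp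
  qed
  show ?thesis unfolding relaxed_payoff_def prod.case
    using ereal_minus_mono[OF 1 2] net_bound(2)[OF p am bm a0 ai' bb feas] by (rule order_trans)
qed

lemma relaxed_payoff_eq:
  assumes ri: "set_integrable lborel {0..} (revenue_bound p b)" and ci: "set_integrable lborel {0..} (cost_bound p a)"
    and N: "countable N"
    and e: "\<And>t. 0 \<le> t \<Longrightarrow> t \<notin> N \<Longrightarrow>
        ext_integral (q t) Q (\<lambda>y. ereal (R y)) = ereal (R_conj (costate p t) + costate p t * b t)
        \<and> ext_integral (\<alpha> t) A (\<lambda>y. ereal (C y)) = ereal (costate p t * a t - C_conj (costate p t))"
  shows "relaxed_payoff A Q R C \<beta> (\<alpha>, q) = ereal ((LINT t:{0..}|lborel. revenue_bound p b t) - (LINT t:{0..}|lborel. cost_bound p a t))"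
proof -
  have N: "AE t in lborel. t \<notin> N" using countable_imp_null_set_lborel[OF N] AE_not_in by blast
  have "ext_integral lborel {0..} (\<lambda>t. ereal (exp (- \<beta> * t)) * ext_integral (q t) Q (\<lambda>y. ereal (R y)))
      = ext_integral lborel {0..} (\<lambda>t. ereal (revenue_bound p b t))"
    "ext_integral lborel {0..} (\<lambda>t. ereal (exp (- \<beta> * t)) * ext_integral (\<alpha> t) A (\<lambda>y. ereal (C y)))
      = ext_integral lborel {0..} (\<lambda>t. ereal (cost_bound p a t))"
    using N e by (intro ext_integral_cong_AE; auto simp: revenue_bound_def cost_bound_def)+
  thus ?thesis unfolding relaxed_payoff_def using ext_integral_integrable[OF ri] ext_integral_integrable[OF ci] by simp
qed

section \<open>Optimal rates below and at the critical price\<close>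

lemma ccv_revenue_eq: "ccv_revenue Q R y = - cvx_cost Q (\<lambda>q. - R q) y"
proof -
  have "(\<lambda>q. - ext_revenue Q R q) = ext_cost Q (\<lambda>q. - R q)"
    by (auto simp: ext_revenue_def ext_cost_def)
  thus ?thesis unfolding ccv_revenue_def cvx_cost_def by simp
qed

lemma ccv_revenue_le: "ccv_revenue Q R y \<le> ereal (R_conj z + z * y)"
  using sales.cvx_cost_ge[of y "-z"] unfolding ccv_revenue_eq R_conj_def
  by (cases "cvx_cost Q (\<lambda>q. - R q) y") (auto simp: algebra_simps)

lemma cvx_cost_ge: "ereal (z * y - C_conj z) \<le> cvx_cost A C y"
  using prod.cvx_cost_ge[of y z] by (simp add: mult.commute)

lemma ext_revenue_le: "y \<in> Q \<Longrightarrow> ext_revenue Q R y \<le> ereal (R_conj z + z * y)"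
  using R_conj_ge[of y z] by (simp add: ext_revenue_def algebra_simps)

lemma ext_cost_ge: "y \<in> A \<Longrightarrow> ereal (z * y - C_conj z) \<le> ext_cost A C y"
  using prod.conj_fun_ge[of y z] by (simp add: ext_cost_def algebra_simps)

lemma alpha_maximizer:
  assumes "prod.maximizer z a"
  shows "a \<in> A" "C a = z * a - C_conj z" "cvx_cost A C a = ereal (C a)" "ext_cost A C a = ereal (C a)"
  using assms prod.conj_fun_eq[OF assms] prod.cvx_cost_maximizer(1)[OF assms]
  by (auto simp: prod.maximizer_def ext_cost_def mult.commute)

lemma q_maximizer:
  assumes "sales.maximizer (- z) q"
  shows "q \<in> Q" "R q = R_conj z + z * q" "ccv_revenue Q R q = ereal (R q)" "ext_revenue Q R q = ereal (R q)"
  using assms sales.conj_fun_eq[OF assms] sales.cvx_cost_maximizer(1)[OF assms]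
  by (auto simp: sales.maximizer_def ext_revenue_def ccv_revenue_eq R_conj_def mult.commute)

lemma alpha_hat_eq:
  assumes "C_hat A C differentiable (at z)"
  shows "alpha_hat A C z = alpha_sel z"
  using prod.argmax_conjugate[OF _ alpha_sel] assms unfolding alpha_hat_def prod.conj_fun_def by simp

lemma q_hat_eq:
  assumes "R_hat Q R differentiable (at z)"
  shows "q_hat Q R z = q_sel z"
proof -
  have e: "ccv_revenue Q R q - ereal (q * z) = ereal (q * (- z)) - cvx_cost Q (\<lambda>q. - R q) q" for q
    unfolding ccv_revenue_eq by (cases "cvx_cost Q (\<lambda>q. - R q) q") auto
  have "(\<lambda>w. R_hat Q R (- w)) differentiable (at (- z))"
    using differentiable_compose[of "R_hat Q R" uminus "- z" UNIV] assms by simp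
  moreover have "(\<lambda>w. R_hat Q R (- w)) = sales.conj_fun" unfolding R_hat_eq R_conj_def by simp
  ultimately show ?thesis using sales.argmax_conjugate[OF _ q_sel[of z]] unfolding q_hat_def e by simp
qed

text \<open>
  Both rates have to converge along the same subsequence for the sign of the drift to pass to
  the limit.
\<close>

lemma maximizers_at_limit:
  assumes "z \<longlonglongrightarrow> \<zeta>"
  shows "\<exists>a q r. strict_mono (r :: nat \<Rightarrow> nat) \<and> prod.maximizer \<zeta> a \<and> sales.maximizer (- \<zeta>) q
    \<and> (\<lambda>n. drift (z (r n))) \<longlonglongrightarrow> a - q"
proof -
  obtain r a where r: "strict_mono (r :: nat \<Rightarrow> nat)" "prod.maximizer \<zeta> a" "((\<lambda>n. alpha_sel (z n)) \<circ> r) \<longlonglongrightarrow> a"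
    using prod.maximizer_limit[OF alpha_sel assms] by blast
  have "(\<lambda>n. - (z \<circ> r) n) \<longlonglongrightarrow> - \<zeta>" by (intro tendsto_minus LIMSEQ_subseq_LIMSEQ[OF assms r(1)])
  from sales.maximizer_limit[OF q_sel this]
  obtain r' q where r': "strict_mono (r' :: nat \<Rightarrow> nat)" "sales.maximizer (- \<zeta>) q"
    "((\<lambda>n. q_sel ((z \<circ> r) n)) \<circ> r') \<longlonglongrightarrow> q" by blast
  have "(\<lambda>n. drift (z ((r \<circ> r') n))) \<longlonglongrightarrow> a - q"
    using tendsto_diff[OF LIMSEQ_subseq_LIMSEQ[OF r(3) r'(1)] r'(3)] by (simp add: drift_def o_def)
  thus ?thesis using r r' strict_mono_o by blast
qed

text \<open>
  Approaching the minimum point \<open>\<zeta>\<close> from the right, where the drift is nonnegative, yields optimal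
  rates with production at least sales; approaching it from the left yields optimal rates with
  production at most sales. Hence the two intervals of optimal rates intersect, and on the
  intersection both Fenchel-Young inequalities at \<open>\<zeta>\<close> are equalities.
\<close>

lemma static_optimum_exists:
  "\<exists>u. u \<in> co_set Q \<inter> co_set A \<and> cvx_cost A C u = ereal (\<zeta> * u - C_conj \<zeta>)
    \<and> ccv_revenue Q R u = ereal (R_conj \<zeta> + \<zeta> * u)"
proof -
  define h where "h n = inverse (real (Suc n))" for n
  have h: "h n > 0" for n by (simp add: h_def)
  have h0: "h \<longlonglongrightarrow> 0" unfolding h_def by (rule LIMSEQ_inverse_real_of_nat)
  have "(\<lambda>n. \<zeta> + h n) \<longlonglongrightarrow> \<zeta>" using tendsto_add[OF tendsto_const[of \<zeta>] h0] by simp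
  from maximizers_at_limit[OF this]
  obtain a2 q1 r where r: "prod.maximizer \<zeta> a2" "sales.maximizer (- \<zeta>) q1" "(\<lambda>n. drift (\<zeta> + h (r n))) \<longlonglongrightarrow> a2 - q1" by blast
  have "(\<lambda>n. \<zeta> - h n) \<longlonglongrightarrow> \<zeta>" using tendsto_diff[OF tendsto_const[of \<zeta>] h0] by simp
  from maximizers_at_limit[OF this]
  obtain a1 q2 r' where r': "prod.maximizer \<zeta> a1" "sales.maximizer (- \<zeta>) q2" "(\<lambda>n. drift (\<zeta> - h (r' n))) \<longlonglongrightarrow> a1 - q2" by blast
  have "0 \<le> drift (\<zeta> + h n)" for n
  proof -
    have "H (\<zeta> + h n) - drift (\<zeta> + h n) * h n \<le> H \<zeta>"
      using H_subgradient[OF alpha_sel q_sel, of "\<zeta> + h n" \<zeta>] by (simp add: drift_def)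
    hence "0 \<le> drift (\<zeta> + h n) * h n" using zeta_least_minimum(1)[of "\<zeta> + h n"] by linarith
    thus ?thesis using h[of n] by (simp add: zero_le_mult_iff)
  qed
  hence "0 \<le> a2 - q1" by (intro LIMSEQ_le_const[OF r(3)]) auto
  moreover have "drift (\<zeta> - h n) \<le> 0" for n using drift_neg[of "\<zeta> - h n"] h[of n] by simp
  hence "a1 - q2 \<le> 0" by (intro LIMSEQ_le_const2[OF r'(3)]) auto
  \<comment> \<open>The larger of the left end points lies in both intervals, as \<open>q1 \<le> a2\<close> and \<open>a1 \<le> q2\<close>.\<close>
  moreover define u where "u = max (min a1 a2) (min q1 q2)"
  ultimately have u: "min a1 a2 \<le> u" "u \<le> max a1 a2" "min q1 q2 \<le> u" "u \<le> max q1 q2" by auto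
  show ?thesis
    using prod.tight_between[OF r'(1) r(1) u(1,2)] sales.tight_between[OF r(2) r'(2) u(3,4)]
    by (intro exI[of _ u]) (simp add: ccv_revenue_eq R_conj_def mult.commute)
qed

text \<open>
  By weak duality the net revenue at \<open>u\<close> is at most \<open>H(\<zeta>)\<close>, and this value is attained; so for a
  maximizer both inequalities must be equalities.
\<close>

lemma static_optimum_tight:
  assumes u: "u \<in> argmax_set (\<lambda>u. ccv_revenue Q R u - cvx_cost A C u) (co_set Q \<inter> co_set A)"
  shows "cvx_cost A C u = ereal (\<zeta> * u - C_conj \<zeta>)" "ccv_revenue Q R u = ereal (R_conj \<zeta> + \<zeta> * u)"
proof -
  obtain w where w: "w \<in> co_set Q \<inter> co_set A" "cvx_cost A C w = ereal (\<zeta> * w - C_conj \<zeta>)"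
    "ccv_revenue Q R w = ereal (R_conj \<zeta> + \<zeta> * w)" using static_optimum_exists by blast
  have "ccv_revenue Q R w - cvx_cost A C w \<le> ccv_revenue Q R u - cvx_cost A C u"
    using u w(1) unfolding argmax_set_iff by blast
  hence "ereal (R_conj \<zeta> + C_conj \<zeta>) \<le> ccv_revenue Q R u - cvx_cost A C u" using w(2,3) by simp
  thus "cvx_cost A C u = ereal (\<zeta> * u - C_conj \<zeta>)" "ccv_revenue Q R u = ereal (R_conj \<zeta> + \<zeta> * u)"
    using ccv_revenue_le[of u \<zeta>] cvx_cost_ge[of \<zeta> u]
    by (cases "ccv_revenue Q R u"; cases "cvx_cost A C u"; simp)+
qed

section \<open>Optimality of the switching strategy\<close>

text \<open>
  Changing rates on a countable set affects neither measurability nor the inventory.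
\<close>

lemma controls_off_countable:
  assumes N: "countable N" and [measurable]: "a \<in> borel_measurable borel" "b \<in> borel_measurable borel"
    and i: "\<And>t. set_integrable lborel {0..t} a"
    and f: "\<And>t. 0 \<le> t \<Longrightarrow> 0 \<le> x + (LINT s:{0..t}|lborel. a s - b s)"
    and m: "\<And>t. 0 \<le> t \<Longrightarrow> \<alpha> t \<in> A' \<and> q t \<in> Q'"
    and e: "\<And>t. 0 \<le> t \<Longrightarrow> t \<notin> N \<Longrightarrow> \<alpha> t = a t \<and> q t = b t"
  shows "(\<alpha>, q) \<in> controls A' Q' x"
proof -
  have N0: "AE t in lborel. t \<notin> N" using countable_imp_null_set_lborel[OF N] AE_not_in by blast
  have am: "\<alpha> \<in> borel_measurable (restrict_space borel {0..})" "q \<in> borel_measurable (restrict_space borel {0..})"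
    using borel_measurable_Ici_off_countable[OF _ N] e assms(2,3) by blast+
  have loc: "(\<lambda>s. indicator {0..t} s *\<^sub>R g s) \<in> borel_measurable borel"
    if "g \<in> borel_measurable (restrict_space borel {0..})" for g :: "real \<Rightarrow> real" and t :: real
  proof -
    have [measurable]: "(\<lambda>s. indicator {0..} s *\<^sub>R g s) \<in> borel_measurable borel"
      using that by (simp add: borel_measurable_restrict_space_iff)
    have "(\<lambda>s. indicator {0..t} s *\<^sub>R (indicator {0..} s *\<^sub>R g s)) \<in> borel_measurable borel" by measurable
    moreover have "(\<lambda>s. indicator {0..t} s *\<^sub>R (indicator {0..} s *\<^sub>R g s)) = (\<lambda>s. indicator {0..t} s *\<^sub>R g s)"
      by (auto simp: indicator_def)
    ultimately show ?thesis by simp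
  qed
  have ai: "set_integrable lborel {0..t} \<alpha>" for t
    unfolding set_integrable_def
  proof (rule integrable_cong_AE_imp[OF i[of t, unfolded set_integrable_def]])
    show "(\<lambda>s. indicator {0..t} s *\<^sub>R \<alpha> s) \<in> borel_measurable lborel" using loc[OF am(1)] by simp
    show "AE s in lborel. indicator {0..t} s *\<^sub>R a s = indicator {0..t} s *\<^sub>R \<alpha> s"
      using N0 by eventually_elim (auto simp: e indicator_def)
  qed
  have "(LINT s:{0..t}|lborel. \<alpha> s - q s) = (LINT s:{0..t}|lborel. a s - b s)" for t
    unfolding set_lebesgue_integral_def
  proof (rule integral_cong_AE)
    have "(\<lambda>s. indicator {0..t} s *\<^sub>R \<alpha> s - indicator {0..t} s *\<^sub>R q s) \<in> borel_measurable borel"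
      using loc[OF am(1)] loc[OF am(2)] by (rule borel_measurable_diff)
    thus "(\<lambda>s. indicator {0..t} s *\<^sub>R (\<alpha> s - q s)) \<in> borel_measurable lborel" by (simp add: scaleR_diff_right right_diff_distrib)
    show "(\<lambda>s. indicator {0..t} s *\<^sub>R (a s - b s)) \<in> borel_measurable lborel" by measurable
    show "AE s in lborel. indicator {0..t} s *\<^sub>R (\<alpha> s - q s) = indicator {0..t} s *\<^sub>R (a s - b s)"
      using N0 by eventually_elim (auto simp: e indicator_def)
  qed
  thus ?thesis unfolding controls_def using am ai m f by auto
qed

lemma switching_strategy_const:
  assumes x: "0 \<le> x" and w: "0 \<le> w"
  defines "a \<equiv> switch x alpha_sel (\<lambda>_. w)" and "b \<equiv> switch x q_sel (\<lambda>_. w)"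
  shows "a \<in> borel_measurable borel" "b \<in> borel_measurable borel"
    and "set_integrable lborel {0..t} a" "set_integrable lborel {0..t} b"
    and "0 \<le> t \<Longrightarrow> 0 \<le> x + (LINT s:{0..t}|lborel. a s - b s)"
    and "set_integrable lborel {0..} (revenue_bound (price x) b)" "set_integrable lborel {0..} (cost_bound (price x) a)"
    and "dual x (price x)
        \<le> (LINT t:{0..}|lborel. revenue_bound (price x) b t) - (LINT t:{0..}|lborel. cost_bound (price x) a t)"
  using switching_strategy[OF x, of "\<lambda>_. w" "\<lambda>_. w" w 0] w unfolding a_def b_def by simp_all

lemma switching_optimal:
  assumes x: "0 \<le> x" and A': "A' \<subseteq> {0..}" and Q': "Q' \<subseteq> {0..B}"
    and r: "\<And>z y. y \<in> Q' \<Longrightarrow> r y \<le> ereal (R_conj z + z * y)"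
    and c: "\<And>z y. y \<in> A' \<Longrightarrow> ereal (z * y - C_conj z) \<le> c y"
    and rs: "\<And>z. r (q_sel z) = ereal (R_conj z + z * q_sel z)"
    and cs: "\<And>z. c (alpha_sel z) = ereal (z * alpha_sel z - C_conj z)"
    and w: "0 \<le> w" "r w = ereal (R_conj \<zeta> + \<zeta> * w)" "c w = ereal (\<zeta> * w - C_conj \<zeta>)"
    and N: "countable N"
    and m: "\<And>t. 0 \<le> t \<Longrightarrow> \<alpha> t \<in> A' \<and> q t \<in> Q'"
    and e: "\<And>t. 0 \<le> t \<Longrightarrow> t \<notin> N \<Longrightarrow> \<alpha> t = switch x alpha_sel (\<lambda>_. w) t \<and> q t = switch x q_sel (\<lambda>_. w) t"
  shows "(\<alpha>, q) \<in> controls A' Q' x \<and> payoff \<beta> r c (\<alpha>, q) = (SUP p\<in>controls A' Q' x. payoff \<beta> r c p)"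
proof -
  note sw = switching_strategy_const[OF x w(1)]
  have adm: "(\<alpha>, q) \<in> controls A' Q' x"
    by (rule controls_off_countable[OF N sw(1,2,3,5) m e])
  have tight: "r (q t) = ereal (R_conj (costate (price x) t) + costate (price x) t * switch x q_sel (\<lambda>_. w) t)
        \<and> c (\<alpha> t) = ereal (costate (price x) t * switch x alpha_sel (\<lambda>_. w) t - C_conj (costate (price x) t))"
    if "0 \<le> t" "t \<notin> N" for t
    using e[OF that] rs cs w(2,3) costate_price_late[of x t] by (auto simp: switch_def)
  have "dual x (price x) \<le> payoff \<beta> r c (\<alpha>, q)"
    using payoff_eq[where r = r and c = c and q = q and \<alpha> = \<alpha>, OF sw(6,7) N tight] sw(8) by simp
  moreover have "payoff \<beta> r c p \<le> dual x (price x)" if "p \<in> controls A' Q' x" for p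
    using payoff_le_dual[OF price_bounds(1) price_bounds(2)[OF x] A' Q' r c] that by (cases p) auto
  ultimately show ?thesis using SUP_eqI_attained[OF adm] adm by blast
qed

section \<open>The value function and its derivative\<close>

text \<open>
  After depletion each rate jumps with period \<open>\<epsilon>\<close> between the two maximizers that represent
  the static optimum, the high production rate and the low selling rate coming first in every
  period. The inventory then stays nonnegative and of order \<open>\<epsilon>\<close>, while the Fenchel-Young
  inequalities remain equalities because only maximizers at \<open>\<zeta>\<close> are used.
\<close>

lemma chattering_payoff:
  assumes x: "0 \<le> x"
  shows "\<exists>M. \<forall>\<epsilon>>0. ereal (dual x (price x) - \<epsilon> * M) \<le> orig_value A Q R C \<beta> x"
proof -
  let ?T = "depletion_time x"
  obtain u where u: "cvx_cost A C u = ereal (\<zeta> * u - C_conj \<zeta>)"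
    "ccv_revenue Q R u = ereal (R_conj \<zeta> + \<zeta> * u)" using static_optimum_exists by blast
  have "cvx_cost A C u \<le> ereal (u * \<zeta> - C_conj \<zeta>)" using u(1) by (simp add: mult.commute)
  from prod.tight_representation[OF this]
  obtain a1 a2 \<nu> where a: "prod.maximizer \<zeta> a1" "prod.maximizer \<zeta> a2" "a1 \<le> a2" "0 < \<nu>" "\<nu> < 1"
    "u = \<nu> * a1 + (1 - \<nu>) * a2" by metis
  have "cvx_cost Q (\<lambda>q. - R q) u \<le> ereal (u * (- \<zeta>) - sales.conj_fun (- \<zeta>))"
    using u(2) unfolding ccv_revenue_eq R_conj_def
    by (cases "cvx_cost Q (\<lambda>q. - R q) u") (auto simp: algebra_simps)
  from sales.tight_representation[OF this]
  obtain q1 q2 \<gamma> where q: "sales.maximizer (- \<zeta>) q1" "sales.maximizer (- \<zeta>) q2" "q1 \<le> q2" "0 < \<gamma>" "\<gamma> < 1"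
    "u = \<gamma> * q1 + (1 - \<gamma>) * q2" by metis
  have nonneg: "0 \<le> a1" "0 \<le> q1" using alpha_maximizer(1)[OF a(1)] q_maximizer(1)[OF q(1)] A(2) Q(2) by auto
  \<comment> \<open>The inventory after depletion never exceeds \<open>\<epsilon>\<close> times the sum of the two jump heights.\<close>
  define M where "M = price x * ((a2 - a1) + (q2 - q1))"
  have "ereal (dual x (price x) - \<epsilon> * M) \<le> orig_value A Q R C \<beta> x" if \<epsilon>: "0 < \<epsilon>" for \<epsilon>
  proof -
    \<comment> \<open>The production rate is high during the fraction \<open>1 - \<nu>\<close> of each period, the selling rate low during the fraction \<open>\<gamma>\<close>.\<close>
    define ca where "ca t = chatter \<epsilon> (1 - \<nu>) (t - ?T)" for t
    define cq where "cq t = chatter \<epsilon> \<gamma> (t - ?T)" for t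
    define ua where "ua t = a1 + (a2 - a1) * ca t" for t
    define uq where "uq t = q2 - (q2 - q1) * cq t" for t
    have [measurable]: "ua \<in> borel_measurable borel" "uq \<in> borel_measurable borel"
      unfolding ua_def[abs_def] uq_def[abs_def] ca_def cq_def by measurable
    have ua: "ua t = a1 \<or> ua t = a2" and uq: "uq t = q1 \<or> uq t = q2" for t
      by (auto simp: ua_def uq_def ca_def cq_def chatter_def)
    have ub: "0 \<le> ua t \<and> ua t \<le> max a2 q2" "0 \<le> uq t \<and> uq t \<le> max a2 q2" for t
      using ua[of t] uq[of t] nonneg a(3) q(3) by auto
    have small: "0 \<le> integral {?T..t} (\<lambda>s. ua s - uq s) \<and> integral {?T..t} (\<lambda>s. ua s - uq s) \<le> \<epsilon> * ((a2 - a1) + (q2 - q1))"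
      if t: "?T \<le> t" for t
    proof -
      have "ua s - uq s = (a2 - a1) * (ca s - (1 - \<nu>)) + (q2 - q1) * (cq s - \<gamma>)" for s
      proof -
        have "a1 + (a2 - a1) * (1 - \<nu>) = q2 - (q2 - q1) * \<gamma>" using a(6) q(6) by (simp add: algebra_simps)
        thus ?thesis unfolding ua_def uq_def by (simp add: algebra_simps)
      qed
      hence eq: "(\<lambda>s. ua s - uq s) = (\<lambda>s. (a2 - a1) * (ca s - (1 - \<nu>)) + (q2 - q1) * (cq s - \<gamma>))" by blast
      have ca: "(\<lambda>s. ca s - (1 - \<nu>)) integrable_on {?T..t}" "0 \<le> integral {?T..t} (\<lambda>s. ca s - (1 - \<nu>))"
        "integral {?T..t} (\<lambda>s. ca s - (1 - \<nu>)) \<le> \<epsilon>"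
        unfolding ca_def using chatter_late[OF \<epsilon> _ _ t, of "1 - \<nu>"] a(4,5) by simp_all
      have cq: "(\<lambda>s. cq s - \<gamma>) integrable_on {?T..t}" "0 \<le> integral {?T..t} (\<lambda>s. cq s - \<gamma>)"
        "integral {?T..t} (\<lambda>s. cq s - \<gamma>) \<le> \<epsilon>"
        unfolding cq_def using chatter_late[OF \<epsilon> _ _ t, of \<gamma>] q(4,5) by simp_all
      have "integral {?T..t} (\<lambda>s. ua s - uq s)
        = (a2 - a1) * integral {?T..t} (\<lambda>s. ca s - (1 - \<nu>)) + (q2 - q1) * integral {?T..t} (\<lambda>s. cq s - \<gamma>)"
        unfolding eq
        by (intro integral_unique has_integral_add has_integral_mult_right integrable_integral ca(1) cq(1))
      moreover have "0 \<le> (a2 - a1) * integral {?T..t} (\<lambda>s. ca s - (1 - \<nu>))"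
        "0 \<le> (q2 - q1) * integral {?T..t} (\<lambda>s. cq s - \<gamma>)" using a(3) q(3) ca(2) cq(2) by simp_all
      moreover have "(a2 - a1) * integral {?T..t} (\<lambda>s. ca s - (1 - \<nu>)) \<le> (a2 - a1) * \<epsilon>"
        "(q2 - q1) * integral {?T..t} (\<lambda>s. cq s - \<gamma>) \<le> (q2 - q1) * \<epsilon>"
        using a(3) q(3) ca(3) cq(3) by (auto intro: mult_left_mono)
      moreover have "\<epsilon> * ((a2 - a1) + (q2 - q1)) = (a2 - a1) * \<epsilon> + (q2 - q1) * \<epsilon>" by (simp add: algebra_simps)
      ultimately show ?thesis by linarith
    qed
    have uam: "ua \<in> borel_measurable borel" and uqm: "uq \<in> borel_measurable borel" by measurable
    note sw = switching_strategy[OF x uam uqm ub small]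
    define \<alpha> where "\<alpha> = switch x alpha_sel ua"
    define b where "b = switch x q_sel uq"
    note sw = sw[folded \<alpha>_def b_def]
    have ma: "\<exists>z. prod.maximizer z (\<alpha> t) \<and> z = costate (price x) t" for t
      using ua[of t] a(1,2) alpha_sel costate_price_late[of x t] unfolding \<alpha>_def switch_def by (cases "t < ?T") auto
    have mq: "\<exists>z. sales.maximizer (- z) (b t) \<and> z = costate (price x) t" for t
      using uq[of t] q(1,2) q_sel costate_price_late[of x t] unfolding b_def switch_def by (cases "t < ?T") auto
    have adm: "(\<alpha>, b) \<in> controls A Q x"
      by (rule controls_off_countable[of "{}", OF _ sw(1,2,3,5)])
        (use alpha_maximizer(1) q_maximizer(1) ma mq in blast)+
    have tight: "ext_revenue Q R (b t) = ereal (R_conj (costate (price x) t) + costate (price x) t * b t)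
        \<and> ext_cost A C (\<alpha> t) = ereal (costate (price x) t * \<alpha> t - C_conj (costate (price x) t))" for t
      using ma[of t] mq[of t] alpha_maximizer(2,4) q_maximizer(2,4) by metis
    have "payoff \<beta> (ext_revenue Q R) (ext_cost A C) (\<alpha>, b)
        = ereal ((LINT t:{0..}|lborel. revenue_bound (price x) b t) - (LINT t:{0..}|lborel. cost_bound (price x) \<alpha> t))"
      by (rule payoff_eq[where r = "ext_revenue Q R" and c = "ext_cost A C" and q = b and \<alpha> = \<alpha>,
            OF sw(6,7) countable_empty tight])
    hence "ereal (dual x (price x) - \<epsilon> * M) \<le> payoff \<beta> (ext_revenue Q R) (ext_cost A C) (\<alpha>, b)"
      using sw(8) by (simp add: M_def mult.left_commute)
    also have "\<dots> \<le> orig_value A Q R C \<beta> x" unfolding orig_value_def by (rule SUP_upper[OF adm])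
    finally show ?thesis .
  qed
  thus ?thesis by blast
qed

lemma orig_value_le_dual:
  assumes "0 < p" "p \<le> \<zeta>"
  shows "orig_value A Q R C \<beta> x \<le> ereal (dual x p)"
  unfolding orig_value_def
proof (rule SUP_least)
  obtain B where B: "Q \<subseteq> {0..B}" using Q_bound by blast
  fix c assume "c \<in> controls A Q x"
  thus "payoff \<beta> (ext_revenue Q R) (ext_cost A C) c \<le> ereal (dual x p)"
    using payoff_le_dual[OF assms A(2) B ext_revenue_le ext_cost_ge] by (cases c) auto
qed

lemma orig_value_eq_dual:
  assumes x: "0 \<le> x"
  shows "orig_value A Q R C \<beta> x = ereal (dual x (price x))"
proof (rule antisym)
  show "orig_value A Q R C \<beta> x \<le> ereal (dual x (price x))"
    by (rule orig_value_le_dual) (use price_bounds x in auto)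
  obtain M where M: "\<And>\<epsilon>. \<epsilon> > 0 \<Longrightarrow> ereal (dual x (price x) - \<epsilon> * M) \<le> orig_value A Q R C \<beta> x"
    using chattering_payoff[OF x] by blast
  have "(\<lambda>n. dual x (price x) - inverse (real (Suc n)) * M) \<longlonglongrightarrow> dual x (price x) - 0 * M"
    by (intro tendsto_intros LIMSEQ_inverse_real_of_nat)
  hence "(\<lambda>n. ereal (dual x (price x) - inverse (real (Suc n)) * M)) \<longlonglongrightarrow> ereal (dual x (price x))" by simp
  thus "ereal (dual x (price x)) \<le> orig_value A Q R C \<beta> x"
    by (rule LIMSEQ_le_const2) (use M in auto)
qed

text \<open>
  The tangent inequality says that \<open>price\<close> is a supergradient of the value function \<open>v\<close> everywhere.
  Used at \<open>x\<close> and at \<open>y\<close> it puts the difference quotient between \<open>price x\<close> and \<open>price y\<close>.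
\<close>

lemma value_deriv_eq_price:
  assumes x: "0 \<le> x"
  shows "value_deriv A Q R C \<beta> x = price x"
proof -
  define v where "v y = real_of_ereal (orig_value A Q R C \<beta> y)" for y
  have v: "v y = dual y (price y)" if "0 \<le> y" for y using orig_value_eq_dual[OF that] by (simp add: v_def)
  have tangent: "v y \<le> v w + price w * (y - w)" if "0 \<le> y" "0 \<le> w" for y w
  proof -
    have "ereal (dual y (price y)) \<le> ereal (dual y (price w))"
      using orig_value_le_dual[of "price w" y] price_bounds that orig_value_eq_dual[OF that(1)] by simp
    also have "dual y (price w) = dual w (price w) + price w * (y - w)"
      by (simp add: dual_def algebra_simps)
    finally show ?thesis using v that by simp
  qed
  have "(v has_real_derivative price x) (at x within {0..})"
    unfolding has_field_derivative_iff
  proof (rule tendsto_sandwich)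
    have "(price \<longlongrightarrow> price x) (at x within {0..})"
      using price_continuous x by (auto simp: continuous_on_def)
    hence lim: "((\<lambda>y. price y - price x) \<longlongrightarrow> 0) (at x within {0..})"
      using LIM_zero by blast
    show "((\<lambda>y. price x - \<bar>price y - price x\<bar>) \<longlongrightarrow> price x) (at x within {0..})"
      "((\<lambda>y. price x + \<bar>price y - price x\<bar>) \<longlongrightarrow> price x) (at x within {0..})"
      using tendsto_diff[OF tendsto_const tendsto_rabs_zero[OF lim], of "price x"]
        tendsto_add[OF tendsto_const tendsto_rabs_zero[OF lim], of "price x"] by simp_all
    have ev: "\<forall>\<^sub>F y in at x within {0..}. y \<in> {0..} \<and> y \<noteq> x"
      by (simp add: eventually_at_filter)
    have bnd: "price x - \<bar>price y - price x\<bar> \<le> (v y - v x) / (y - x) \<and> (v y - v x) / (y - x) \<le> price x + \<bar>price y - price x\<bar>"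
      if y: "y \<in> {0..} \<and> y \<noteq> x" for y
    proof -
      have 1: "v y - v x \<le> price x * (y - x)" "price y * (y - x) \<le> v y - v x"
        using tangent[of y x] tangent[of x y] x y by (auto simp: algebra_simps)
      show ?thesis
      proof (cases "x < y")
        case True
        hence "(v y - v x) / (y - x) \<le> price x" "price y \<le> (v y - v x) / (y - x)"
          using 1 by (simp_all add: pos_divide_le_eq pos_le_divide_eq)
        thus ?thesis by linarith
      next
        case False
        hence "y < x" using y by auto
        hence "price x \<le> (v y - v x) / (y - x)" "(v y - v x) / (y - x) \<le> price y"
          using 1 by (simp_all add: neg_divide_le_eq neg_le_divide_eq)
        thus ?thesis by linarith
      qed
    qed
    show "\<forall>\<^sub>F y in at x within {0..}. price x - \<bar>price y - price x\<bar> \<le> (v y - v x) / (y - x)"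
      by (rule eventually_mono[OF ev]) (use bnd in blast)
    show "\<forall>\<^sub>F y in at x within {0..}. (v y - v x) / (y - x) \<le> price x + \<bar>price y - price x\<bar>"
      by (rule eventually_mono[OF ev]) (use bnd in blast)
  qed
  moreover have "at x within {0..} \<noteq> bot"
  proof -
    have "at x within {x<..} \<le> at x within {0..}" using x by (intro at_le) auto
    thus ?thesis using trivial_limit_at_right_real[of x] by (auto simp: bot_unique)
  qed
  ultimately show ?thesis unfolding value_deriv_def
    using vector_derivative_within[of x "{0..}" v "price x"]
    by (simp add: has_real_derivative_iff_has_vector_derivative v_def[abs_def])
qed

lemma price_stock: "0 \<le> s \<Longrightarrow> price (stock s) = \<zeta> * exp (- \<beta> * s)"
  by (simp add: price_def depletion_time_stock)

lemma depletion_time_eq_ln: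
  assumes "0 \<le> x"
  shows "1 / \<beta> * ln (price 0 / price x) = depletion_time x"
proof -
  have "price 0 / price x = exp (\<beta> * depletion_time x)"
    unfolding price_0 unfolding price_def using zeta_pos by (simp add: exp_minus field_simps)
  thus ?thesis using beta by simp
qed

text \<open>
  The state at which \<open>v'\<close> has grown by the factor \<open>e\<^sup>\<beta>\<^sup>t\<close> is the inventory from which the remaining
  time to depletion is shorter by \<open>t\<close>.
\<close>

lemma inventory_path:
  assumes x: "0 \<le> x" and t: "0 \<le> t" "t \<le> depletion_time x"
  shows "(THE y. y \<in> {0..x} \<and> price y = price x * exp (\<beta> * t)) = stock (depletion_time x - t)"
    and "price (stock (depletion_time x - t)) = costate (price x) t"
proof -
  let ?s = "depletion_time x - t"
  note T = depletion_time[OF x]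
  have e: "price x * exp (\<beta> * t) = \<zeta> * exp (- \<beta> * ?s)"
  proof -
    have "- \<beta> * depletion_time x + \<beta> * t = - \<beta> * ?s" by (simp add: algebra_simps)
    thus ?thesis unfolding price_def by (simp only: mult.assoc exp_add[symmetric])
  qed
  show "price (stock ?s) = costate (price x) t"
    using price_stock[of ?s] costate_price[OF t(2)] t by simp
  show "(THE y. y \<in> {0..x} \<and> price y = price x * exp (\<beta> * t)) = stock ?s"
  proof (rule the_equality)
    have "stock ?s \<le> x" using T(2) stock_strict_mono[of ?s "depletion_time x"] t by (cases "t = 0") auto
    thus "stock ?s \<in> {0..x} \<and> price (stock ?s) = price x * exp (\<beta> * t)"
      using stock_nonneg[of ?s] price_stock[of ?s] t e by simp
    fix y assume y: "y \<in> {0..x} \<and> price y = price x * exp (\<beta> * t)"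
    hence "depletion_time y = ?s" using e zeta_pos beta by (simp add: price_def)
    thus "y = stock ?s" using depletion_time(2)[of y] y by auto
  qed
qed

section \<open>Optimal strategies for the three problems\<close>

text \<open>
  The costate is strictly increasing before depletion, so it meets the countable exceptional set of
  prices at countably many times only. The instant of depletion is added because there the
  rates are neither those driven by the costate nor the final ones.
\<close>

lemma irregular_times_countable:
  assumes F: "countable ({0<..<\<zeta>} - F)"
  shows "countable (({0..depletion_time x} - {t \<in> {0..depletion_time x}. costate (price x) t \<in> F}) \<union> {depletion_time x})"
proof -
  let ?T = "depletion_time x"
  let ?N = "{t \<in> {0..<?T}. costate (price x) t \<notin> F}"
  have "inj_on (costate (price x)) ?N"
    using zeta_pos beta by (auto simp: inj_on_def costate_price)
  moreover have "costate (price x) ` ?N \<subseteq> {0<..<\<zeta>} - F"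
    using zeta_pos beta by (auto simp: costate_price)
  hence "countable (costate (price x) ` ?N)" using F countable_subset by blast
  ultimately have "countable (?N \<union> {?T})" using countable_image_inj_on by auto
  thus ?thesis by (rule countable_subset[rotated]) auto
qed

text \<open>
  A point mass is a mixture of two equal point masses, so the rates before and after depletion are
  mixtures of two measurable maximizer-valued functions with fixed weights. Their means follow the
  ordinary switching strategy, and their average revenue and cost are again on the supporting lines
  at the costate.
\<close>

lemma relaxed_strategy_optimal:
  assumes x: "0 \<le> x" and N: "countable N"
    and a: "prod.maximizer \<zeta> a1" "prod.maximizer \<zeta> a2" "0 \<le> \<nu>" "\<nu> \<le> 1" "w = \<nu> * a1 + (1 - \<nu>) * a2"
    and b: "sales.maximizer (- \<zeta>) q1" "sales.maximizer (- \<zeta>) q2" "0 \<le> \<gamma>" "\<gamma> \<le> 1" "w = \<gamma> * q1 + (1 - \<gamma>) * q2"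
    and m: "\<And>t. 0 \<le> t \<Longrightarrow> \<alpha> t \<in> prob_measures_on A \<and> q t \<in> prob_measures_on Q"
    and early: "\<And>t. 0 \<le> t \<Longrightarrow> t \<notin> N \<Longrightarrow> t < depletion_time x \<Longrightarrow>
      \<alpha> t = return borel (alpha_sel (costate (price x) t)) \<and> q t = return borel (q_sel (costate (price x) t))"
    and late: "\<And>t. 0 \<le> t \<Longrightarrow> t \<notin> N \<Longrightarrow> \<not> t < depletion_time x \<Longrightarrow> \<alpha> t = dirac_mix \<nu> a1 a2 \<and> q t = dirac_mix \<gamma> q1 q2"
  shows "(\<alpha>, q) \<in> relaxed_controls A Q x \<and> relaxed_payoff A Q R C \<beta> (\<alpha>, q) = relaxed_value A Q R C \<beta> x"
proof -
  have clQ: "closed Q" by (rule sales.closed)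
  have "0 \<le> a1" "0 \<le> a2" using alpha_maximizer(1)[OF a(1)] alpha_maximizer(1)[OF a(2)] A(2) by auto
  hence w0: "0 \<le> w" unfolding a(5) using a(3,4) by (intro add_nonneg_nonneg mult_nonneg_nonneg) auto
  note sw = switching_strategy_const[OF x w0]
  define a where "a = switch x alpha_sel (\<lambda>_. w)"
  define b where "b = switch x q_sel (\<lambda>_. w)"
  note sw = sw[folded a_def b_def]
  define sa where "sa i = switch x alpha_sel (\<lambda>_. if i then a1 else a2)" for i :: bool
  define sq where "sq i = switch x q_sel (\<lambda>_. if i then q1 else q2)" for i :: bool
  have meas: "sa i \<in> borel_measurable borel" "sq i \<in> borel_measurable borel" for i
    unfolding sa_def sq_def by measurable
  have maxa: "prod.maximizer (costate (price x) t) (sa i t)" for i t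
    using assms(3,4) alpha_sel costate_price_late[of x t] by (auto simp: sa_def switch_def)
  have maxq: "sales.maximizer (- costate (price x) t) (sq i t)" for i t
    using assms(8,9) q_sel costate_price_late[of x t] by (auto simp: sq_def switch_def)
  have \<alpha>: "\<alpha> t = dirac_mix \<nu> (sa True t) (sa False t)" and q: "q t = dirac_mix \<gamma> (sq True t) (sq False t)"
    if "0 \<le> t" "t \<notin> N" for t
    using early[OF that] late[OF that] dirac_mix_same assms(5,6,10,11)
    by (cases "t < depletion_time x"; simp add: sa_def sq_def switch_def)+
  have am: "a t = \<nu> * sa True t + (1 - \<nu>) * sa False t" and bm: "b t = \<gamma> * sq True t + (1 - \<gamma>) * sq False t" for t
    using assms(7,12) by (auto simp: a_def b_def sa_def sq_def switch_def algebra_simps)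
  have SA: "sa i t \<in> A" and SQ: "sq i t \<in> Q" for i t using alpha_maximizer(1)[OF maxa] q_maximizer(1)[OF maxq] by auto
  have mean: "set_integrable (\<alpha> t) A (\<lambda>y. y)" "(LINT y:A|\<alpha> t. y) = a t" "(LINT y:Q|q t. y) = b t"
    if "0 \<le> t" "t \<notin> N" for t
    using dirac_mix(2,3)[OF assms(5,6) SA SA A(1) continuous_on_id] dirac_mix(3)[OF assms(10,11) SQ SQ clQ continuous_on_id]
    unfolding \<alpha>[OF that] q[OF that] am bm by auto
  have maps: "relaxed_map A \<alpha>" "relaxed_map Q q"
    using relaxed_map_dirac_mix[where \<mu> = \<alpha>, OF A(1) assms(5,6) N meas(1)[of True] meas(1)[of False]]
      relaxed_map_dirac_mix[where \<mu> = q, OF clQ assms(10,11) N meas(2)[of True] meas(2)[of False]] \<alpha> q SA SQ m by blast+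
  have N0: "AE t in lborel. t \<notin> N" using countable_imp_null_set_lborel[OF N] AE_not_in by blast
  define \<alpha>' where "\<alpha>' t = (LINT y:A|\<alpha> t. y)" for t
  define q' where "q' t = (LINT y:Q|q t. y)" for t
  \<comment> \<open>The mean rates form an ordinary control, which gives the state constraint.\<close>
  have "(\<alpha>', q') \<in> controls UNIV UNIV x"
    by (rule controls_off_countable[OF N sw(1,2,3,5)]) (auto simp: \<alpha>'_def q'_def mean)
  hence ctl: "\<And>t. 0 \<le> t \<Longrightarrow> set_integrable lborel {0..t} \<alpha>'" "\<And>t. 0 \<le> t \<Longrightarrow> 0 \<le> x + (LINT s:{0..t}|lborel. \<alpha>' s - q' s)"
    unfolding controls_def by auto
  \<comment> \<open>A control with equal rates; it is only used to obtain local integrability of the mean selling rate.\<close>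
  have "(q', q') \<in> controls UNIV UNIV 0"
    by (rule controls_off_countable[OF N sw(2,2,4)]) (auto simp: q'_def mean)
  hence qi: "\<And>t. 0 \<le> t \<Longrightarrow> set_integrable lborel {0..t} q'"
    unfolding controls_def by auto
  have feas: "0 \<le> x + (LINT s:{0..t}|lborel. \<alpha>' s) - (LINT s:{0..t}|lborel. q' s)" if "0 \<le> t" for t
    using ctl(2)[OF that] set_integral_diff(2)[OF ctl(1) qi] that by simp
  have adm: "(\<alpha>, q) \<in> relaxed_controls A Q x"
    unfolding relaxed_controls_def using maps ctl(1) feas mean(1) N0
    by (auto simp: \<alpha>'_def[abs_def] q'_def[abs_def] elim: eventually_mono)
  have C_val: "ext_integral (\<alpha> t) A (\<lambda>y. ereal (C y)) = ereal (costate (price x) t * a t - C_conj (costate (price x) t))"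
    and R_val: "ext_integral (q t) Q (\<lambda>y. ereal (R y)) = ereal (R_conj (costate (price x) t) + costate (price x) t * b t)"
    if t: "0 \<le> t" "t \<notin> N" for t
  proof -
    let ?z = "costate (price x) t"
    have "\<nu> * C (sa True t) + (1 - \<nu>) * C (sa False t) = ?z * a t - C_conj ?z"
      unfolding am alpha_maximizer(2)[OF maxa] by (simp add: algebra_simps)
    thus "ext_integral (\<alpha> t) A (\<lambda>y. ereal (C y)) = ereal (?z * a t - C_conj ?z)"
      unfolding \<alpha>[OF t] ext_integral_integrable[OF dirac_mix(2)[OF assms(5,6) SA SA A(1) C(1)]]
        dirac_mix(3)[OF assms(5,6) SA SA A(1) C(1)] by simp
    have "\<gamma> * R (sq True t) + (1 - \<gamma>) * R (sq False t) = R_conj ?z + ?z * b t"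
      unfolding bm q_maximizer(2)[OF maxq] by (simp add: algebra_simps)
    thus "ext_integral (q t) Q (\<lambda>y. ereal (R y)) = ereal (R_conj ?z + ?z * b t)"
      unfolding q[OF t] ext_integral_integrable[OF dirac_mix(2)[OF assms(10,11) SQ SQ clQ R(1)]]
        dirac_mix(3)[OF assms(10,11) SQ SQ clQ R(1)] by simp
  qed
  have "dual x (price x) \<le> relaxed_payoff A Q R C \<beta> (\<alpha>, q)"
    using relaxed_payoff_eq[where \<alpha> = \<alpha> and q = q, OF sw(6,7) N conjI[OF R_val C_val]] sw(8) by simp
  moreover have "relaxed_payoff A Q R C \<beta> p \<le> dual x (price x)" if "p \<in> relaxed_controls A Q x" for p
    using relaxed_payoff_le_dual[OF price_bounds(1) price_bounds(2)[OF x]] that by (cases p) auto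
  ultimately show ?thesis using SUP_eqI_attained[OF adm] adm unfolding relaxed_value_def by blast
qed

end

theorem theorem6:
  fixes A Q F :: "real set" and R C :: "real \<Rightarrow> real" and \<beta> x uh :: real
  assumes A: "closed A" "A \<subseteq> {0..}" "0 \<in> A" "A - {0} \<noteq> {}"
    and Q: "compact Q" "Q \<subseteq> {0..}" "0 \<in> Q" "Q - {0} \<noteq> {}"
    and R: "continuous_on Q R" "\<forall>q\<in>Q. 0 \<le> R q" "R 0 = 0"
    and C: "continuous_on A C" "\<forall>a\<in>A. 0 \<le> C a" "mono_on A C"
    and C_superlinear:
      "\<not> bounded A \<longrightarrow> filterlim (\<lambda>a. C a / a) at_top (inf at_top (principal A))"
    and beta: "\<beta> > 0"
    and zeta: "zeta A Q R C > 0"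
    and F: "F \<subseteq> {0<..<zeta A Q R C}" "countable ({0<..<zeta A Q R C} - F)"
      "\<forall>z\<in>F. R_hat Q R differentiable (at z) \<and> C_hat A C differentiable (at z)"
    and x: "x > 0"
    and uh: "uh \<in> argmax_set (\<lambda>u. ccv_revenue Q R u - cvx_cost A C u) (co_set Q \<inter> co_set A)"
  shows
    "let v' = value_deriv A Q R C \<beta>;
         \<tau> = 1 / \<beta> * ln (v' 0 / v' x);
         X = (\<lambda>t. THE y. y \<in> {0..x} \<and> v' y = v' x * exp (\<beta> * t));
         T = {t \<in> {0..\<tau>}. v' (X t) \<in> F};
         \<alpha>s = (\<lambda>t. alpha_hat A C (v' (X t)));
         qs = (\<lambda>t. q_hat Q R (v' (X t)))
     in
       (\<forall>\<alpha> \<in> switching T \<tau> \<alpha>s uh (co_set A). \<forall>q \<in> switching T \<tau> qs uh (co_set Q).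
          (\<alpha>, q) \<in> controls (co_set A) (co_set Q) x \<and>
          payoff \<beta> (ccv_revenue Q R) (cvx_cost A C) (\<alpha>, q) = conv_value A Q R C \<beta> x) \<and>
       (\<forall>t\<in>T. \<alpha>s t \<in> A \<and> qs t \<in> Q \<and>
          cvx_cost A C (\<alpha>s t) = ereal (C (\<alpha>s t)) \<and> ccv_revenue Q R (qs t) = ereal (R (qs t))) \<and>
       (\<exists>q1\<in>Q. \<exists>q2\<in>Q. \<exists>\<alpha>1\<in>A. \<exists>\<alpha>2\<in>A. \<exists>\<gamma>\<in>{0<..<1}. \<exists>\<nu>\<in>{0<..<1}.
          uh = \<gamma> * q1 + (1 - \<gamma>) * q2 \<and> uh = \<nu> * \<alpha>1 + (1 - \<nu>) * \<alpha>2 \<and>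
          ccv_revenue Q R uh = ereal (\<gamma> * R q1 + (1 - \<gamma>) * R q2) \<and>
          cvx_cost A C uh = ereal (\<nu> * C \<alpha>1 + (1 - \<nu>) * C \<alpha>2) \<and>
          (\<forall>\<alpha> \<in> switching T \<tau> (\<lambda>t. return borel (\<alpha>s t)) (dirac_mix \<nu> \<alpha>1 \<alpha>2) (prob_measures_on A).
           \<forall>q \<in> switching T \<tau> (\<lambda>t. return borel (qs t)) (dirac_mix \<gamma> q1 q2) (prob_measures_on Q).
             (\<alpha>, q) \<in> relaxed_controls A Q x \<and>
             relaxed_payoff A Q R C \<beta> (\<alpha>, q) = relaxed_value A Q R C \<beta> x)) \<and>
       (M_zeta A Q R C \<noteq> {} \<longrightarrow>
          (\<forall>w \<in> argmax_set (\<lambda>u. R u - C u) (Q \<inter> A).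
           \<forall>\<alpha> \<in> switching T \<tau> \<alpha>s w A. \<forall>q \<in> switching T \<tau> qs w Q.
             (\<alpha>, q) \<in> controls A Q x \<and>
             payoff \<beta> (ext_revenue Q R) (ext_cost A C) (\<alpha>, q) = orig_value A Q R C \<beta> x))"
proof -
  interpret production A Q R C \<beta>
    by unfold_locales (fact A Q R(1,2) C(1,2) C_superlinear beta zeta)+
  have x0: "0 \<le> x" using x by simp
  let ?v = "value_deriv A Q R C \<beta>" and ?z = "costate (price x)"
  define \<tau> where "\<tau> = 1 / \<beta> * ln (?v 0 / ?v x)"
  define X where "X = (\<lambda>t. THE y. y \<in> {0..x} \<and> ?v y = ?v x * exp (\<beta> * t))"
  define T where "T = {t \<in> {0..\<tau>}. ?v (X t) \<in> F}"
  define \<alpha>s where "\<alpha>s = (\<lambda>t. alpha_hat A C (?v (X t)))"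
  define qs where "qs = (\<lambda>t. q_hat Q R (?v (X t)))"
  \<comment> \<open>Off \<open>N\<close> the strategy is the switching strategy built from the selected maximizers.\<close>
  define N where "N = ({0..\<tau>} - T) \<union> {\<tau>}"
  have \<tau>: "\<tau> = depletion_time x"
    unfolding \<tau>_def using depletion_time_eq_ln[OF x0] value_deriv_eq_price x0 by simp
  have vX: "?v (X t) = ?z t" if "0 \<le> t" "t \<le> \<tau>" for t
  proof -
    have "X t = (THE y. y \<in> {0..x} \<and> price y = price x * exp (\<beta> * t))"
      unfolding X_def by (rule arg_cong[where f = The]) (use value_deriv_eq_price x0 in auto)
    also have "\<dots> = stock (\<tau> - t)" using inventory_path(1)[OF x0] that \<tau> by simp
    finally show ?thesis
      using value_deriv_eq_price[OF stock_nonneg[of "\<tau> - t"]] inventory_path(2)[OF x0] that \<tau> by simp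
  qed
  have T_eq: "T = {t \<in> {0..\<tau>}. ?z t \<in> F}" unfolding T_def using vX by auto
  have N: "countable N" unfolding N_def T_eq \<tau> by (rule irregular_times_countable[OF F(2)])
  have T_lt: "t < \<tau>" if "t \<in> T" for t
  proof -
    have "t \<le> \<tau>" "?z t \<noteq> \<zeta>" using that F(1) unfolding T_eq by auto
    thus ?thesis using costate_price_late[of x t] unfolding \<tau> by (cases "t = depletion_time x") auto
  qed
  have ctl: "\<alpha>s t = alpha_sel (?z t)" "qs t = q_sel (?z t)" if "t \<in> T" for t
    using that vX F(3) alpha_hat_eq q_hat_eq unfolding \<alpha>s_def qs_def T_def by auto
  have cases: "t \<in> T \<or> \<tau> < t" if "0 \<le> t" "t \<notin> N" for t using that unfolding N_def by auto
  obtain B where B: "Q \<subseteq> {0..B}" using Q_bound by blast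
  have coA: "co_set A \<subseteq> {0..}" and coQ: "co_set Q \<subseteq> {0..B}"
    by (rule co_set_subset; use A(2) B in \<open>simp add: is_interval_ci is_interval_cc\<close>)+
  note selA = alpha_maximizer[OF alpha_sel] and selQ = q_maximizer[OF q_sel]
  note tight = static_optimum_tight[OF uh]
  have uh_mem: "uh \<in> co_set A" "uh \<in> co_set Q" using uh unfolding argmax_set_iff by auto

  have mem: "\<forall>t\<ge>0. \<alpha> t \<in> U" if \<alpha>: "\<alpha> \<in> switching T \<tau> f u U" and "u \<in> U" "\<And>t. t \<in> T \<Longrightarrow> f t \<in> U"
    for \<alpha> f and u :: 'b and U
  proof (intro allI impI)
    fix t :: real assume "0 \<le> t"
    consider "t \<in> T" | "t \<in> {0..\<tau>} - T" | "\<tau> < t" using \<open>0 \<le> t\<close> by fastforce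
    thus "\<alpha> t \<in> U" using that unfolding switching_def by cases auto
  qed
  have agree: "\<alpha> t = switch x alpha_sel (\<lambda>_. w) t \<and> q t = switch x q_sel (\<lambda>_. w) t"
    if "\<alpha> \<in> switching T \<tau> \<alpha>s w U" "q \<in> switching T \<tau> qs w V" "0 \<le> t" "t \<notin> N" for \<alpha> q w U V t
    using cases[OF that(3,4)] that(1,2) T_lt[of t] ctl[of t] unfolding switching_def switch_def \<tau> by auto

  have 1: "(\<alpha>, q) \<in> controls (co_set A) (co_set Q) x \<and>
          payoff \<beta> (ccv_revenue Q R) (cvx_cost A C) (\<alpha>, q) = conv_value A Q R C \<beta> x"
    if s: "\<alpha> \<in> switching T \<tau> \<alpha>s uh (co_set A)" "q \<in> switching T \<tau> qs uh (co_set Q)" for \<alpha> q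
    unfolding conv_value_def
  proof (rule switching_optimal[OF x0 coA coQ ccv_revenue_le cvx_cost_ge _ _ _ tight(2) tight(1) N])
    show "ccv_revenue Q R (q_sel z) = ereal (R_conj z + z * q_sel z)"
      "cvx_cost A C (alpha_sel z) = ereal (z * alpha_sel z - C_conj z)" for z
      using selA(2,3)[of z] selQ(2,3)[of z] by simp_all
    show "0 \<le> uh" using uh_mem coA by auto
    show "\<alpha> t \<in> co_set A \<and> q t \<in> co_set Q" if "0 \<le> t" for t
      using mem[OF s(1) uh_mem(1)] mem[OF s(2) uh_mem(2)] ctl selA(1) selQ(1) subset_co_set that by (metis subsetD)
    show "\<alpha> t = switch x alpha_sel (\<lambda>_. uh) t \<and> q t = switch x q_sel (\<lambda>_. uh) t" if "0 \<le> t" "t \<notin> N" for t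
      by (rule agree[OF s that])
  qed
  have 2: "\<alpha>s t \<in> A \<and> qs t \<in> Q \<and> cvx_cost A C (\<alpha>s t) = ereal (C (\<alpha>s t)) \<and> ccv_revenue Q R (qs t) = ereal (R (qs t))"
    if "t \<in> T" for t
    using ctl[OF that] selA(1,3) selQ(1,3) by simp
  have 3: "\<exists>q1\<in>Q. \<exists>q2\<in>Q. \<exists>\<alpha>1\<in>A. \<exists>\<alpha>2\<in>A. \<exists>\<gamma>\<in>{0<..<1}. \<exists>\<nu>\<in>{0<..<1}.
          uh = \<gamma> * q1 + (1 - \<gamma>) * q2 \<and> uh = \<nu> * \<alpha>1 + (1 - \<nu>) * \<alpha>2 \<and>
          ccv_revenue Q R uh = ereal (\<gamma> * R q1 + (1 - \<gamma>) * R q2) \<and>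
          cvx_cost A C uh = ereal (\<nu> * C \<alpha>1 + (1 - \<nu>) * C \<alpha>2) \<and>
          (\<forall>\<alpha> \<in> switching T \<tau> (\<lambda>t. return borel (\<alpha>s t)) (dirac_mix \<nu> \<alpha>1 \<alpha>2) (prob_measures_on A).
           \<forall>q \<in> switching T \<tau> (\<lambda>t. return borel (qs t)) (dirac_mix \<gamma> q1 q2) (prob_measures_on Q).
             (\<alpha>, q) \<in> relaxed_controls A Q x \<and>
             relaxed_payoff A Q R C \<beta> (\<alpha>, q) = relaxed_value A Q R C \<beta> x)"
  proof -
    have "cvx_cost A C uh \<le> ereal (uh * \<zeta> - C_conj \<zeta>)" using tight(1) by (simp add: mult.commute)
    from prod.tight_representation[OF this]
    obtain a1 a2 \<nu> where a: "prod.maximizer \<zeta> a1" "prod.maximizer \<zeta> a2" "0 < \<nu>" "\<nu> < 1"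
      "uh = \<nu> * a1 + (1 - \<nu>) * a2" "cvx_cost A C uh = ereal (\<nu> * C a1 + (1 - \<nu>) * C a2)" by metis
    have "cvx_cost Q (\<lambda>q. - R q) uh \<le> ereal (uh * (- \<zeta>) - sales.conj_fun (- \<zeta>))"
      using tight(2) unfolding ccv_revenue_eq R_conj_def
      by (cases "cvx_cost Q (\<lambda>q. - R q) uh") (auto simp: algebra_simps)
    from sales.tight_representation[OF this]
    obtain q1 q2 \<gamma> where q: "sales.maximizer (- \<zeta>) q1" "sales.maximizer (- \<zeta>) q2" "0 < \<gamma>" "\<gamma> < 1"
      "uh = \<gamma> * q1 + (1 - \<gamma>) * q2" "cvx_cost Q (\<lambda>q. - R q) uh = ereal (\<gamma> * - R q1 + (1 - \<gamma>) * - R q2)" by metis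
    have opt: "(\<alpha>, r) \<in> relaxed_controls A Q x \<and> relaxed_payoff A Q R C \<beta> (\<alpha>, r) = relaxed_value A Q R C \<beta> x"
      if s: "\<alpha> \<in> switching T \<tau> (\<lambda>t. return borel (\<alpha>s t)) (dirac_mix \<nu> a1 a2) (prob_measures_on A)"
        "r \<in> switching T \<tau> (\<lambda>t. return borel (qs t)) (dirac_mix \<gamma> q1 q2) (prob_measures_on Q)" for \<alpha> r
    proof (rule relaxed_strategy_optimal[OF x0 N a(1,2) _ _ a(5) q(1,2) _ _ q(5)])
      have Ca: "return borel y \<in> prob_measures_on A" if "y \<in> A" for y
        using dirac_mix(1)[of 1 y A y] dirac_mix_same[of 1 y] that A(1) by simp
      have Cq: "return borel y \<in> prob_measures_on Q" if "y \<in> Q" for y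
        using dirac_mix(1)[of 1 y Q y] dirac_mix_same[of 1 y] that sales.closed by simp
      have "dirac_mix \<nu> a1 a2 \<in> prob_measures_on A" "dirac_mix \<gamma> q1 q2 \<in> prob_measures_on Q"
        using dirac_mix(1) a q alpha_maximizer(1) q_maximizer(1) A(1) sales.closed less_imp_le by metis+
      from mem[OF s(1) this(1)] mem[OF s(2) this(2)] Ca Cq 2
      show "\<alpha> t \<in> prob_measures_on A \<and> r t \<in> prob_measures_on Q" if "0 \<le> t" for t using that by blast
      show "\<alpha> t = return borel (alpha_sel (?z t)) \<and> r t = return borel (q_sel (?z t))"
        if "0 \<le> t" "t \<notin> N" "t < depletion_time x" for t
        using cases[OF that(1,2)] that(3) s ctl[of t] unfolding switching_def \<tau> by auto
      show "\<alpha> t = dirac_mix \<nu> a1 a2 \<and> r t = dirac_mix \<gamma> q1 q2"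
        if "0 \<le> t" "t \<notin> N" "\<not> t < depletion_time x" for t
        using cases[OF that(1,2)] that(3) s T_lt[of t] unfolding switching_def \<tau> by auto
    qed (use a(3,4) q(3,4) in auto)
    have rev: "ccv_revenue Q R uh = ereal (\<gamma> * R q1 + (1 - \<gamma>) * R q2)"
      unfolding ccv_revenue_eq q(6) by (simp add: algebra_simps)
    show ?thesis
      apply (rule bexI[of _ q1], rule bexI[of _ q2], rule bexI[of _ a1], rule bexI[of _ a2],
          rule bexI[of _ \<gamma>], rule bexI[of _ \<nu>])
      using a q rev opt alpha_maximizer(1) q_maximizer(1) by auto
  qed
  have 4: "(\<alpha>, q) \<in> controls A Q x \<and> payoff \<beta> (ext_revenue Q R) (ext_cost A C) (\<alpha>, q) = orig_value A Q R C \<beta> x"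
    if M: "M_zeta A Q R C \<noteq> {}" and w: "w \<in> argmax_set (\<lambda>u. R u - C u) (Q \<inter> A)"
      and s: "\<alpha> \<in> switching T \<tau> \<alpha>s w A" "q \<in> switching T \<tau> qs w Q" for w \<alpha> q
  proof -
    \<comment> \<open>A rate \<open>m\<close> optimal for both sides at \<open>\<zeta>\<close> earns \<open>H(\<zeta>)\<close>, so \<open>w\<close> earns it too and is optimal for both sides.\<close>
    obtain m where "m \<in> argmax_set (\<lambda>q. R q - \<zeta> * q) Q" "m \<in> argmax_set (\<lambda>a. a * \<zeta> - C a) A"
      using M unfolding M_zeta_def by blast
    hence "sales.maximizer (- \<zeta>) m" "prod.maximizer \<zeta> m"
      unfolding argmax_set_iff sales.maximizer_def prod.maximizer_def by (auto simp: algebra_simps)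
    hence m: "m \<in> Q \<inter> A" "R m - C m = R_conj \<zeta> + C_conj \<zeta>"
      using alpha_maximizer(1,2)[of \<zeta> m] q_maximizer(1,2)[of \<zeta> m] by auto
    have wQA: "w \<in> Q" "w \<in> A" and "R m - C m \<le> R w - C w" using w m(1) unfolding argmax_set_iff by auto
    hence eq: "R w = R_conj \<zeta> + \<zeta> * w" "C w = \<zeta> * w - C_conj \<zeta>"
      using m(2) R_conj_ge[of w \<zeta>] prod.conj_fun_ge[of w \<zeta>] by (simp_all add: algebra_simps)
    show ?thesis unfolding orig_value_def
    proof (rule switching_optimal[OF x0 A(2) B ext_revenue_le ext_cost_ge _ _ _ _ _ N])
      show "ext_revenue Q R (q_sel z) = ereal (R_conj z + z * q_sel z)"
        "ext_cost A C (alpha_sel z) = ereal (z * alpha_sel z - C_conj z)" for z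
        using selA(2,4)[of z] selQ(2,4)[of z] by simp_all
      show "0 \<le> w" using wQA A(2) by auto
      show "ext_revenue Q R w = ereal (R_conj \<zeta> + \<zeta> * w)" "ext_cost A C w = ereal (\<zeta> * w - C_conj \<zeta>)"
        using wQA eq by (simp_all add: ext_revenue_def ext_cost_def)
      show "\<alpha> t \<in> A \<and> q t \<in> Q" if "0 \<le> t" for t
        using mem[OF s(1) wQA(2)] mem[OF s(2) wQA(1)] 2 that by blast
      show "\<alpha> t = switch x alpha_sel (\<lambda>_. w) t \<and> q t = switch x q_sel (\<lambda>_. w) t" if "0 \<le> t" "t \<notin> N" for t
        by (rule agree[OF s that])
    qed
  qed
  show ?thesis
    using 1 2 3 4 unfolding Let_def T_def \<alpha>s_def qs_def X_def \<tau>_def by blast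
qed

end
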